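(* Let $\mathscr{A}$ be a ring with $\mathbb{C}[z]\subseteq \mathscr{A}\subseteq \mathscr{H}_{\rm fin}$ such that every $f\in\mathscr{A}$ is lacunary. Then the set $\mathbb{Z}\subseteq\mathscr{A}$ (the integer constant functions) is positive existentially definable in $\mathscr{A}$ over the language $\mathscr{L}_z=\{0,1,z,+,\times,=\}$. In particular, the positive existential theory of $\mathscr{A}$ over $\mathscr{L}_z$ is undecidable.
   Context: $\mathscr{H}_{\rm fin}$ is the ring of complex entire functions $f$ of one variable $z$ of finite order, i.e. such that there is $A\ge0$ with $\log\max\{|f(z)|:|z|\le r\}=O_f(r^A)$ for all $r>1$. A power series $F=\sum_{n\ge0}a_nz^n$ is lacunary if for every $M\ge1$ there is $N$ such that $a_{N+j}=0$ for all $j=1,\dots,M$; a function holomorphic near $0$ is lacunary if its power series expansion at $z=0$ is. A ring $\mathscr{A}\supseteq\mathbb{C}[z]$ is regarded as an $\mathscr{L}_z$-structure with the constant symbol $z$ interpreted as the identity function. Positive existentially definable means definable by a formula $\exists y_1\dots\exists y_m\,\phi$ where $\phi$ is a finite conjunction/disjunction of polynomial equations in the language $\mathscr{L}_z$. *)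

theory Defs
  imports "HOL-Complex_Analysis.Complex_Analysis" "HOL-Library.Nat_Bijection"
begin

definition fun_subring :: "(complex \<Rightarrow> complex) set \<Rightarrow> bool" where
  "fun_subring A \<longleftrightarrow>
     (\<lambda>_. 0) \<in> A \<and> (\<lambda>_. 1) \<in> A \<and>
     (\<forall>f\<in>A. (\<lambda>z. - f z) \<in> A) \<and>
     (\<forall>f\<in>A. \<forall>g\<in>A. (\<lambda>z. f z + g z) \<in> A) \<and>
     (\<forall>f\<in>A. \<forall>g\<in>A. (\<lambda>z. f z * g z) \<in> A)"

definition poly_funs :: "(complex \<Rightarrow> complex) set" where
  "poly_funs = range (\<lambda>p :: complex poly. poly p)"

text \<open>The supremum below is the maximum modulus of \<open>f\<close> on the closed disc of radius \<open>r\<close>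
  (attained, by compactness).  The zero function is included, as \<open>ln 0 = 0\<close>.\<close>

definition H_fin :: "(complex \<Rightarrow> complex) set" where
  "H_fin = {f. f holomorphic_on UNIV \<and>
     (\<exists>a::real. a \<ge> 0 \<and> (\<exists>C::real. \<forall>r>1.
        \<bar>ln (SUP z\<in>cball 0 r. norm (f z))\<bar> \<le> C * r powr a))}"

definition lacunary_fps :: "complex fps \<Rightarrow> bool" where
  "lacunary_fps F \<longleftrightarrow> (\<forall>M\<ge>1. \<exists>N. \<forall>j\<in>{1..M}. fps_nth F (N + j) = 0)"

definition lacunary :: "(complex \<Rightarrow> complex) \<Rightarrow> bool" where
  "lacunary f \<longleftrightarrow> lacunary_fps (fps_expansion f 0)"

definition integer_constants :: "(complex \<Rightarrow> complex) set" where
  "integer_constants = range (\<lambda>k :: int. \<lambda>_. of_int k)"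

datatype tm = Var nat | Zero | One | Z | Add tm tm | Mul tm tm

datatype qf = Eq tm tm | Conj qf qf | Disj qf qf

text \<open>A prefix of existential quantifiers (over named variables) in front of a
  quantifier-free matrix.\<close>

datatype pe = Matrix qf | Ex nat pe

primrec tm_val :: "(nat \<Rightarrow> complex \<Rightarrow> complex) \<Rightarrow> tm \<Rightarrow> complex \<Rightarrow> complex" where
  "tm_val v (Var i) = v i"
| "tm_val v Zero = (\<lambda>_. 0)"
| "tm_val v One = (\<lambda>_. 1)"
| "tm_val v Z = (\<lambda>z. z)"
| "tm_val v (Add s t) = (\<lambda>z. tm_val v s z + tm_val v t z)"
| "tm_val v (Mul s t) = (\<lambda>z. tm_val v s z * tm_val v t z)"

primrec qf_sat :: "(nat \<Rightarrow> complex \<Rightarrow> complex) \<Rightarrow> qf \<Rightarrow> bool" where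
  "qf_sat v (Eq s t) \<longleftrightarrow> tm_val v s = tm_val v t"
| "qf_sat v (Conj p q) \<longleftrightarrow> qf_sat v p \<and> qf_sat v q"
| "qf_sat v (Disj p q) \<longleftrightarrow> qf_sat v p \<or> qf_sat v q"

primrec pe_sat ::
  "(complex \<Rightarrow> complex) set \<Rightarrow> (nat \<Rightarrow> complex \<Rightarrow> complex) \<Rightarrow> pe \<Rightarrow> bool" where
  "pe_sat A v (Matrix p) \<longleftrightarrow> qf_sat v p"
| "pe_sat A v (Ex i p) \<longleftrightarrow> (\<exists>y\<in>A. pe_sat A (v(i := y)) p)"

primrec tm_vars :: "tm \<Rightarrow> nat set" where
  "tm_vars (Var i) = {i}"
| "tm_vars Zero = {}"
| "tm_vars One = {}"
| "tm_vars Z = {}"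
| "tm_vars (Add s t) = tm_vars s \<union> tm_vars t"
| "tm_vars (Mul s t) = tm_vars s \<union> tm_vars t"

primrec qf_vars :: "qf \<Rightarrow> nat set" where
  "qf_vars (Eq s t) = tm_vars s \<union> tm_vars t"
| "qf_vars (Conj p q) = qf_vars p \<union> qf_vars q"
| "qf_vars (Disj p q) = qf_vars p \<union> qf_vars q"

primrec pe_free :: "pe \<Rightarrow> nat set" where
  "pe_free (Matrix p) = qf_vars p"
| "pe_free (Ex i p) = pe_free p - {i}"

lemma tm_val_cong: "(\<And>i. i \<in> tm_vars t \<Longrightarrow> v i = w i) \<Longrightarrow> tm_val v t = tm_val w t"
  by (induction t) auto

lemma qf_sat_cong: "(\<And>i. i \<in> qf_vars p \<Longrightarrow> v i = w i) \<Longrightarrow> qf_sat v p = qf_sat w p"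
proof (induction p)
  case (Eq s t)
  then have "tm_val v s = tm_val w s" "tm_val v t = tm_val w t"
    by (auto intro!: tm_val_cong)
  then show ?case by simp
qed auto

lemma pe_sat_cong:
  "(\<And>i. i \<in> pe_free p \<Longrightarrow> v i = w i) \<Longrightarrow> pe_sat A v p = pe_sat A w p"
proof (induction p arbitrary: v w)
  case (Matrix p)
  have "qf_sat v p = qf_sat w p"
    by (rule qf_sat_cong) (use Matrix in simp)
  then show ?case by simp
next
  case (Ex i p)
  have "pe_sat A (v(i := y)) p = pe_sat A (w(i := y)) p" for y
    using Ex.prems by (intro Ex.IH) auto
  then show ?case by simp
qed

text \<open>Definability is without parameters: only the variable \<open>0\<close> may be free.  By
  \<open>pe_sat_cong\<close>, the values of the assignment at other variables are irrelevant.\<close>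

definition pe_definable :: "(complex \<Rightarrow> complex) set \<Rightarrow> (complex \<Rightarrow> complex) set \<Rightarrow> bool" where
  "pe_definable A S \<longleftrightarrow>
     (\<exists>p. pe_free p \<subseteq> {0} \<and> S = {f \<in> A. pe_sat A (\<lambda>_. f) p})"

definition pe_theory :: "(complex \<Rightarrow> complex) set \<Rightarrow> pe set" where
  "pe_theory A = {p. pe_free p = {} \<and> pe_sat A (\<lambda>_ _. 0) p}"

text \<open>Total recursive functions of arity \<open>n\<close>, on lists of length \<open>n\<close>; minimisation is
  applied only to regular functions.  Values on lists of other lengths carry no meaning.\<close>

inductive recursive_fun :: "nat \<Rightarrow> (nat list \<Rightarrow> nat) \<Rightarrow> bool" where
  zero: "recursive_fun n (\<lambda>_. 0)"
| succ: "recursive_fun 1 (\<lambda>xs. Suc (xs ! 0))"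
| proj: "i < n \<Longrightarrow> recursive_fun n (\<lambda>xs. xs ! i)"
| comp: "recursive_fun (length gs) f \<Longrightarrow> \<forall>g\<in>set gs. recursive_fun n g \<Longrightarrow>
    recursive_fun n (\<lambda>xs. f (map (\<lambda>g. g xs) gs))"
| prim_rec: "recursive_fun n f \<Longrightarrow> recursive_fun (Suc (Suc n)) g \<Longrightarrow>
    recursive_fun (Suc n)
      (\<lambda>xs. rec_nat (f (tl xs)) (\<lambda>k r. g (k # r # tl xs)) (hd xs))"
| minimisation: "recursive_fun (Suc n) f \<Longrightarrow>
    \<forall>xs. length xs = n \<longrightarrow> (\<exists>k. f (k # xs) = 0) \<Longrightarrow>
    recursive_fun n (\<lambda>xs. LEAST k. f (k # xs) = 0)"

definition decidable_nat_set :: "nat set \<Rightarrow> bool" where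
  "decidable_nat_set S \<longleftrightarrow>
     (\<exists>f. recursive_fun 1 f \<and> (\<forall>n. f [n] = (if n \<in> S then 1 else 0)))"

text \<open>A Goedel numbering by the Cantor pairing function \<open>prod_encode\<close>, the first component
  being a tag for the outermost constructor.\<close>

primrec tm_code :: "tm \<Rightarrow> nat" where
  "tm_code (Var i) = prod_encode (0, i)"
| "tm_code Zero = prod_encode (1, 0)"
| "tm_code One = prod_encode (2, 0)"
| "tm_code Z = prod_encode (3, 0)"
| "tm_code (Add s t) = prod_encode (4, prod_encode (tm_code s, tm_code t))"
| "tm_code (Mul s t) = prod_encode (5, prod_encode (tm_code s, tm_code t))"

primrec qf_code :: "qf \<Rightarrow> nat" where
  "qf_code (Eq s t) = prod_encode (0, prod_encode (tm_code s, tm_code t))"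
| "qf_code (Conj p q) = prod_encode (1, prod_encode (qf_code p, qf_code q))"
| "qf_code (Disj p q) = prod_encode (2, prod_encode (qf_code p, qf_code q))"

primrec pe_code :: "pe \<Rightarrow> nat" where
  "pe_code (Matrix p) = prod_encode (0, qf_code p)"
| "pe_code (Ex i p) = prod_encode (1, prod_encode (i, pe_code p))"

lemma tm_code_inject: "tm_code s = tm_code t \<longleftrightarrow> s = t"
proof (induction s arbitrary: t)
  case (Var i) then show ?case by (cases t) auto
next
  case Zero then show ?case by (cases t) auto
next
  case One then show ?case by (cases t) auto
next
  case Z then show ?case by (cases t) auto
next
  case (Add s1 s2) then show ?case by (cases t) auto
next
  case (Mul s1 s2) then show ?case by (cases t) auto
qed

lemma qf_code_inject: "qf_code p = qf_code q \<longleftrightarrow> p = q"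
proof (induction p arbitrary: q)
  case (Eq s t) then show ?case by (cases q) (auto simp: tm_code_inject)
next
  case (Conj p1 p2) then show ?case by (cases q) auto
next
  case (Disj p1 p2) then show ?case by (cases q) auto
qed

lemma inj_pe_code: "inj pe_code"
proof (rule injI)
  show "p = q" if "pe_code p = pe_code q" for p q
    using that
  proof (induction p arbitrary: q)
    case (Matrix p) then show ?case by (cases q) (auto simp: qf_code_inject)
  next
    case (Ex i p) then show ?case by (cases q) auto
  qed
qed

definition pe_theory_decidable :: "(complex \<Rightarrow> complex) set \<Rightarrow> bool" where
  "pe_theory_decidable A \<longleftrightarrow> decidable_nat_set (pe_code ` pe_theory A)"

end

(* The solutions in A of the Pell equation X^2 - (z^2 - 1) Y^2 = 1 are the Chebyshev pairs up to
   sign. Finite order makes W = X'/Y a polynomial, through a logarithmic derivative estimate for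
   X + sqrt(z^2 - 1) Y. Then X satisfies a linear differential equation with polynomial
   coefficients, so a long gap in its power series yields a polynomial solution, and comparing
   degrees shows that W is a constant with W^2 = n^2. Hence Y(1) is an integer. In the same way
   the units of A are constants.

   Evaluating Chebyshev pairs at constants makes exponentiation of natural numbers definable, so
   binomial coefficients and factorials are definable, and a bounded universal quantifier in
   front of a polynomial Diophantine relation can be eliminated (Davis, Putnam, Robinson). By
   Goedel's beta function every recursive function has a graph in Davis normal form, and a
   diagonal sentence refutes decidability. *)

theory Submission
  imports Defs "HOL-Number_Theory.Cong"
begin

section \<open>Growth and lacunarity of entire functions\<close>

text \<open>Two obstacles shape the proof. The function X + sqrt(z^2 - 1) Y has no global branch, so
  its logarithmic derivative is estimated separately on unit discs away from 1 and -1, where it is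
  invertible with inverse X - sqrt(z^2 - 1) Y; the factor sqrt(z^2 - 1) then turns it into an entire
  function W that is the same for both branches. The second obstacle is that a bounded quantifier is
  eliminated by means of congruences, which polynomials respect and exponentials do not.
  Exponentiation must therefore stay outside the quantifier: relations given by polynomials over the
  naturals (\<open>ndioph\<close>) are kept apart from those expressible in the ring
  (\<open>adioph\<close>), and a recursive graph is first given one bounded quantifier in front of a
  polynomial matrix. Values at a constant \<alpha> are expressed by divisibility by z - \<alpha>
  inside the ring. The cofactors that have to exist belong to Chebyshev pairs and are polynomials,
  so they lie in the ring although it need not be closed under division.\<close>

lemma logarithmic_derivative_bound:
  fixes \<phi> \<psi> :: "complex \<Rightarrow> complex"
  assumes hol: "\<phi> holomorphic_on ball z0 1"
    and inv: "\<And>z. z \<in> ball z0 1 \<Longrightarrow> \<phi> z * \<psi> z = 1"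
    and le: "\<And>z. z \<in> ball z0 1 \<Longrightarrow> norm (\<phi> z) \<le> exp K"
      "\<And>z. z \<in> ball z0 1 \<Longrightarrow> norm (\<psi> z) \<le> exp K"
    and "K > 0"
  shows "norm (deriv \<phi> z0 * \<psi> z0) \<le> 6 * K"
proof -
  have nz: "\<phi> z \<noteq> 0" if "z \<in> ball z0 1" for z
    using inv[OF that] by auto
  obtain h where h: "h holomorphic_on ball z0 1" "\<And>z. z \<in> ball z0 1 \<Longrightarrow> \<phi> z = exp (h z)"
    using simply_connected_eq_holomorphic_log[of "ball z0 1"] hol nz
      convex_imp_simply_connected[of "ball z0 1"] by (metis convex_ball open_ball)
  have Re: "\<bar>Re (h z)\<bar> \<le> K" if "z \<in> ball z0 1" for z
  proof -
    have "norm (\<phi> z) = exp (Re (h z))" by (simp add: h(2)[OF that])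
    moreover have "\<psi> z = exp (- h z)"
      using inv[OF that] by (simp add: h(2)[OF that] exp_minus field_simps)
    then have "norm (\<psi> z) = exp (- Re (h z))" by simp
    ultimately show ?thesis using le[OF that] by simp
  qed
  \<comment> \<open>A Borel-Caratheodory estimate at the centre: u -> u / (6K - u) maps the
    half-plane Re u < 3K into the unit disc and fixes 0. Since Re q <= 2K, the Schwarz lemma applies
    to \<open>F\<close>, whose derivative at 0 is h'(z0) / (6K).\<close>
  define q where "q = (\<lambda>w. h (z0 + w) - h z0)"
  define F where "F = (\<lambda>w. q w / (6 * of_real K - q w))"
  have q_hol: "q holomorphic_on ball 0 1"
  proof -
    have "(h \<circ> (\<lambda>w. z0 + w)) holomorphic_on ball 0 1"
      by (rule holomorphic_on_compose_gen[OF _ h(1)])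
        (auto intro!: holomorphic_intros simp: dist_norm)
    then show ?thesis unfolding q_def o_def by (intro holomorphic_intros)
  qed
  have Re_q: "Re (q w) \<le> 2 * K" if "norm w < 1" for w
    using Re[of "z0 + w"] Re[of z0] that by (simp add: q_def dist_norm)
  have den: "6 * of_real K - q w \<noteq> 0" if "norm w < 1" for w
  proof
    assume "6 * of_real K - q w = 0"
    then have "Re (q w) = 6 * K" by (simp add: complex_eq_iff)
    with Re_q[OF that] \<open>K > 0\<close> show False by simp
  qed
  have F_hol: "F holomorphic_on ball 0 1"
    unfolding F_def using den by (intro holomorphic_intros q_hol) auto
  have "norm (F w) < 1" if "norm w < 1" for w
  proof -
    have "(norm (q w))\<^sup>2 < (norm (6 * of_real K - q w))\<^sup>2"
    proof -
      have "0 < 12 * K * (3 * K - Re (q w))"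
        using Re_q[OF that] \<open>K > 0\<close> by (intro mult_pos_pos) auto
      then show ?thesis
        unfolding cmod_power2 by (simp add: power2_eq_square algebra_simps)
    qed
    then have "norm (q w) < norm (6 * of_real K - q w)"
      by (rule power2_less_imp_less) simp
    then show ?thesis
      using den[OF that] by (simp add: F_def norm_divide divide_simps)
  qed
  moreover have "F 0 = 0" by (simp add: F_def q_def)
  ultimately have bd: "norm (deriv F 0) \<le> 1"
    by (intro Schwarz_Lemma(2)[OF F_hol, of 0]) auto
  have dh: "(h has_field_derivative deriv h z0) (at z0)"
    using h(1) by (intro holomorphic_derivI[of _ "ball z0 1"]) auto
  then have "(h has_field_derivative deriv h z0) (at (0 + z0))" by simp
  then have "((\<lambda>w. h (w + z0)) has_field_derivative deriv h z0) (at 0)"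
    by (subst (asm) DERIV_shift)
  then have dq: "(q has_field_derivative deriv h z0) (at 0)"
    unfolding q_def by (auto intro!: derivative_eq_intros simp: add.commute)
  have q0: "q 0 = 0" by (simp add: q_def)
  have "(F has_field_derivative deriv h z0 / (6 * of_real K)) (at 0)"
    unfolding F_def using den[of 0] \<open>K > 0\<close>
    by (auto intro!: derivative_eq_intros dq simp: q0 divide_simps)
  then have "deriv F 0 = deriv h z0 / (6 * of_real K)" by (rule DERIV_imp_deriv)
  with bd have "norm (deriv h z0) \<le> 6 * K"
    using \<open>K > 0\<close> by (simp add: norm_divide divide_simps)
  moreover have "deriv \<phi> z0 * \<psi> z0 = deriv h z0"
  proof -
    have "(\<phi> has_field_derivative exp (h z0) * deriv h z0) (at z0)"
    proof (rule has_field_derivative_transform_within_open[of "\<lambda>z. exp (h z)" _ _ "ball z0 1"])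
      show "((\<lambda>z. exp (h z)) has_field_derivative exp (h z0) * deriv h z0) (at z0)"
        by (auto intro!: derivative_eq_intros dh)
    qed (auto simp: h(2))
    then have "deriv \<phi> z0 = \<phi> z0 * deriv h z0"
      by (simp add: DERIV_imp_deriv h(2))
    then show ?thesis using inv[of z0] by (simp add: algebra_simps)
  qed
  ultimately show ?thesis by simp
qed

section \<open>Pointwise growth bounds and truncation of lacunary series\<close>

lemma H_fin_growth:
  assumes "f \<in> H_fin"
  obtains C k where "C > 0" "\<And>z. norm (f z) \<le> exp (C * (norm z + 2) ^ k)"
proof -
  from assms obtain a C where hol: "f holomorphic_on UNIV" and "a \<ge> 0"
    and C: "\<And>r. r > 1 \<Longrightarrow> \<bar>ln (SUP z\<in>cball 0 r. norm (f z))\<bar> \<le> C * r powr a"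
    unfolding H_fin_def by blast
  define k where "k = nat \<lceil>a\<rceil>"
  have "norm (f z) \<le> exp (max C 1 * (norm z + 2) ^ k)" for z
  proof (cases "f z = 0")
    case False
    \<comment> \<open>The definition of finite order speaks only of radii above 1. The shift by 2
      also keeps the base of the power at least 1, so exponents may be enlarged freely.\<close>
    define r where "r = norm z + 2"
    define S where "S = (SUP z\<in>cball 0 r. norm (f z))"
    have r: "r > 1" by (simp add: r_def add_pos_nonneg)
    have "compact ((\<lambda>z. norm (f z)) ` cball 0 r)"
      by (intro compact_continuous_image continuous_intros holomorphic_on_imp_continuous_on
          holomorphic_on_subset[OF hol]) auto
    then have "bdd_above ((\<lambda>z. norm (f z)) ` cball 0 r)"
      by (intro bounded_imp_bdd_above compact_imp_bounded)
    then have fS: "norm (f z) \<le> S"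
      unfolding S_def by (intro cSUP_upper) (auto simp: r_def)
    have "ln (norm (f z)) \<le> ln S"
      using False fS by (intro ln_mono) auto
    also have "\<dots> \<le> C * r powr a" using C[OF r] by (simp add: S_def)
    also have "\<dots> \<le> max C 1 * r powr a" by (intro mult_right_mono) auto
    also have "\<dots> \<le> max C 1 * r ^ k"
    proof (intro mult_left_mono)
      have "r powr a \<le> r powr real k"
        using r by (intro powr_mono) (auto simp: k_def real_nat_ceiling_ge)
      then show "r powr a \<le> r ^ k" using r by (simp add: powr_realpow)
    qed auto
    finally have "exp (ln (norm (f z))) \<le> exp (max C 1 * r ^ k)" by simp
    then show ?thesis using False by (simp add: r_def)
  qed auto
  then show ?thesis using that[of "max C 1" k] by simp
qed

lemma polynomial_growth_imp_poly:
  assumes "f holomorphic_on UNIV"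
    and "\<And>z. norm z \<ge> R \<Longrightarrow> norm (f z) \<le> B * (norm z + b) ^ k" "b \<ge> 0" "B \<ge> 0"
  obtains p where "f = poly p"
proof -
  have bd: "norm (f z) \<le> (B * 2 ^ k) * norm z ^ k" if "max R b \<le> norm z" for z
  proof -
    have "norm (f z) \<le> B * (norm z + b) ^ k" using assms(2) that by simp
    also have "\<dots> \<le> B * (2 * norm z) ^ k"
      using that assms(3,4) by (intro mult_left_mono power_mono) auto
    finally show ?thesis by (simp add: power_mult_distrib)
  qed
  define p where "p = (\<Sum>i\<le>k. monom ((deriv ^^ i) f 0 / fact i) i)"
  have "f z = poly p z" for z
    unfolding p_def poly_sum poly_monom
    by (rule Liouville_polynomial[OF assms(1) bd])
  then show ?thesis using that by blast
qed

text \<open>For a differential operator with polynomial coefficients that annihilates f: if it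
  raises degrees by less than the gap, its value on \<open>T\<close> agrees with its value on the
  series in every degree where it could be nonzero. So \<open>T\<close> is a polynomial
  solution.\<close>

lemma lacunary_truncation:
  assumes hol: "f holomorphic_on UNIV" and lac: "lacunary f" and nz: "\<exists>z. f z \<noteq> 0"
  obtains N T where "T \<noteq> 0" "degree T \<le> N"
    "\<And>k. k \<le> N + M \<Longrightarrow> fps_nth (fps_expansion f 0) k = coeff T k"
proof -
  define F where "F = fps_expansion f 0"
  have an: "f analytic_on {0}"
    using hol by (meson analytic_on_holomorphic open_UNIV subset_UNIV)
  then have exp: "f has_fps_expansion F"
    unfolding F_def by (rule analytic_at_imp_has_fps_expansion_0)
  have "F \<noteq> 0"
  proof
    assume "F = 0"
    with exp have "eventually (\<lambda>z. f z = 0) (nhds 0)" by (simp add: has_fps_expansion_0_iff)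
    then obtain S where S: "open S" "0 \<in> S" "\<And>z. z \<in> S \<Longrightarrow> f z = 0"
      by (auto simp: eventually_nhds)
    have "f z = 0" for z
      by (rule analytic_continuation_open[of S UNIV f "\<lambda>_. 0"])
        (use S hol in \<open>auto intro: holomorphic_intros\<close>)
    with nz show False by auto
  qed
  \<comment> \<open>A gap might lie before the first nonzero coefficient, and then the truncation
    would vanish. Making the gap longer than the subdegree puts that coefficient among those on
    which F and \<open>T\<close> agree.\<close>
  define M' where "M' = M + subdegree F + 1"
  obtain N where N: "\<And>j. j \<in> {1..M'} \<Longrightarrow> fps_nth F (N + j) = 0"
    using lac unfolding lacunary_def lacunary_fps_def F_def[symmetric] M'_def
    by (metis le_add2)
  define T where "T = truncate_fps (Suc N) F"
  have coT: "coeff T k = (if k \<le> N then fps_nth F k else 0)" for k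
    by (auto simp: T_def)
  have eq: "fps_nth F k = coeff T k" if "k \<le> N + M'" for k
    proof (cases "k \<le> N")
    case False
    then have "fps_nth F (N + (k - N)) = 0" using that by (intro N) auto
    with False show ?thesis by (simp add: coT)
  qed (simp add: coT)
  show ?thesis
  proof
    have "fps_nth F (subdegree F) = coeff T (subdegree F)"
      by (rule eq) (simp add: M'_def)
    then show "T \<noteq> 0" using \<open>F \<noteq> 0\<close> by auto
    show "degree T \<le> N" by (intro degree_le) (auto simp: coT)
    show "fps_nth (fps_expansion f 0) k = coeff T k" if "k \<le> N + M" for k
      using eq[of k] that by (simp add: F_def M'_def)
  qed
qed

lemma H_fin_growth_common:
  assumes "f \<in> H_fin" "g \<in> H_fin"
  obtains C k where "C > 0" "\<And>z. norm (f z) \<le> exp (C * (norm z + 2) ^ k)"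
    "\<And>z. norm (g z) \<le> exp (C * (norm z + 2) ^ k)"
proof -
  obtain C1 k1 where 1: "C1 > 0" "\<And>z. norm (f z) \<le> exp (C1 * (norm z + 2) ^ k1)"
    using H_fin_growth[OF assms(1)] by metis
  obtain C2 k2 where 2: "C2 > 0" "\<And>z. norm (g z) \<le> exp (C2 * (norm z + 2) ^ k2)"
    using H_fin_growth[OF assms(2)] by metis
  have le: "exp (C * (norm z + 2) ^ k) \<le> exp (max C1 C2 * (norm z + 2) ^ max k1 k2)"
    if "C \<le> max C1 C2" "k \<le> max k1 k2" for C k and z :: complex
  proof -
    have "C * (norm z + 2) ^ k \<le> max C1 C2 * (norm z + 2) ^ k"
      using that by (intro mult_right_mono) auto
    also have "\<dots> \<le> max C1 C2 * (norm z + 2) ^ max k1 k2"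
      using that 1 by (intro mult_left_mono power_increasing) auto
    finally show ?thesis by simp
  qed
  show ?thesis
    using 1 by (intro that[of "max C1 C2" "max k1 k2"]
        order_trans[OF 1(2) le] order_trans[OF 2(2) le]) auto
qed

lemma growth_on_unit_ball:
  assumes "\<And>z :: complex. norm (f z :: complex) \<le> exp (C * (norm z + 2) ^ k)" "C > 0" "z \<in> ball z0 1"
  shows "norm (f z) \<le> exp (C * (norm z0 + 3) ^ k)"
proof -
  have "norm z \<le> norm z0 + 1"
    using assms(3) norm_triangle_ineq2[of z z0] by (simp add: dist_norm norm_minus_commute)
  then have "C * (norm z + 2) ^ k \<le> C * (norm z0 + 3) ^ k"
    using assms(2) by (intro mult_left_mono power_mono) auto
  with assms(1)[of z] show ?thesis by (meson exp_le_cancel_iff order_trans)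
qed

section \<open>Power series of entire functions, and units of finite order\<close>

lemma entire_has_fps_expansion:
  assumes "f holomorphic_on UNIV"
  shows "f has_fps_expansion fps_expansion f 0"
  using assms by (intro analytic_at_imp_has_fps_expansion_0)
    (meson analytic_on_holomorphic open_UNIV subset_UNIV)

lemma has_fps_expansion_poly:
  "poly p has_fps_expansion fps_of_poly (p :: complex poly)"
proof (induction p)
  case (pCons a p)
  have "(\<lambda>x. a + x * poly p x) has_fps_expansion fps_const a + fps_X * fps_of_poly p"
    by (intro fps_expansion_intros pCons)
  then show ?case by (simp add: fps_of_poly_pCons mult.commute add.commute)
qed (simp add: fps_expansion_intros)

lemma fps_mult_nth_cong:
  assumes "\<And>k. k \<le> n \<Longrightarrow> fps_nth F k = fps_nth G k"
  shows "k \<le> n \<Longrightarrow> fps_nth (H * F) k = fps_nth (H * G) k"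
  using assms by (auto simp: fps_mult_nth intro!: sum.cong)

lemma fps_deriv_nth_cong:
  assumes "\<And>k. k \<le> Suc n \<Longrightarrow> fps_nth F k = fps_nth G k"
  shows "k \<le> n \<Longrightarrow> fps_nth (fps_deriv F) k = fps_nth (fps_deriv G) k"
  using assms by simp

text \<open>As g = 1/f, the entire function f' g is the logarithmic derivative of f. The bound on
  unit discs gives it polynomial growth, so it is a polynomial.\<close>

lemma fin_order_unit_deriv:
  assumes "f \<in> H_fin" "g \<in> H_fin" and fg: "\<And>z. f z * g z = 1"
  obtains w where "\<And>z. deriv f z = poly w z * f z"
proof -
  have hol: "f holomorphic_on UNIV" "g holomorphic_on UNIV"
    using assms by (auto simp: H_fin_def)
  obtain C k where C: "C > 0" "\<And>z. norm (f z) \<le> exp (C * (norm z + 2) ^ k)"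
    "\<And>z. norm (g z) \<le> exp (C * (norm z + 2) ^ k)"
    using H_fin_growth_common[OF assms(1,2)] by metis
  have "norm (deriv f z * g z) \<le> 6 * (C * (norm z + 3) ^ k)" for z
  proof (rule logarithmic_derivative_bound)
    show "f holomorphic_on ball z 1" using hol by (auto intro: holomorphic_on_subset)
    have "norm z + 3 > 0" by (simp add: add_nonneg_pos)
    then show "C * (norm z + 3) ^ k > 0" using C(1) by simp
  qed (use fg C in \<open>auto intro: growth_on_unit_ball\<close>)
  then obtain w where w: "(\<lambda>z. deriv f z * g z) = poly w"
    using C(1) polynomial_growth_imp_poly[of "\<lambda>z. deriv f z * g z" 0 "6 * C" 3 k]
    by (auto intro!: holomorphic_intros hol simp: mult.assoc)
  have "deriv f z = poly w z * f z" for z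
  proof -
    have "deriv f z = deriv f z * g z * f z" using fg[of z] by (simp add: algebra_simps)
    then show ?thesis by (metis w)
  qed
  then show ?thesis using that by blast
qed

text \<open>The truncation of f at a long gap satisfies T' = w T exactly. If w were nonzero, the
  right side would have larger degree than the left; so w = 0 and f' = 0.\<close>

lemma lacunary_unit_const:
  assumes "f \<in> H_fin" "g \<in> H_fin" and fg: "\<And>z. f z * g z = 1" and lac: "lacunary f"
  shows "f = (\<lambda>_. f 0)"
proof -
  have hol: "f holomorphic_on UNIV" using assms by (auto simp: H_fin_def)
  obtain w where w: "\<And>z. deriv f z = poly w z * f z"
    using fin_order_unit_deriv[OF assms(1-3)] by metis
  define F where "F = fps_expansion f 0"
  have F: "f has_fps_expansion F" unfolding F_def by (rule entire_has_fps_expansion[OF hol])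
  have "deriv f has_fps_expansion fps_deriv F" by (rule has_fps_expansion_deriv[OF F])
  moreover have "deriv f has_fps_expansion fps_of_poly w * F"
    unfolding w by (intro fps_expansion_intros has_fps_expansion_poly F)
  ultimately have ode: "fps_deriv F = fps_of_poly w * F"
    by (rule fps_expansion_unique_complex)
  have "\<exists>z. f z \<noteq> 0" using fg[of 0] by (metis mult_zero_left zero_neq_one)
  \<comment> \<open>Multiplication by w raises degrees by \<open>degree w\<close>; the extra 1 pays
    for the index shift of the derivative.\<close>
  then obtain N T where T: "T \<noteq> 0" "degree T \<le> N"
    "\<And>k. k \<le> N + (degree w + 1) \<Longrightarrow> fps_nth F k = coeff T k"
    using lacunary_truncation[OF hol lac, of "degree w + 1"] unfolding F_def by metis
  have "coeff (pderiv T) k = coeff (w * T) k" for k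
  proof (cases "k \<le> N + degree w")
    case True
    have "fps_nth (fps_deriv F) k = coeff (pderiv T) k"
      using fps_deriv_nth_cong[of "N + degree w" F "fps_of_poly T" k] T(3) True
      by (simp add: coeff_pderiv)
    moreover have "fps_nth (fps_of_poly w * F) k = coeff (w * T) k"
      using fps_mult_nth_cong[of "N + degree w" F "fps_of_poly T" k "fps_of_poly w"] T(3) True
      by (simp flip: fps_of_poly_mult)
    ultimately show ?thesis using ode by simp
  next
    case False
    then have "degree (w * T) < k" "degree (pderiv T) < k"
      using degree_mult_le[of w T] T(2) by (auto simp: degree_pderiv)
    then show ?thesis by (simp add: coeff_eq_0)
  qed
  then have eq: "pderiv T = w * T" by (simp add: poly_eq_iff)
  have "w = 0"
  proof (rule ccontr)
    assume "w \<noteq> 0"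
    then have "pderiv T \<noteq> 0" using eq T(1) by simp
    then have "degree T \<noteq> 0" by (auto simp: pderiv_eq_0_iff)
    moreover have "degree (pderiv T) = degree w + degree T"
      unfolding eq using \<open>w \<noteq> 0\<close> T(1) by (rule degree_mult_eq)
    ultimately show False by (simp add: degree_pderiv)
  qed
  then have "(f has_field_derivative 0) (at z)" for z
    using w[of z] hol by (metis UNIV_I holomorphic_derivI mult_zero_left open_UNIV poly_0)
  then have "f z = f 0" for z
    using has_field_derivative_zero_constant[of UNIV f] by (metis UNIV_I convex_UNIV has_field_derivative_at_within)
  then show ?thesis by (intro ext) simp
qed

section \<open>The Pell equation over entire functions\<close>

locale entire_pell =
  fixes X Y :: "complex \<Rightarrow> complex"
  assumes hol: "X holomorphic_on UNIV" "Y holomorphic_on UNIV"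
    and pell: "\<And>z. X z ^ 2 - (z ^ 2 - 1) * Y z ^ 2 = 1"
begin

text \<open>This is s (s Y)' for s = sqrt(z^2 - 1), written without a branch by means of s s' =
  z.\<close>

definition V :: "complex \<Rightarrow> complex" where "V z = z * Y z + (z ^ 2 - 1) * deriv Y z"

text \<open>\<open>W = sqrt (z\<^sup>2 - 1) * \<phi>' / \<phi>\<close> for \<open>\<phi> = X + sqrt (z\<^sup>2 - 1) * Y\<close>.\<close>
definition W :: "complex \<Rightarrow> complex" where "W z = X z * V z - (z ^ 2 - 1) * Y z * deriv X z"

lemma DERIV_X: "(X has_field_derivative deriv X z) (at z)"
  and DERIV_Y: "(Y has_field_derivative deriv Y z) (at z)"
  using hol by (auto intro: holomorphic_derivI)

lemma X_deriv_X: "X z * deriv X z = Y z * V z"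
proof -
  have "((\<lambda>z. X z ^ 2 - (z ^ 2 - 1) * Y z ^ 2) has_field_derivative
      2 * (X z * deriv X z) - 2 * (Y z * V z)) (at z)"
    by (auto intro!: derivative_eq_intros DERIV_X DERIV_Y simp: V_def algebra_simps power2_eq_square)
  moreover have "((\<lambda>z. X z ^ 2 - (z ^ 2 - 1) * Y z ^ 2) has_field_derivative 0) (at z)"
    unfolding pell by simp
  ultimately have "2 * (X z * deriv X z) - 2 * (Y z * V z) = 0" by (rule DERIV_unique)
  then show ?thesis by simp
qed

text \<open>Together with \<open>V_eq\<close> this is the first-order system of the pair (X, s Y)
  with s = sqrt(z^2 - 1), obtained by eliminating with the Pell equation. For the n-th Chebyshev
  pair, W is the constant n.\<close>

lemma deriv_X_eq: "deriv X z = W z * Y z"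
proof -
  have "W z * Y z = X z * (X z * deriv X z) - (z ^ 2 - 1) * Y z ^ 2 * deriv X z"
    unfolding X_deriv_X W_def by (simp add: algebra_simps power2_eq_square)
  also have "\<dots> = (X z ^ 2 - (z ^ 2 - 1) * Y z ^ 2) * deriv X z"
    by (simp add: algebra_simps power2_eq_square)
  finally show ?thesis by (simp add: pell)
qed

lemma V_eq: "V z = W z * X z"
proof -
  have "W z * X z = X z ^ 2 * V z - (z ^ 2 - 1) * Y z * (X z * deriv X z)"
    unfolding W_def by (simp add: algebra_simps power2_eq_square)
  also have "\<dots> = (X z ^ 2 - (z ^ 2 - 1) * Y z ^ 2) * V z"
    unfolding X_deriv_X by (simp add: algebra_simps power2_eq_square)
  finally show ?thesis by (simp add: pell)
qed

lemma W_holomorphic: "W holomorphic_on UNIV"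
  unfolding W_def V_def by (intro holomorphic_intros hol) auto

text \<open>On the unit disc around z0 all points have modulus above 2, so z^2 - 1 has a holomorphic
  root s there, and X + s Y has inverse X - s Y. The logarithmic derivative estimate then
  applies.\<close>

lemma W_bound:
  assumes C: "C > 0" "\<And>z. norm (X z) \<le> exp (C * (norm z + 2) ^ k)"
    "\<And>z. norm (Y z) \<le> exp (C * (norm z + 2) ^ k)"
    and z0: "norm z0 \<ge> 3"
  shows "norm (W z0) \<le> 6 * (C + 1) * (norm z0 + 3) ^ (k + 2)"
proof -
  define B where "B = ball z0 1"
  have B: "convex B" "open B" "z0 \<in> B" by (auto simp: B_def)
  have nB: "norm z < norm z0 + 1" "norm z > 2" if "z \<in> B" for z
    using that z0 norm_triangle_ineq2[of z z0] norm_triangle_ineq2[of z0 z]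
    by (auto simp: B_def dist_norm norm_minus_commute)
  have nz: "z ^ 2 - 1 \<noteq> 0" if "z \<in> B" for z
  proof
    assume "z ^ 2 - 1 = 0"
    then have "norm z ^ 2 = 1" by (metis eq_iff_diff_eq_0 norm_one norm_power)
    moreover have "2 ^ 2 < norm z ^ 2" using nB(2)[OF that] by (intro power_strict_mono) auto
    ultimately show False by simp
  qed
  have "(\<lambda>z. z ^ 2 - 1) holomorphic_on B" by (intro holomorphic_intros)
  then obtain s where s: "s holomorphic_on B" "\<And>z. z \<in> B \<Longrightarrow> z ^ 2 - 1 = s z ^ 2"
    using simply_connected_eq_holomorphic_sqrt[OF B(2)] convex_imp_simply_connected[OF B(1)] nz
    by (metis (no_types, lifting))
  have sle: "norm (s z) \<le> norm z0 + 2" if "z \<in> B" for z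
  proof -
    have "norm (s z) ^ 2 = norm (z ^ 2 - 1)" by (simp add: s(2)[OF that] norm_power)
    also have "\<dots> \<le> norm z ^ 2 + 1" by (metis norm_one norm_power norm_triangle_ineq4)
    also have "\<dots> \<le> (norm z + 1) ^ 2" by (simp add: power2_eq_square algebra_simps)
    finally have "norm (s z) \<le> norm z + 1" by (rule power2_le_imp_le) simp
    then show ?thesis using nB(1)[OF that] by simp
  qed
  \<comment> \<open>The larger constant and exponent absorb the polynomial factor |z0| + 3, which
    comes from |s| and is estimated by exp(|z0| + 3).\<close>
  define K where "K = (C + 1) * (norm z0 + 3) ^ (k + 1)"
  have pos: "norm z0 + 3 > 0" using z0 by simp
  have "K > 0" using C(1) pos by (simp add: K_def)
  have XY: "norm (X z) + norm (s z * Y z) \<le> exp K" if "z \<in> B" for z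
  proof -
    let ?E = "exp (C * (norm z0 + 3) ^ k)"
    have "norm (X z) + norm (s z * Y z) \<le> ?E + (norm z0 + 2) * ?E"
      unfolding norm_mult using that[unfolded B_def] sle[OF that]
      by (intro add_mono mult_mono growth_on_unit_ball[OF C(2,1)]
          growth_on_unit_ball[OF C(3,1)]) auto
    also have "\<dots> = (norm z0 + 3) * ?E" by (simp add: algebra_simps)
    also have "\<dots> \<le> exp (norm z0 + 3) * ?E"
      using exp_ge_add_one_self[of "norm z0 + 3"] by (intro mult_right_mono) auto
    also have "\<dots> = exp ((norm z0 + 3) ^ 1 + C * (norm z0 + 3) ^ k)" by (simp add: exp_add)
    also have "\<dots> \<le> exp ((norm z0 + 3) ^ (k + 1) + C * (norm z0 + 3) ^ (k + 1))"
      unfolding exp_le_cancel_iff using C(1)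
      by (intro add_mono mult_left_mono power_increasing) auto
    finally show ?thesis by (simp add: K_def algebra_simps)
  qed
  define \<phi> where "\<phi> = (\<lambda>z. X z + s z * Y z)"
  define \<psi> where "\<psi> = (\<lambda>z. X z - s z * Y z)"
  have "\<phi> z * \<psi> z = 1" if "z \<in> B" for z
    using pell[of z] unfolding s(2)[OF that] by (simp add: \<phi>_def \<psi>_def algebra_simps power2_eq_square)
  then have le: "norm (deriv \<phi> z0 * \<psi> z0) \<le> 6 * K"
    using XY unfolding \<phi>_def \<psi>_def B_def[symmetric]
    by (intro logarithmic_derivative_bound \<open>K > 0\<close>)
      (auto simp: B_def[symmetric] intro!: holomorphic_intros s holomorphic_on_subset[OF hol(1)]
        holomorphic_on_subset[OF hol(2)]
        intro: order_trans[OF norm_triangle_ineq] order_trans[OF norm_triangle_ineq4])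
  have Ds: "(s has_field_derivative deriv s z0) (at z0)"
    using s(1) B by (intro holomorphic_derivI) auto
  have ss: "s z0 * deriv s z0 = z0"
  proof -
    have "((\<lambda>z. s z ^ 2) has_field_derivative 2 * (s z0 * deriv s z0)) (at z0)"
      by (auto intro!: derivative_eq_intros Ds)
    then have "((\<lambda>z. z ^ 2 - 1) has_field_derivative 2 * (s z0 * deriv s z0)) (at z0)"
      by (rule has_field_derivative_transform_within_open[OF _ B(2,3)]) (simp add: s(2))
    moreover have "((\<lambda>z. z ^ 2 - 1) has_field_derivative 2 * z0) (at z0)"
      by (auto intro!: derivative_eq_intros)
    ultimately have "2 * (s z0 * deriv s z0) = 2 * z0" by (rule DERIV_unique)
    then show ?thesis by simp
  qed
  have "(\<phi> has_field_derivative (deriv X z0 + (deriv s z0 * Y z0 + s z0 * deriv Y z0))) (at z0)"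
    unfolding \<phi>_def by (auto intro!: derivative_eq_intros Ds DERIV_X DERIV_Y)
  then have "s z0 * deriv \<phi> z0 = s z0 * deriv X z0 + V z0"
  proof -
    assume "(\<phi> has_field_derivative (deriv X z0 + (deriv s z0 * Y z0 + s z0 * deriv Y z0))) (at z0)"
    then have "s z0 * deriv \<phi> z0
        = s z0 * deriv X z0 + ((s z0 * deriv s z0) * Y z0 + s z0 ^ 2 * deriv Y z0)"
      by (simp add: DERIV_imp_deriv algebra_simps power2_eq_square)
    then show ?thesis by (simp only: ss V_def s(2)[OF B(3)])
  qed
  also have "\<dots> = W z0 * \<phi> z0"
    by (simp add: V_eq deriv_X_eq \<phi>_def algebra_simps)
  \<comment> \<open>W involves no branch, so the bound obtained from the local root s is a bound on
    the global entire function.\<close>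
  finally have "s z0 * (deriv \<phi> z0 * \<psi> z0) = W z0"
    using \<open>\<And>z. z \<in> B \<Longrightarrow> \<phi> z * \<psi> z = 1\<close>[OF B(3)] by (simp flip: mult.assoc)
  then have "norm (W z0) = norm (s z0) * norm (deriv \<phi> z0 * \<psi> z0)" by (metis norm_mult)
  also have "\<dots> \<le> (norm z0 + 3) * (6 * K)"
    using sle[OF B(3)] le by (intro mult_mono) auto
  finally show ?thesis by (simp add: K_def algebra_simps)
qed

text \<open>The differential equation satisfied by the Chebyshev polynomials when \<open>w\<close> is constant.\<close>
lemma ode:
  assumes w: "\<And>z. W z = poly w z"
  defines "F \<equiv> fps_expansion X 0" and "G \<equiv> fps_of_poly w"
  shows "(fps_X\<^sup>2 - 1) * (fps_deriv (fps_deriv F) * G - fps_deriv F * fps_deriv G)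
    + fps_X * (fps_deriv F * G) = G ^ 3 * F"
proof (rule fps_expansion_unique_complex)
  have F: "X has_fps_expansion F" unfolding F_def by (rule entire_has_fps_expansion[OF hol(1)])
  have G: "poly w has_fps_expansion G" unfolding G_def by (rule has_fps_expansion_poly)
  show "(\<lambda>z. poly w z ^ 3 * X z) has_fps_expansion G ^ 3 * F"
    by (intro fps_expansion_intros F G)
  have "(\<lambda>z. (z\<^sup>2 - 1) * (deriv (deriv X) z * poly w z - deriv X z * deriv (poly w) z)
      + z * (deriv X z * poly w z)) has_fps_expansion
      (fps_X\<^sup>2 - 1) * (fps_deriv (fps_deriv F) * G - fps_deriv F * fps_deriv G)
      + fps_X * (fps_deriv F * G)"
    by (intro fps_expansion_intros F G)
  moreover have "(z\<^sup>2 - 1) * (deriv (deriv X) z * poly w z - deriv X z * deriv (poly w) z)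
      + z * (deriv X z * poly w z) = poly w z ^ 3 * X z" for z
  proof -
    have "deriv X = (\<lambda>z. poly w z * Y z)" by (simp add: deriv_X_eq w fun_eq_iff)
    moreover have "((\<lambda>z. poly w z * Y z) has_field_derivative
        deriv (poly w) z * Y z + poly w z * deriv Y z) (at z)"
      by (auto intro!: derivative_eq_intros DERIV_Y simp: DERIV_imp_deriv[OF poly_DERIV])
    ultimately have dd: "deriv (deriv X) z = deriv (poly w) z * Y z + poly w z * deriv Y z"
      by (simp add: DERIV_imp_deriv)
    \<comment> \<open>Inserting X' = w Y makes the terms with w' cancel; what remains is w^2 ((z^2 -
      1) Y' + z Y).\<close>
    have "(z\<^sup>2 - 1) * (deriv (deriv X) z * poly w z - deriv X z * deriv (poly w) z)
      + z * (deriv X z * poly w z) = poly w z ^ 2 * V z"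
      unfolding dd by (simp add: deriv_X_eq w V_def algebra_simps power2_eq_square)
    then show ?thesis by (simp add: V_eq w power2_eq_square power3_eq_cube)
  qed
  ultimately show "(\<lambda>z. poly w z ^ 3 * X z) has_fps_expansion
      (fps_X\<^sup>2 - 1) * (fps_deriv (fps_deriv F) * G - fps_deriv F * fps_deriv G)
      + fps_X * (fps_deriv F * G)" by simp
qed

end


text \<open>With n = deg T, the left side has degree at most n + deg w and the right side exactly n
  + 3 deg w, so w is a constant c. Comparing coefficients of z^n gives c (n (n - 1) + n) =
  c^3.\<close>

lemma chebyshev_ode_poly:
  fixes T w :: "complex poly"
  assumes "T \<noteq> 0"
    and eq: "[:-1, 0, 1:] * (pderiv (pderiv T) * w - pderiv T * pderiv w)
      + [:0, 1:] * (pderiv T * w) = w ^ 3 * T"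
  obtains c n where "w = [:c:]" "c ^ 2 = of_nat n ^ 2"
proof (cases "w = 0")
  case True
  then show ?thesis by (intro that[of 0 0]) auto
next
  case False
  define n where "n = degree T"
  have "degree w = 0"
  proof -
    have "degree ([:-1, 0, 1:] * (pderiv (pderiv T) * w)) \<le> n + degree w"
    proof (cases "n \<le> 1")
      case True
      then have "pderiv (pderiv T) = 0" by (simp add: pderiv_eq_0_iff degree_pderiv n_def)
      then show ?thesis by simp
    next
      case False
      have "degree ([:-1, 0, 1:] * (pderiv (pderiv T) * w)) \<le> 2 + (n - 1 - 1 + degree w)"
        by (intro order_trans[OF degree_mult_le] add_mono) (auto simp: degree_pderiv n_def)
      with False show ?thesis by simp
    qed
    moreover have "degree ([:-1, 0, 1:] * (pderiv T * pderiv w)) \<le> n + degree w"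
    proof (cases "n = 0 \<or> degree w = 0")
      case True
      then have "pderiv T = 0 \<or> pderiv w = 0" by (auto simp: pderiv_eq_0_iff n_def)
      then show ?thesis by auto
    next
      case False
      have "degree ([:-1, 0, 1:] * (pderiv T * pderiv w)) \<le> 2 + (n - 1 + (degree w - 1))"
        by (intro order_trans[OF degree_mult_le] add_mono) (auto simp: degree_pderiv n_def)
      also have "\<dots> \<le> n + degree w" using False by arith
      finally show ?thesis .
    qed
    moreover have "degree ([:0, 1:] * (pderiv T * w)) \<le> n + degree w"
    proof (cases "n = 0")
      case True
      then have "pderiv T = 0" by (simp add: pderiv_eq_0_iff n_def)
      then show ?thesis by simp
    next
      case False
      have "degree ([:0, 1:] * (pderiv T * w)) \<le> 1 + (n - 1 + degree w)"
        by (intro order_trans[OF degree_mult_le] add_mono) (auto simp: degree_pderiv n_def)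
      with False show ?thesis by simp
    qed
    ultimately have "degree (w ^ 3 * T) \<le> n + degree w"
      unfolding eq[symmetric] right_diff_distrib by (intro degree_add_le degree_diff_le)
    moreover have "degree (w ^ 3 * T) = 3 * degree w + n"
      using False \<open>T \<noteq> 0\<close> by (simp add: degree_mult_eq degree_power_eq n_def)
    ultimately show ?thesis by simp
  qed
  then obtain c where c: "w = [:c:]" by (rule degree_eq_zeroE)
  with False have "c \<noteq> 0" by simp
  have quad: "coeff ([:-1, 0, 1:] * Q) k = (if k < 2 then 0 else coeff Q (k - 2)) - coeff Q k"
    for Q :: "complex poly" and k
  proof -
    have "[:-1, 0, 1:] * Q = pCons 0 (pCons 0 Q) - Q" by simp
    then show ?thesis by (auto simp: coeff_pCons numeral_2_eq_2 split: nat.split)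
  qed
  have lin: "coeff ([:0, 1:] * Q) k = (if k = 0 then 0 else coeff Q (k - 1))"
    for Q :: "complex poly" and k
    by (simp add: coeff_pCons split: nat.split)
  have w': "pderiv w = 0" by (simp add: c)
  have wc: "Q * w = smult c Q" for Q by (simp add: c)
  have top: "coeff T (Suc n) = 0" "coeff T (Suc (Suc n)) = 0"
    by (simp_all add: coeff_eq_0 n_def)
  have "coeff (w ^ 3 * T) n = c * (of_nat n ^ 2 * coeff T n)"
  proof (cases "n < 2")
    case True
    then have "n = 0 \<or> n = 1" by auto
    then show ?thesis
      unfolding eq[symmetric] w' wc coeff_add quad lin using top
      by (auto simp: coeff_pderiv)
  next
    case False
    define m where "m = n - 2"
    have m: "n = Suc (Suc m)" using False by (simp add: m_def)
    have "coeff (w ^ 3 * T) n = c * (coeff (pderiv (pderiv T)) m - coeff (pderiv (pderiv T)) n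
        + coeff (pderiv T) (Suc m))"
      unfolding eq[symmetric] w' wc coeff_add quad lin by (simp add: m distrib_left right_diff_distrib)
    also have "coeff (pderiv (pderiv T)) n = 0" using top by (simp add: coeff_pderiv)
    also have "coeff (pderiv (pderiv T)) m = (of_nat m + 1) * (of_nat m + 2) * coeff T n"
      by (simp add: coeff_pderiv m add.commute mult.commute mult.left_commute)
    also have "coeff (pderiv T) (Suc m) = (of_nat m + 2) * coeff T n"
      by (simp add: coeff_pderiv m add.commute)
    also have "c * ((of_nat m + 1) * (of_nat m + 2) * coeff T n - 0 + (of_nat m + 2) * coeff T n)
        = c * ((of_nat m + 2) ^ 2 * coeff T n)"
      by (simp add: power2_eq_square algebra_simps)
    also have "of_nat m + 2 = (of_nat n :: complex)" by (simp add: m)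
    finally show ?thesis .
  qed
  moreover have "coeff (w ^ 3 * T) n = c ^ 3 * coeff T n"
    by (simp add: c power3_eq_cube)
  ultimately have "c ^ 2 = of_nat n ^ 2"
    using \<open>T \<noteq> 0\<close> \<open>c \<noteq> 0\<close> by (simp add: n_def power2_eq_square power3_eq_cube)
  with c show ?thesis by (rule that)
qed


text \<open>At a long gap the differential equation for X passes to a polynomial, which forces W to
  be a constant c. The relation at 1 comes from V = c X, because V(1) = Y(1).\<close>

lemma pell_deriv:
  fixes X Y :: "complex \<Rightarrow> complex"
  assumes XY: "X \<in> H_fin" "Y \<in> H_fin" and lac: "lacunary X"
    and pell: "\<And>z. X z ^ 2 - (z ^ 2 - 1) * Y z ^ 2 = 1"
  obtains c n where "c ^ 2 = of_nat n ^ 2" "\<And>z. deriv X z = c * Y z" "Y 1 = c * X 1"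
proof -
  interpret entire_pell X Y
    using assms by unfold_locales (auto simp: H_fin_def)
  obtain C k where C: "C > 0" "\<And>z. norm (X z) \<le> exp (C * (norm z + 2) ^ k)"
    "\<And>z. norm (Y z) \<le> exp (C * (norm z + 2) ^ k)"
    using H_fin_growth_common[OF XY] by metis
  obtain w where w: "W = poly w"
    using polynomial_growth_imp_poly[of W 3 "6 * (C + 1)" 3 "k + 2"] W_holomorphic W_bound[OF C] C(1)
    by auto
  define F where "F = fps_expansion X 0"
  define G where "G = fps_of_poly w"
  \<comment> \<open>The polynomial coefficients stand on the left because
    \<open>fps_mult_nth_cong\<close> varies the right factor.\<close>
  define E where "E = (\<lambda>F. (fps_X\<^sup>2 - 1) * (G * fps_deriv (fps_deriv F) - fps_deriv G * fps_deriv F)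
    + fps_X * (G * fps_deriv F) - G ^ 3 * F)"
  have E0: "E F = 0" using ode[of w] by (simp add: w E_def F_def G_def mult.commute)
  have "\<exists>z. X z \<noteq> 0"
  proof (rule ccontr)
    assume "\<nexists>z. X z \<noteq> 0"
    then show False using pell[of 1] by simp
  qed
  \<comment> \<open>The operator raises degrees by at most d: by 3 deg w through w^3, by deg w + 2
    through the other terms. The gap d + 2 used next allows for two differentiations.\<close>
  define d where "d = 3 * degree w + 2"
  obtain N T where T: "T \<noteq> 0" "degree T \<le> N"
    "\<And>k. k \<le> N + (d + 2) \<Longrightarrow> fps_nth F k = coeff T k"
    using lacunary_truncation[OF hol(1) lac \<open>\<exists>z. X z \<noteq> 0\<close>, of "d + 2"] unfolding F_def by metis
  define e where "e = [:-1, 0, 1:] * (pderiv (pderiv T) * w - pderiv T * pderiv w)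
      + [:0, 1:] * (pderiv T * w) - w ^ 3 * T"
  have e: "fps_of_poly e = E (fps_of_poly T)"
  proof -
    have "fps_of_poly [:-1, 0, 1 :: complex:] = fps_X\<^sup>2 - 1"
      by (simp add: fps_of_poly_pCons power2_eq_square)
    moreover have "fps_of_poly [:0, 1 :: complex:] = fps_X" by simp
    ultimately show ?thesis
      unfolding mult.commute[of _ w] mult.commute[of _ "pderiv w"] e_def E_def G_def
      by (simp only: fps_of_poly_diff fps_of_poly_add fps_of_poly_mult
          fps_of_poly_pderiv fps_of_poly_power)
  qed
  have "coeff e k = 0" for k
  proof (cases "k \<le> N + d")
    case True
    have 0: "fps_nth F k = fps_nth (fps_of_poly T) k" if "k \<le> Suc (Suc (N + d))" for k
      using T(3) that by simp
    let ?T = "fps_of_poly T"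
    have 1: "fps_nth (fps_deriv F) k = fps_nth (fps_deriv ?T) k" if "k \<le> Suc (N + d)" for k
      by (rule fps_deriv_nth_cong[where n = "Suc (N + d)"]) (use 0 that in auto)
    have 2: "fps_nth (fps_deriv (fps_deriv F)) k = fps_nth (fps_deriv (fps_deriv ?T)) k"
      if "k \<le> N + d" for k
      by (rule fps_deriv_nth_cong[where n = "N + d"]) (use 1 that in auto)
    have A: "fps_nth (G * fps_deriv (fps_deriv F) - fps_deriv G * fps_deriv F) k
        = fps_nth (G * fps_deriv (fps_deriv ?T) - fps_deriv G * fps_deriv ?T) k"
      if "k \<le> N + d" for k
    proof -
      have "fps_nth (G * fps_deriv (fps_deriv F)) k = fps_nth (G * fps_deriv (fps_deriv ?T)) k"
        by (rule fps_mult_nth_cong[where n = "N + d"]) (use 2 that in auto)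
      moreover have "fps_nth (fps_deriv G * fps_deriv F) k = fps_nth (fps_deriv G * fps_deriv ?T) k"
        by (rule fps_mult_nth_cong[where n = "N + d"]) (use 1 that in auto)
      ultimately show ?thesis by simp
    qed
    have B: "fps_nth (G * fps_deriv F) k = fps_nth (G * fps_deriv ?T) k" if "k \<le> N + d" for k
      by (rule fps_mult_nth_cong[where n = "N + d"]) (use 1 that in auto)
    have "fps_nth (fps_X * (G * fps_deriv F)) k = fps_nth (fps_X * (G * fps_deriv ?T)) k"
      by (rule fps_mult_nth_cong[where n = "N + d"]) (use B True in auto)
    moreover have "fps_nth (G ^ 3 * F) k = fps_nth (G ^ 3 * ?T) k"
      by (rule fps_mult_nth_cong[where n = "N + d"]) (use 0 True in auto)
    moreover have "fps_nth ((fps_X\<^sup>2 - 1) * (G * fps_deriv (fps_deriv F) - fps_deriv G * fps_deriv F)) k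
        = fps_nth ((fps_X\<^sup>2 - 1) * (G * fps_deriv (fps_deriv ?T) - fps_deriv G * fps_deriv ?T)) k"
      by (rule fps_mult_nth_cong[where n = "N + d"]) (use A True in auto)
    ultimately have "fps_nth (E F) k = fps_nth (E ?T) k"
      unfolding E_def fps_add_nth fps_sub_nth by simp
    then show ?thesis using E0 by (simp flip: e)
  next
    case False
    have "degree ([:-1, 0, 1:] * (pderiv (pderiv T) * w)) \<le> 2 + (N + degree w)"
      using T(2) by (intro order_trans[OF degree_mult_le] add_mono) (auto simp: degree_pderiv)
    moreover have "degree ([:-1, 0, 1:] * (pderiv T * pderiv w)) \<le> 2 + (N + degree w)"
      using T(2) by (intro order_trans[OF degree_mult_le] add_mono) (auto simp: degree_pderiv)
    moreover have "degree ([:0, 1:] * (pderiv T * w)) \<le> 1 + (N + degree w)"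
      using T(2) by (intro order_trans[OF degree_mult_le] add_mono) (auto simp: degree_pderiv)
    moreover have "degree (w ^ 3 * T) \<le> 3 * degree w + N"
      using T(2) degree_power_le[of w 3] by (intro order_trans[OF degree_mult_le] add_mono) auto
    ultimately have "degree e \<le> N + d"
      unfolding e_def right_diff_distrib by (intro degree_add_le degree_diff_le) (auto simp: d_def)
    with False show ?thesis by (simp add: coeff_eq_0)
  qed
  then have "e = 0" by (simp add: poly_eq_iff)
  then obtain c n where c: "w = [:c:]" "c ^ 2 = of_nat n ^ 2"
    using chebyshev_ode_poly[OF T(1), of w] by (auto simp: e_def)
  show ?thesis
  proof (rule that[OF c(2)])
    show "deriv X z = c * Y z" for z using deriv_X_eq[of z] by (simp add: w c)
    show "Y 1 = c * X 1" using V_eq[of 1] by (simp add: w c V_def)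
  qed
qed

section \<open>Chebyshev polynomials and rings of lacunary functions\<close>

text \<open>The components T and U satisfy T + s U = (z + s)^n with s^2 = z^2 - 1. In this indexing
  U is the Chebyshev polynomial of the second kind of degree n - 1 for n > 0.\<close>

primrec cheb :: "nat \<Rightarrow> complex poly \<times> complex poly" where
  "cheb 0 = (1, 0)"
| "cheb (Suc n) = ([:0, 1:] * fst (cheb n) + [:-1, 0, 1:] * snd (cheb n), fst (cheb n) + [:0, 1:] * snd (cheb n))"

definition cheb_T :: "nat \<Rightarrow> complex \<Rightarrow> complex" where "cheb_T n = poly (fst (cheb n))"
definition cheb_U :: "nat \<Rightarrow> complex \<Rightarrow> complex" where "cheb_U n = poly (snd (cheb n))"

lemma cheb_0 [simp]: "cheb_T 0 z = 1" "cheb_U 0 z = 0"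
  by (simp_all add: cheb_T_def cheb_U_def)

lemma cheb_Suc:
  "cheb_T (Suc n) z = z * cheb_T n z + (z ^ 2 - 1) * cheb_U n z"
  "cheb_U (Suc n) z = cheb_T n z + z * cheb_U n z"
  by (simp_all add: cheb_T_def cheb_U_def algebra_simps power2_eq_square)

lemma cheb_pell: "cheb_T n z ^ 2 - (z ^ 2 - 1) * cheb_U n z ^ 2 = 1"
proof (induction n)
  case (Suc n)
  have "cheb_T (Suc n) z ^ 2 - (z ^ 2 - 1) * cheb_U (Suc n) z ^ 2
      = cheb_T n z ^ 2 - (z ^ 2 - 1) * cheb_U n z ^ 2"
    by (simp add: cheb_Suc algebra_simps power2_eq_square)
  then show ?case by (simp add: Suc)
qed simp

lemma cheb_1: "cheb_T n 1 = 1" "cheb_U n 1 = of_nat n"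
proof -
  have "cheb_T n 1 = 1 \<and> cheb_U n 1 = of_nat n"
    by (induction n) (auto simp: cheb_Suc)
  then show "cheb_T n 1 = 1" "cheb_U n 1 = of_nat n" by auto
qed

text \<open>Stated for either root of \<alpha>^2 - 1: the two signs of \<beta> give positive and
  negative powers later on.\<close>

lemma cheb_power:
  assumes "\<beta> ^ 2 = \<alpha> ^ 2 - 1"
  shows "cheb_T n \<alpha> + \<beta> * cheb_U n \<alpha> = (\<alpha> + \<beta>) ^ n"
proof (induction n)
  case (Suc n)
  have "cheb_T (Suc n) \<alpha> + \<beta> * cheb_U (Suc n) \<alpha> = (\<alpha> + \<beta>) * (cheb_T n \<alpha> + \<beta> * cheb_U n \<alpha>)"
    unfolding cheb_Suc assms[symmetric] by (simp add: algebra_simps power2_eq_square)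
  then show ?case by (simp add: Suc)
qed simp

section \<open>Rings of lacunary functions and their group of Pell solutions\<close>

locale lacunary_ring =
  fixes A :: "(complex \<Rightarrow> complex) set"
  assumes subring: "fun_subring A"
    and polys: "poly_funs \<subseteq> A"
    and fin_order: "A \<subseteq> H_fin"
    and lac: "\<And>f. f \<in> A \<Longrightarrow> lacunary f"
begin

lemma A_add [intro]: "f \<in> A \<Longrightarrow> g \<in> A \<Longrightarrow> (\<lambda>z. f z + g z) \<in> A"
  and A_mult [intro]: "f \<in> A \<Longrightarrow> g \<in> A \<Longrightarrow> (\<lambda>z. f z * g z) \<in> A"
  and A_minus [intro]: "f \<in> A \<Longrightarrow> (\<lambda>z. - f z) \<in> A"
  using subring by (auto simp: fun_subring_def)

lemma A_poly [simp, intro]: "poly p \<in> A"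
  using polys by (auto simp: poly_funs_def)

lemma A_polyI: "(\<And>z. f z = poly p z) \<Longrightarrow> f \<in> A"
  using A_poly[of p] by (metis ext)

lemma A_const [simp, intro]: "(\<lambda>_. c) \<in> A"
  by (rule A_polyI[of _ "[:c:]"]) simp

lemma A_id [simp, intro]: "(\<lambda>z. z) \<in> A"
  by (rule A_polyI[of _ "[:0, 1:]"]) simp

lemma A_cheb [simp, intro]: "cheb_T n \<in> A" "cheb_U n \<in> A"
  by (simp_all add: cheb_T_def cheb_U_def)

lemma A_holomorphic: "f \<in> A \<Longrightarrow> f holomorphic_on UNIV"
  using fin_order by (auto simp: H_fin_def)

lemma A_unit_const:
  assumes "f \<in> A" "g \<in> A" "\<And>z. f z * g z = 1"
  shows "f = (\<lambda>_. f 0)"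
  using lacunary_unit_const assms fin_order lac by blast

definition pell :: "(complex \<Rightarrow> complex) \<Rightarrow> (complex \<Rightarrow> complex) \<Rightarrow> bool" where
  "pell X Y \<longleftrightarrow> X \<in> A \<and> Y \<in> A \<and> (\<forall>z. X z ^ 2 - (z ^ 2 - 1) * Y z ^ 2 = 1)"

lemma pell_cheb: "pell (cheb_T n) (cheb_U n)"
  by (simp add: pell_def cheb_pell)

lemma pell_neg: "pell X Y \<Longrightarrow> pell X (\<lambda>z. - Y z)"
  by (auto simp: pell_def)

text \<open>The norm X^2 - (z^2 - 1) Y^2 of X + s Y, where s^2 = z^2 - 1, is multiplicative.
  Solutions thus form a group in which \<open>pell_neg\<close> is inversion.\<close>

lemma pell_mult:
  assumes "pell X Y" "pell P Q"
  shows "pell (\<lambda>z. X z * P z + (z ^ 2 - 1) * (Y z * Q z)) (\<lambda>z. X z * Q z + Y z * P z)"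
proof -
  have "(X z * P z + (z ^ 2 - 1) * (Y z * Q z)) ^ 2 - (z ^ 2 - 1) * (X z * Q z + Y z * P z) ^ 2
      = (X z ^ 2 - (z ^ 2 - 1) * Y z ^ 2) * (P z ^ 2 - (z ^ 2 - 1) * Q z ^ 2)" for z
    by (simp add: algebra_simps power2_eq_square)
  moreover have "(\<lambda>z. z ^ 2 - 1) \<in> A"
    by (rule A_polyI[of _ "[:-1, 0, 1:]"]) (simp add: power2_eq_square)
  ultimately show ?thesis
    using assms unfolding pell_def by (auto intro!: A_add A_mult)
qed

lemma pell_value:
  assumes "pell X Y"
  obtains c n where "c ^ 2 = of_nat n ^ 2" "\<And>z. deriv X z = c * Y z" "Y 1 = c * X 1"
  using pell_deriv[of X Y] assms fin_order lac unfolding pell_def by blast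

lemma pell_value_1:
  assumes "pell X Y"
  shows "X 1 ^ 2 = 1" "\<exists>k :: int. Y 1 = of_int k"
proof -
  show X1: "X 1 ^ 2 = 1" using assms unfolding pell_def by (metis (no_types) diff_zero mult_zero_left one_power2 right_minus_eq)
  obtain c n where c: "c ^ 2 = of_nat n ^ 2" "Y 1 = c * X 1"
    using pell_value[OF assms] by metis
  then have "Y 1 ^ 2 = of_nat n ^ 2" by (simp add: power_mult_distrib X1)
  then have "Y 1 = of_nat n \<or> Y 1 = - of_nat n" by (rule power2_eq_iff[THEN iffD1])
  then show "\<exists>k :: int. Y 1 = of_int k"
    by (metis of_int_minus of_int_of_nat_eq)
qed

text \<open>The values at 1 force c = 0, hence X' = 0 and X = 1, so (z^2 - 1) Y^2 = 0. The identity
  theorem, used from the unit disc, covers the points 1 and -1 as well.\<close>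

lemma pell_trivial:
  assumes "pell X Y" "X 1 = 1" "Y 1 = 0"
  shows "X = (\<lambda>_. 1)" "Y = (\<lambda>_. 0)"
proof -
  obtain c where c: "\<And>z. deriv X z = c * Y z" "Y 1 = c * X 1"
    using pell_value[OF assms(1)] by metis
  have "c = 0" using c(2) assms by simp
  moreover have "(X has_field_derivative deriv X z) (at z)" for z
    using assms(1) by (intro holomorphic_derivI[of _ UNIV] A_holomorphic) (auto simp: pell_def)
  ultimately have "(X has_field_derivative 0) (at z)" for z using c(1) by simp
  then have X: "X z = X 1" for z
    using has_field_derivative_zero_constant[of UNIV X] by (metis UNIV_I convex_UNIV has_field_derivative_at_within)
  then show "X = (\<lambda>_. 1)" using assms by auto
  have "(z ^ 2 - 1) * Y z ^ 2 = 0" for z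
  proof -
    have "X z ^ 2 - (z ^ 2 - 1) * Y z ^ 2 = 1" using assms(1) by (simp add: pell_def)
    then show ?thesis using X[of z] assms(2) by simp
  qed
  then have Y0: "Y z = 0" if "z ^ 2 \<noteq> 1" for z using that by auto
  have "Y z = 0" for z
  proof (rule analytic_continuation_open[of "ball 0 1" UNIV Y "\<lambda>_. 0"])
    show "Y holomorphic_on UNIV" using assms(1) by (auto simp: pell_def A_holomorphic)
    show "Y z = 0" if "z \<in> ball 0 1" for z
    proof (rule Y0)
      have "norm (z ^ 2) < 1" using that by (simp add: norm_power power_less_one_iff)
      then show "z ^ 2 \<noteq> 1" by auto
    qed
  qed auto
  then show "Y = (\<lambda>_. 0)" by auto
qed

text \<open>The quotient of the two solutions in the group has value (1, 0) at z = 1, so it is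
  trivial. This makes the power relation below single-valued.\<close>

lemma pell_unique:
  assumes 1: "pell X Y" and 2: "pell P Q" and "X 1 = 1" "P 1 = 1" "Y 1 = Q 1"
  shows "X = P" "Y = Q"
proof -
  define R where "R = (\<lambda>z. X z * P z + (z ^ 2 - 1) * (Y z * - Q z))"
  define S where "S = (\<lambda>z. X z * - Q z + Y z * P z)"
  have "pell R S" unfolding R_def S_def by (rule pell_mult[OF 1 pell_neg[OF 2]])
  moreover have "R 1 = 1" "S 1 = 0" using assms by (simp_all add: R_def S_def)
  ultimately have "R = (\<lambda>_. 1)" "S = (\<lambda>_. 0)" by (rule pell_trivial)+
  then have R: "R z = 1" and S: "S z = 0" for z by auto
  have "X z = R z * P z + (z ^ 2 - 1) * (S z * Q z)" "Y z = R z * Q z + S z * P z" for z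
  proof -
    have pq: "P z ^ 2 - (z ^ 2 - 1) * Q z ^ 2 = 1" using 2 by (simp add: pell_def)
    have "R z * P z + (z ^ 2 - 1) * (S z * Q z) = X z * (P z ^ 2 - (z ^ 2 - 1) * Q z ^ 2)"
      "R z * Q z + S z * P z = Y z * (P z ^ 2 - (z ^ 2 - 1) * Q z ^ 2)"
      by (simp_all add: R_def S_def algebra_simps power2_eq_square)
    then show "X z = R z * P z + (z ^ 2 - 1) * (S z * Q z)" "Y z = R z * Q z + S z * P z"
      by (simp_all add: pq)
  qed
  then show "X = P" "Y = Q" by (simp_all add: R S fun_eq_iff)
qed

end

section \<open>Diophantine relations\<close>

primrec tm_subst :: "(nat \<Rightarrow> tm) \<Rightarrow> tm \<Rightarrow> tm" where
  "tm_subst \<sigma> (Var i) = \<sigma> i"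
| "tm_subst \<sigma> Zero = Zero"
| "tm_subst \<sigma> One = One"
| "tm_subst \<sigma> Z = Z"
| "tm_subst \<sigma> (Add s t) = Add (tm_subst \<sigma> s) (tm_subst \<sigma> t)"
| "tm_subst \<sigma> (Mul s t) = Mul (tm_subst \<sigma> s) (tm_subst \<sigma> t)"

primrec qf_subst :: "(nat \<Rightarrow> tm) \<Rightarrow> qf \<Rightarrow> qf" where
  "qf_subst \<sigma> (Eq s t) = Eq (tm_subst \<sigma> s) (tm_subst \<sigma> t)"
| "qf_subst \<sigma> (Conj p q) = Conj (qf_subst \<sigma> p) (qf_subst \<sigma> q)"
| "qf_subst \<sigma> (Disj p q) = Disj (qf_subst \<sigma> p) (qf_subst \<sigma> q)"

definition scons :: "'a \<Rightarrow> (nat \<Rightarrow> 'a) \<Rightarrow> nat \<Rightarrow> 'a" (infixr "##" 65) where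
  "(a ## v) = case_nat a v"

lemma scons_simps [simp]: "(a ## v) 0 = a" "(a ## v) (Suc i) = v i"
  by (simp_all add: scons_def)

lemma scons_numeral [simp]: "(a ## v) (numeral k) = v (pred_numeral k)"
  by (simp add: numeral_eq_Suc)

lemma scons_shift [simp]: "(\<lambda>i. (a ## v) (Suc i)) = v"
  by simp

lemma scons_in: "a \<in> S \<Longrightarrow> (\<And>i. v i \<in> S) \<Longrightarrow> (a ## v) i \<in> S"
  by (cases i) auto

text \<open>Even positions carry the free variables and odd ones the existential witnesses, so there
  is always room for more of either kind.\<close>

definition mix :: "(nat \<Rightarrow> 'a) \<Rightarrow> (nat \<Rightarrow> 'a) \<Rightarrow> nat \<Rightarrow> 'a" where
  "mix v w i = (if even i then v (i div 2) else w (i div 2))"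

lemma mix_simps [simp]: "mix v w (2 * i) = v i" "mix v w (Suc (2 * i)) = w i"
  by (simp_all add: mix_def)

lemma mix_in: "(\<And>i. v i \<in> S) \<Longrightarrow> (\<And>i. w i \<in> S) \<Longrightarrow> mix v w i \<in> S"
  by (simp add: mix_def)

text \<open>The closure properties of existential definability are proved once here, from the
  behaviour of variables, substitution and connectives, and then serve both the function ring and
  the natural numbers.\<close>

locale qf_structure =
  fixes S :: "'a set" and val :: "(nat \<Rightarrow> 'a) \<Rightarrow> tm \<Rightarrow> 'a" and sat :: "(nat \<Rightarrow> 'a) \<Rightarrow> qf \<Rightarrow> bool"
  assumes val_closed: "(\<And>i. v i \<in> S) \<Longrightarrow> val v t \<in> S"
    and val_Var [simp]: "val v (Var i) = v i"
    and val_subst: "val v (tm_subst \<sigma> t) = val (\<lambda>i. val v (\<sigma> i)) t"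
    and sat_simps [simp]: "sat v (Eq s t) \<longleftrightarrow> val v s = val v t"
      "sat v (Conj p q) \<longleftrightarrow> sat v p \<and> sat v q" "sat v (Disj p q) \<longleftrightarrow> sat v p \<or> sat v q"
begin

lemma sat_subst: "sat v (qf_subst \<sigma> q) \<longleftrightarrow> sat (\<lambda>i. val v (\<sigma> i)) q"
  by (induction q) (auto simp: val_subst)

text \<open>All witnesses are quantified at once as an infinite sequence; a formula mentions only
  finitely many, and their number need not be tracked.\<close>

definition dioph :: "((nat \<Rightarrow> 'a) \<Rightarrow> bool) \<Rightarrow> bool" where
  "dioph R \<longleftrightarrow> (\<exists>q. \<forall>v. (\<forall>i. v i \<in> S) \<longrightarrow>
     (R v \<longleftrightarrow> (\<exists>w. (\<forall>i. w i \<in> S) \<and> sat (mix v w) q)))"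

definition pol :: "((nat \<Rightarrow> 'a) \<Rightarrow> 'a) \<Rightarrow> bool" where
  "pol f \<longleftrightarrow> (\<exists>t. \<forall>v. (\<forall>i. v i \<in> S) \<longrightarrow> f v = val v t)"

lemma polI: "(\<And>v. (\<And>i. v i \<in> S) \<Longrightarrow> f v = val v t) \<Longrightarrow> pol f"
  by (auto simp: pol_def)

lemma pol_var [simp, intro]: "pol (\<lambda>v. v i)"
  by (rule polI[of _ "Var i"]) simp

lemma dioph_eq:
  assumes "pol f" "pol g"
  shows "dioph (\<lambda>v. f v = g v)"
proof -
  obtain s t where st: "\<And>v. (\<And>i. v i \<in> S) \<Longrightarrow> f v = val v s" "\<And>v. (\<And>i. v i \<in> S) \<Longrightarrow> g v = val v t"
    using assms unfolding pol_def by metis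
  define q where "q = qf_subst (\<lambda>i. Var (2 * i)) (Eq s t)"
  have "sat (mix v w) q \<longleftrightarrow> val v s = val v t" for v w
    by (simp only: q_def sat_subst val_Var mix_simps sat_simps)
  then show ?thesis
    unfolding dioph_def using st by (intro exI[of _ q]) metis
qed

lemma dioph_conj:
  assumes "dioph P" "dioph Q"
  shows "dioph (\<lambda>v. P v \<and> Q v)"
proof -
  obtain p q where p: "\<And>v. (\<And>i. v i \<in> S) \<Longrightarrow> P v \<longleftrightarrow> (\<exists>w. (\<forall>i. w i \<in> S) \<and> sat (mix v w) p)"
    and q: "\<And>v. (\<And>i. v i \<in> S) \<Longrightarrow> Q v \<longleftrightarrow> (\<exists>w. (\<forall>i. w i \<in> S) \<and> sat (mix v w) q)"
    using assms unfolding dioph_def by metis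
  \<comment> \<open>The two conjuncts receive disjoint supplies of witnesses: those of even and
    those of odd index.\<close>
  define \<rho> where "\<rho> k i = (if even i then Var i else Var (Suc (2 * (2 * (i div 2) + k))))" for k i
  have \<rho>: "(\<lambda>i. val (mix v w) (\<rho> k i)) = mix v (\<lambda>j. w (2 * j + k))" for v w k
    by (rule ext) (simp add: \<rho>_def mix_def)
  define r where "r = Conj (qf_subst (\<rho> 0) p) (qf_subst (\<rho> 1) q)"
  have r: "sat (mix v w) r \<longleftrightarrow> sat (mix v (\<lambda>j. w (2 * j))) p \<and> sat (mix v (\<lambda>j. w (Suc (2 * j)))) q"
    for v w by (simp add: r_def sat_subst \<rho>)
  have "(P v \<and> Q v) \<longleftrightarrow> (\<exists>w. (\<forall>i. w i \<in> S) \<and> sat (mix v w) r)" if v: "\<And>i. v i \<in> S" for v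
  proof
    assume "P v \<and> Q v"
    then obtain w1 w2 where "\<forall>i. w1 i \<in> S" "sat (mix v w1) p" "\<forall>i. w2 i \<in> S" "sat (mix v w2) q"
      using p[OF v] q[OF v] by auto
    then show "\<exists>w. (\<forall>i. w i \<in> S) \<and> sat (mix v w) r"
      by (intro exI[of _ "mix w1 w2"]) (auto simp: r mix_in)
  next
    assume "\<exists>w. (\<forall>i. w i \<in> S) \<and> sat (mix v w) r"
    then show "P v \<and> Q v" using p[OF v] q[OF v] by (auto simp: r)
  qed
  then show ?thesis unfolding dioph_def by blast
qed

lemma dioph_disj:
  assumes "dioph P" "dioph Q"
  shows "dioph (\<lambda>v. P v \<or> Q v)"
proof -
  obtain p q where p: "\<And>v. (\<And>i. v i \<in> S) \<Longrightarrow> P v \<longleftrightarrow> (\<exists>w. (\<forall>i. w i \<in> S) \<and> sat (mix v w) p)"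
    and q: "\<And>v. (\<And>i. v i \<in> S) \<Longrightarrow> Q v \<longleftrightarrow> (\<exists>w. (\<forall>i. w i \<in> S) \<and> sat (mix v w) q)"
    using assms unfolding dioph_def by metis
  \<comment> \<open>Existential quantifiers distribute over disjunction, so both disjuncts may share
    the same witnesses.\<close>
  have "(P v \<or> Q v) \<longleftrightarrow> (\<exists>w. (\<forall>i. w i \<in> S) \<and> sat (mix v w) (Disj p q))" if v: "\<And>i. v i \<in> S" for v
    unfolding p[OF v] q[OF v] by auto
  then show ?thesis unfolding dioph_def by blast
qed

lemma dioph_subst:
  assumes "dioph R" "\<And>i. pol (\<sigma> i)"
  shows "dioph (\<lambda>v. R (\<lambda>i. \<sigma> i v))"
proof -
  obtain q where q: "\<And>v. (\<And>i. v i \<in> S) \<Longrightarrow> R v \<longleftrightarrow> (\<exists>w. (\<forall>i. w i \<in> S) \<and> sat (mix v w) q)"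
    using assms unfolding dioph_def by metis
  obtain t where t: "\<And>i v. (\<And>i. v i \<in> S) \<Longrightarrow> \<sigma> i v = val v (t i)"
    using assms(2) unfolding pol_def by metis
  define \<rho> where "\<rho> i = (if even i then tm_subst (\<lambda>j. Var (2 * j)) (t (i div 2)) else Var i)" for i
  have "(\<lambda>i. val (mix v w) (\<rho> i)) = mix (\<lambda>i. val v (t i)) w" for v w
    by (rule ext) (simp add: \<rho>_def val_subst, simp add: mix_def)
  then have "R (\<lambda>i. \<sigma> i v) \<longleftrightarrow> (\<exists>w. (\<forall>i. w i \<in> S) \<and> sat (mix v w) (qf_subst \<rho> q))"
    if v: "\<And>i. v i \<in> S" for v
    unfolding t[OF v] by (simp add: q val_closed v sat_subst)
  then show ?thesis unfolding dioph_def by blast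
qed

lemma dioph_ex_scons:
  assumes "dioph Q"
  shows "dioph (\<lambda>v. \<exists>y\<in>S. Q (y ## v))"
proof -
  obtain q where q: "\<And>v. (\<And>i. v i \<in> S) \<Longrightarrow> Q v \<longleftrightarrow> (\<exists>w. (\<forall>i. w i \<in> S) \<and> sat (mix v w) q)"
    using assms unfolding dioph_def by metis
  \<comment> \<open>The quantified variable becomes witness 0, stored at position 1. The other free
    variables move down one even position and the old witnesses up one odd position.\<close>
  define \<rho> where "\<rho> i = (if i = 0 then Var 1 else if even i then Var (i - 2) else Var (i + 2))" for i :: nat
  have "val (mix v w) (\<rho> i) = mix (w 0 ## v) (\<lambda>j. w (Suc j)) i" for v w i
  proof (cases "even i")
    case True
    then obtain j where j: "i = 2 * j" by blast
    show ?thesis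
    proof (cases j)
      case 0
      then show ?thesis
        using mix_simps(2)[of v w 0] mix_simps(1)[of "w 0 ## v" "\<lambda>j. w (Suc j)" 0]
        by (simp add: \<rho>_def j)
    next
      case (Suc k)
      then show ?thesis
        using mix_simps(1)[of v w k] mix_simps(1)[of "w 0 ## v" "\<lambda>j. w (Suc j)" j]
        by (simp add: \<rho>_def j)
    qed
  next
    case False
    define j where "j = i div 2"
    have j: "i = Suc (2 * j)" using False by (simp add: j_def)
    show ?thesis
      using mix_simps(2)[of v w "Suc j"] mix_simps(2)[of "w 0 ## v" "\<lambda>j. w (Suc j)" j]
      by (simp add: \<rho>_def j)
  qed
  then have \<rho>: "(\<lambda>i. val (mix v w) (\<rho> i)) = mix (w 0 ## v) (\<lambda>j. w (Suc j))" for v w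
    by blast
  have "(\<exists>y\<in>S. Q (y ## v)) \<longleftrightarrow> (\<exists>w. (\<forall>i. w i \<in> S) \<and> sat (mix v w) (qf_subst \<rho> q))"
    if v: "\<And>i. v i \<in> S" for v
  proof -
    have Q: "Q (y ## v) \<longleftrightarrow> (\<exists>w. (\<forall>i. w i \<in> S) \<and> sat (mix (y ## v) w) q)" if "y \<in> S" for y
      using that v by (intro q scons_in)
    show ?thesis
    proof
      assume "\<exists>y\<in>S. Q (y ## v)"
      then obtain y w where "y \<in> S" "\<forall>i. w i \<in> S" "sat (mix (y ## v) w) q"
        using Q by blast
      then show "\<exists>w. (\<forall>i. w i \<in> S) \<and> sat (mix v w) (qf_subst \<rho> q)"
        by (intro exI[of _ "y ## w"]) (simp add: sat_subst \<rho> scons_in)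
    next
      assume "\<exists>w. (\<forall>i. w i \<in> S) \<and> sat (mix v w) (qf_subst \<rho> q)"
      then obtain w where "\<forall>i. w i \<in> S" "sat (mix (w 0 ## v) (\<lambda>j. w (Suc j))) q"
        by (auto simp: sat_subst \<rho>)
      then have "w 0 \<in> S" "Q (w 0 ## v)" by (auto simp: Q)
      then show "\<exists>y\<in>S. Q (y ## v)" by blast
    qed
  qed
  then show ?thesis unfolding dioph_def by blast
qed

lemma dioph_ex:
  assumes "dioph (\<lambda>v. Q (v 0) (\<lambda>i. v (Suc i)))"
  shows "dioph (\<lambda>v. \<exists>y\<in>S. Q y v)"
  using dioph_ex_scons[OF assms] by simp

end

section \<open>Definability of integers, powers and natural numbers\<close>

context lacunary_ring begin

sublocale qf_structure A tm_val qf_sat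
proof
  show "tm_val v t \<in> A" if "\<And>i. v i \<in> A" for v t
    by (induction t) (auto simp: that)
  show "tm_val v (tm_subst \<sigma> t) = tm_val (\<lambda>i. tm_val v (\<sigma> i)) t" for v \<sigma> t
    by (induction t) auto
qed auto

lemma pol_add [intro]: "pol f \<Longrightarrow> pol g \<Longrightarrow> pol (\<lambda>v z. f v z + g v z)"
proof -
  assume "pol f" "pol g"
  then obtain s t where "\<And>v. \<forall>i. v i \<in> A \<Longrightarrow> f v = tm_val v s" "\<And>v. \<forall>i. v i \<in> A \<Longrightarrow> g v = tm_val v t"
    unfolding pol_def by auto
  then show "pol (\<lambda>v z. f v z + g v z)" by (intro polI[of _ "Add s t"]) simp
qed

lemma pol_mult [intro]: "pol f \<Longrightarrow> pol g \<Longrightarrow> pol (\<lambda>v z. f v z * g v z)"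
proof -
  assume "pol f" "pol g"
  then obtain s t where "\<And>v. \<forall>i. v i \<in> A \<Longrightarrow> f v = tm_val v s" "\<And>v. \<forall>i. v i \<in> A \<Longrightarrow> g v = tm_val v t"
    unfolding pol_def by auto
  then show "pol (\<lambda>v z. f v z * g v z)" by (intro polI[of _ "Mul s t"]) simp
qed

lemma pol_power2 [intro]: "pol f \<Longrightarrow> pol (\<lambda>v z. f v z ^ 2)"
  unfolding power2_eq_square by (rule pol_mult)

lemma pol_z [intro]: "pol (\<lambda>v z. z)"
  by (rule polI[of _ Z]) simp

lemma pol_of_nat [intro]: "pol (\<lambda>v z. of_nat n)"
proof (induction n)
  case 0 show ?case by (rule polI[of _ Zero]) simp
next
  case (Suc n)
  have "pol (\<lambda>v z. 1)" by (rule polI[of _ One]) simp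
  from pol_add[OF this Suc] show ?case by simp
qed

lemma pol_const [intro]: "pol (\<lambda>v z. 0)" "pol (\<lambda>v z. 1)" "pol (\<lambda>v z. numeral k)"
  using pol_of_nat[of 0] pol_of_nat[of 1] pol_of_nat[of "numeral k"] by simp_all

lemmas dioph_intros = dioph_eq dioph_conj dioph_disj dioph_ex pol_var pol_add pol_mult pol_power2
  pol_z pol_const pol_of_nat

text \<open>An existential description: by \<open>A_unit_const\<close> the units of the ring are the
  nonzero constants.\<close>

definition is_const :: "(complex \<Rightarrow> complex) \<Rightarrow> bool" where
  "is_const f \<longleftrightarrow> f = (\<lambda>z. 0) \<or> (\<exists>g\<in>A. (\<lambda>z. f z * g z) = (\<lambda>z. 1))"

lemma is_const_iff:
  assumes "f \<in> A"
  shows "is_const f \<longleftrightarrow> (\<exists>c. f = (\<lambda>_. c))"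
proof
  assume "is_const f"
  then show "\<exists>c. f = (\<lambda>_. c)"
    unfolding is_const_def using A_unit_const[OF assms] by (metis (no_types, lifting))
next
  assume "\<exists>c. f = (\<lambda>_. c)"
  then obtain c where c: "f = (\<lambda>_. c)" by blast
  show "is_const f"
  proof (cases "c = 0")
    case False
    then have "(\<lambda>z. f z * inverse c) = (\<lambda>z. 1)" by (simp add: c)
    then show ?thesis unfolding is_const_def by (intro disjI2 bexI[of _ "\<lambda>_. inverse c"]) auto
  qed (simp add: is_const_def c)
qed

text \<open>The equations are arranged so that no subtraction occurs.\<close>
definition is_int :: "(complex \<Rightarrow> complex) \<Rightarrow> bool" where
  "is_int f \<longleftrightarrow> is_const f \<and> (\<exists>X\<in>A. \<exists>Y\<in>A. \<exists>H\<in>A.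
     (\<lambda>z. X z ^ 2 + Y z ^ 2) = (\<lambda>z. 1 + z ^ 2 * Y z ^ 2) \<and>
     (\<lambda>z. Y z + H z) = (\<lambda>z. f z + z * H z))"

lemma pell_iff:
  "X \<in> A \<Longrightarrow> Y \<in> A \<Longrightarrow> (\<lambda>z. X z ^ 2 + Y z ^ 2) = (\<lambda>z. 1 + z ^ 2 * Y z ^ 2) \<longleftrightarrow> pell X Y"
proof -
  have "a + b = 1 + c * b \<longleftrightarrow> a - (c - 1) * b = 1" for a b c :: complex
    by (simp add: left_diff_distrib diff_diff_eq2 diff_eq_eq)
  then show "X \<in> A \<Longrightarrow> Y \<in> A \<Longrightarrow> ?thesis" by (simp add: pell_def fun_eq_iff)
qed

lemma poly_quotient:
  assumes "f = poly p"
  shows "\<exists>H\<in>A. \<forall>z. f z - f \<alpha> = (z - \<alpha>) * H z"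
proof -
  have "[:- \<alpha>, 1:] dvd p - [:poly p \<alpha>:]" by (simp add: poly_eq_0_iff_dvd[symmetric])
  then obtain h where "p - [:poly p \<alpha>:] = [:- \<alpha>, 1:] * h" by (elim dvdE)
  then have "poly (p - [:poly p \<alpha>:]) z = poly ([:- \<alpha>, 1:] * h) z" for z by simp
  then show ?thesis unfolding assms by (intro bexI[of _ "poly h"]) (auto simp: algebra_simps)
qed

lemma cheb_quotient:
  "\<exists>H\<in>A. \<forall>z. cheb_T n z - cheb_T n \<alpha> = (z - \<alpha>) * H z"
  "\<exists>H\<in>A. \<forall>z. cheb_U n z - cheb_U n \<alpha> = (z - \<alpha>) * H z"
  "\<exists>H\<in>A. \<forall>z. - cheb_U n z - - cheb_U n \<alpha> = (z - \<alpha>) * H z"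
proof -
  have "(\<lambda>z. - cheb_U n z) = poly (- snd (cheb n))" by (simp add: cheb_U_def fun_eq_iff)
  from poly_quotient[OF this]
  show "\<exists>H\<in>A. \<forall>z. - cheb_U n z - - cheb_U n \<alpha> = (z - \<alpha>) * H z" .
qed (rule poly_quotient[OF cheb_T_def] poly_quotient[OF cheb_U_def])+

lemma pell_of_int:
  obtains X Y where "pell X Y" "Y 1 = of_int k" "\<exists>H\<in>A. \<forall>z. Y z - Y 1 = (z - 1) * H z"
proof (cases k)
  case (nonneg n)
  show ?thesis by (rule that[OF pell_cheb[of n] _ cheb_quotient(2)]) (simp add: nonneg cheb_1)
next
  case (neg n)
  show ?thesis
    by (rule that[OF pell_neg[OF pell_cheb[of "Suc n"]] _ cheb_quotient(3)]) (simp add: neg cheb_1)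
qed

text \<open>The last equation of \<open>is_int\<close> reads Y - f = (z - 1) H, so a constant f
  equals Y(1), an integer. Conversely the pairs (T, U) and (T, -U) realise every integer, with a
  polynomial cofactor H.\<close>

lemma is_int_iff:
  assumes "f \<in> A"
  shows "is_int f \<longleftrightarrow> (\<exists>k::int. f = (\<lambda>_. of_int k))"
proof
  assume "is_int f"
  then obtain c X Y H where c: "f = (\<lambda>_. c)" and XY: "pell X Y" and "H \<in> A"
    and eq: "(\<lambda>z. Y z + H z) = (\<lambda>z. f z + z * H z)"
    unfolding is_int_def is_const_iff[OF assms] by (auto simp: pell_iff)
  from fun_cong[OF eq, of 1] have "c = Y 1" by (simp add: c)
  with pell_value_1(2)[OF XY] c show "\<exists>k::int. f = (\<lambda>_. of_int k)" by auto
next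
  assume "\<exists>k::int. f = (\<lambda>_. of_int k)"
  then obtain k :: int where k: "f = (\<lambda>_. of_int k)" by blast
  obtain X Y where XY: "pell X Y" "Y 1 = of_int k" "\<exists>H\<in>A. \<forall>z. Y z - Y 1 = (z - 1) * H z"
    using pell_of_int[of k] by metis
  then obtain H where "H \<in> A" "\<And>z. Y z - Y 1 = (z - 1) * H z" by blast
  then have "(\<lambda>z. Y z + H z) = (\<lambda>z. f z + z * H z)"
    using XY by (auto simp: fun_eq_iff k algebra_simps)
  moreover have "is_const f" using k is_const_iff[OF assms] by blast
  ultimately show "is_int f"
    unfolding is_int_def using XY(1) \<open>H \<in> A\<close> pell_iff[of X Y] unfolding pell_def by blast
qed

lemma dioph_is_const [intro]: "pol f \<Longrightarrow> dioph (\<lambda>v. is_const (f v))"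
proof -
  have "dioph (\<lambda>v. is_const (v 0))"
    unfolding is_const_def by (intro dioph_intros)
  from dioph_subst[OF this, of "\<lambda>_. f"] show "pol f \<Longrightarrow> dioph (\<lambda>v. is_const (f v))" by simp
qed

lemma dioph_is_int [intro]: "pol f \<Longrightarrow> dioph (\<lambda>v. is_int (f v))"
proof -
  have "dioph (\<lambda>v. is_int (v 0))"
    unfolding is_int_def by (intro dioph_intros dioph_is_const)
  from dioph_subst[OF this, of "\<lambda>_. f"] show "pol f \<Longrightarrow> dioph (\<lambda>v. is_int (f v))" by simp
qed

text \<open>With \<open>\<alpha> = (b + 1/b)/2\<close> and \<open>\<beta> = (b - 1/b)/2\<close>, one has \<open>T\<^sub>n(\<alpha>) + \<beta> U\<^sub>n(\<alpha>) = b^n\<close>.\<close>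
definition pow_rel :: "(complex \<Rightarrow> complex) \<Rightarrow> (complex \<Rightarrow> complex) \<Rightarrow> (complex \<Rightarrow> complex) \<Rightarrow> bool" where
  "pow_rel f g h \<longleftrightarrow> (\<exists>X\<in>A. \<exists>Y\<in>A. \<exists>\<alpha>\<in>A. \<exists>\<beta>\<in>A. \<exists>H\<in>A. \<exists>H'\<in>A. \<exists>H''\<in>A.
     (\<lambda>z. X z ^ 2 + Y z ^ 2) = (\<lambda>z. 1 + z ^ 2 * Y z ^ 2) \<and>
     (\<lambda>z. X z + H z) = (\<lambda>z. 1 + z * H z) \<and>
     (\<lambda>z. Y z + H' z) = (\<lambda>z. f z + z * H' z) \<and>
     (\<lambda>z. 2 * (g z * \<alpha> z)) = (\<lambda>z. g z ^ 2 + 1) \<and>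
     (\<lambda>z. 2 * (g z * \<beta> z) + 1) = (\<lambda>z. g z ^ 2) \<and>
     (\<lambda>z. X z + \<beta> z * Y z + \<alpha> z * H'' z) = (\<lambda>z. h z + z * H'' z))"

lemma dioph_pow_rel: "dioph (\<lambda>v. pow_rel (v 0) (v 1) (v 2))"
  unfolding pow_rel_def by (intro dioph_intros)

text \<open>The values at 1 determine the Pell pair by \<open>pell_unique\<close>, and b \<noteq> 0
  determines \<alpha> and \<beta>. The last equation of \<open>pow_rel\<close> reads X + \<beta> Y -
  h = (z - \<alpha>) H'', so it evaluates X + \<beta> Y at \<alpha>. The hypotheses on quotients
  supply the cofactors inside the ring.\<close>

lemma pow_rel_iff:
  assumes "b \<noteq> 0" and X: "pell X Y" "X 1 = 1" "Y 1 = of_int k"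
    "\<And>\<alpha>. \<exists>H\<in>A. \<forall>z. X z - X \<alpha> = (z - \<alpha>) * H z" "\<And>\<alpha>. \<exists>H\<in>A. \<forall>z. Y z - Y \<alpha> = (z - \<alpha>) * H z"
  defines "\<alpha> \<equiv> (b + 1 / b) / 2" and "\<beta> \<equiv> (b - 1 / b) / 2"
  shows "pow_rel (\<lambda>_. of_int k) (\<lambda>_. b) (\<lambda>_. c) \<longleftrightarrow> c = X \<alpha> + \<beta> * Y \<alpha>"
proof
  have iffs: "2 * (b * a) = b ^ 2 + 1 \<longleftrightarrow> a = \<alpha>" "2 * (b * a) + 1 = b ^ 2 \<longleftrightarrow> a = \<beta>" for a
    using \<open>b \<noteq> 0\<close> by (auto simp: \<alpha>_def \<beta>_def field_simps power2_eq_square)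
  {
    assume "pow_rel (\<lambda>_. of_int k) (\<lambda>_. b) (\<lambda>_. c)"
    then obtain P Q a b' H H' H'' where PQ: "P \<in> A" "Q \<in> A"
      "(\<lambda>z. P z ^ 2 + Q z ^ 2) = (\<lambda>z. 1 + z ^ 2 * Q z ^ 2)"
      and eqs': "(\<lambda>z. P z + H z) = (\<lambda>z. 1 + z * H z)"
      "(\<lambda>z. Q z + H' z) = (\<lambda>z. of_int k + z * H' z)"
      "(\<lambda>z. 2 * (b * a z)) = (\<lambda>z. b ^ 2 + 1)" "(\<lambda>z. 2 * (b * b' z) + 1) = (\<lambda>z. b ^ 2)"
      "(\<lambda>z. P z + b' z * Q z + a z * H'' z) = (\<lambda>z. c + z * H'' z)"
      unfolding pow_rel_def by blast
    note eqs = eqs'[THEN fun_cong]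
    have PQ: "pell P Q" using PQ pell_iff by blast
    have "P 1 = 1" "Q 1 = of_int k" using eqs(1)[of 1] eqs(2)[of 1] by auto
    then have "P = X" "Q = Y" using pell_unique[OF PQ X(1)] X by auto
    then show "c = X \<alpha> + \<beta> * Y \<alpha>"
      using eqs(5)[of \<alpha>] eqs(3,4) by (simp add: iffs)
  next
    assume c: "c = X \<alpha> + \<beta> * Y \<alpha>"
    obtain H H' H1 H2 where H: "H \<in> A" "H' \<in> A" "H1 \<in> A" "H2 \<in> A"
      "\<And>z. X z - X 1 = (z - 1) * H z" "\<And>z. Y z - Y 1 = (z - 1) * H' z"
      "\<And>z. X z - X \<alpha> = (z - \<alpha>) * H1 z" "\<And>z. Y z - Y \<alpha> = (z - \<alpha>) * H2 z"
      using X(4)[of 1] X(4)[of \<alpha>] X(5)[of 1] X(5)[of \<alpha>] by auto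
    have "X z + \<beta> * Y z + \<alpha> * (H1 z + \<beta> * H2 z) = c + z * (H1 z + \<beta> * H2 z)" for z
    proof -
      have "X z + \<beta> * Y z - c = (X z - X \<alpha>) + \<beta> * (Y z - Y \<alpha>)" by (simp add: c algebra_simps)
      also have "\<dots> = (z - \<alpha>) * (H1 z + \<beta> * H2 z)" unfolding H by (simp add: distrib_left)
      finally have "X z + \<beta> * Y z = c + (z - \<alpha>) * (H1 z + \<beta> * H2 z)" by (simp only: diff_eq_eq add.commute)
      then show ?thesis by (simp add: left_diff_distrib)
    qed
    then have e6: "(\<lambda>z. X z + \<beta> * Y z + \<alpha> * (H1 z + \<beta> * H2 z)) = (\<lambda>z. c + z * (H1 z + \<beta> * H2 z))"
      by (rule ext)
    have "X z + H z = 1 + z * H z" "Y z + H' z = of_int k + z * H' z" for z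
    proof -
      have "X z = 1 + (z - 1) * H z" "Y z = of_int k + (z - 1) * H' z"
        using H(5)[of z] H(6)[of z] unfolding X(2,3) by (simp_all only: diff_eq_eq add.commute)
      then show "X z + H z = 1 + z * H z" "Y z + H' z = of_int k + z * H' z"
        by (simp_all add: left_diff_distrib)
    qed
    then have e2: "(\<lambda>z. X z + H z) = (\<lambda>z. 1 + z * H z)"
      and e3: "(\<lambda>z. Y z + H' z) = (\<lambda>z. of_int k + z * H' z)" by (auto intro: ext)
    have e4: "(\<lambda>z :: complex. 2 * (b * \<alpha>)) = (\<lambda>z. b ^ 2 + 1)"
      and e5: "(\<lambda>z :: complex. 2 * (b * \<beta>) + 1) = (\<lambda>z. b ^ 2)"
      by (rule ext, rule iffs[THEN iffD2, OF refl])+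
    have mem: "X \<in> A" "Y \<in> A" "(\<lambda>z. H1 z + \<beta> * H2 z) \<in> A"
      using X(1) by (simp_all add: pell_def A_add A_mult H(3,4))
    then have e1: "(\<lambda>z. X z ^ 2 + Y z ^ 2) = (\<lambda>z. 1 + z ^ 2 * Y z ^ 2)"
      using X(1) pell_iff by blast
    show "pow_rel (\<lambda>_. of_int k) (\<lambda>_. b) (\<lambda>_. c)"
      unfolding pow_rel_def
      by (rule bexI[of _ X], rule bexI[of _ Y], rule bexI[of _ "\<lambda>_. \<alpha>"], rule bexI[of _ "\<lambda>_. \<beta>"],
          rule bexI[of _ H], rule bexI[of _ H'], rule bexI[of _ "\<lambda>z. H1 z + \<beta> * H2 z"])
        (intro conjI e1 e2 e3 e4 e5 e6 mem H A_const)+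
  }
qed

lemma half_sum_diff:
  assumes "(b :: complex) \<noteq> 0"
  shows "((b - 1 / b) / 2) ^ 2 = ((b + 1 / b) / 2) ^ 2 - 1"
    "(b + 1 / b) / 2 + (b - 1 / b) / 2 = b" "(b + 1 / b) / 2 - (b - 1 / b) / 2 = 1 / b"
  using assms by (simp_all add: field_simps power2_eq_square)

lemma pow_rel_nat:
  assumes "b \<noteq> 0"
  shows "pow_rel (\<lambda>_. of_nat n) (\<lambda>_. b) (\<lambda>_. c) \<longleftrightarrow> c = b ^ n"
proof -
  let ?\<alpha> = "(b + 1 / b) / 2" and ?\<beta> = "(b - 1 / b) / 2"
  have "pow_rel (\<lambda>_. of_int (int n)) (\<lambda>_. b) (\<lambda>_. c) \<longleftrightarrow> c = cheb_T n ?\<alpha> + ?\<beta> * cheb_U n ?\<alpha>"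
    by (rule pow_rel_iff[OF assms pell_cheb]) (simp_all add: cheb_1 cheb_quotient)
  also have "cheb_T n ?\<alpha> + ?\<beta> * cheb_U n ?\<alpha> = b ^ n"
    using cheb_power[OF half_sum_diff(1)[OF assms], of n] half_sum_diff(2)[OF assms] by simp
  finally show ?thesis by simp
qed

text \<open>The pair (T, -U) evaluates to (\<alpha> - \<beta>)^n, and \<alpha> - \<beta> =
  1/b.\<close>

lemma pow_rel_neg:
  assumes "b \<noteq> 0"
  shows "pow_rel (\<lambda>_. - of_nat n) (\<lambda>_. b) (\<lambda>_. c) \<longleftrightarrow> c = (1 / b) ^ n"
proof -
  let ?\<alpha> = "(b + 1 / b) / 2" and ?\<beta> = "(b - 1 / b) / 2"
  have "pow_rel (\<lambda>_. of_int (- int n)) (\<lambda>_. b) (\<lambda>_. c) \<longleftrightarrow> c = cheb_T n ?\<alpha> + ?\<beta> * - cheb_U n ?\<alpha>"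
    by (rule pow_rel_iff[OF assms pell_neg[OF pell_cheb]])
      (simp_all add: cheb_1 cheb_quotient[simplified])
  also have "cheb_T n ?\<alpha> + ?\<beta> * - cheb_U n ?\<alpha> = (?\<alpha> + - ?\<beta>) ^ n"
  proof -
    have "(- ?\<beta>) ^ 2 = ?\<alpha> ^ 2 - 1" unfolding power2_minus by (rule half_sum_diff(1)[OF assms])
    from cheb_power[OF this, of n] show ?thesis by (simp only: mult_minus_left mult_minus_right)
  qed
  also have "?\<alpha> + - ?\<beta> = 1 / b"
    using half_sum_diff(3)[OF assms] by (simp only: diff_conv_add_uminus)
  finally show ?thesis by simp
qed

text \<open>For an integer k, the power 2^k is an integer exactly when k >= 0.\<close>

definition is_nat :: "(complex \<Rightarrow> complex) \<Rightarrow> bool" where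
  "is_nat f \<longleftrightarrow> is_int f \<and> (\<exists>h\<in>A. is_int h \<and> pow_rel f (\<lambda>z. 2) h)"

lemma is_nat_iff:
  assumes "f \<in> A"
  shows "is_nat f \<longleftrightarrow> (\<exists>n::nat. f = (\<lambda>_. of_nat n))"
proof
  assume "is_nat f"
  then obtain k j :: int where kj: "f = (\<lambda>_. of_int k)" "pow_rel f (\<lambda>z. 2) (\<lambda>_. of_int j)"
    unfolding is_nat_def using is_int_iff assms by metis
  show "\<exists>n::nat. f = (\<lambda>_. of_nat n)"
  proof (cases "k \<ge> 0")
    case True
    then show ?thesis by (intro exI[of _ "nat k"]) (simp add: kj)
  next
    case False
    define n where "n = nat (- k)"
    have k: "k = - int n" "n > 0" using False by (auto simp: n_def)
    have "of_int j = (1 / 2 :: complex) ^ n"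
      using kj pow_rel_neg[of 2 n] by (simp add: k(1))
    then have "of_int j * 2 ^ n = (1 :: complex)" by (simp add: power_one_over)
    then have "of_int (j * 2 ^ n) = (of_int 1 :: complex)" by simp
    then have "j * 2 ^ n = 1" by (simp only: of_int_eq_iff)
    moreover have "even (j * 2 ^ n)" using \<open>n > 0\<close> by simp
    ultimately show ?thesis by simp
  qed
next
  assume "\<exists>n::nat. f = (\<lambda>_. of_nat n)"
  then obtain n :: nat where n: "f = (\<lambda>_. of_nat n)" by blast
  have "pow_rel f (\<lambda>z. 2) (\<lambda>_. of_int (2 ^ n))" by (simp add: n pow_rel_nat)
  moreover have "is_int f" unfolding is_int_iff[OF assms] by (rule exI[of _ "int n"]) (simp add: n)
  moreover have "is_int (\<lambda>_. of_int (2 ^ n))" using is_int_iff[of "\<lambda>_. of_int (2 ^ n)"] A_const by blast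
  ultimately show "is_nat f" unfolding is_nat_def by blast
qed

lemma dioph_is_nat [intro]: "pol f \<Longrightarrow> dioph (\<lambda>v. is_nat (f v))"
proof -
  have "dioph (\<lambda>v. pow_rel (v 1) (\<lambda>z. 2) (v 0))"
    using dioph_subst[OF dioph_pow_rel, of "\<lambda>i. if i = 0 then (\<lambda>v. v 1) else if i = 1 then (\<lambda>v z. 2) else (\<lambda>v. v 0)"]
    by (simp add: pol_const)
  then have "dioph (\<lambda>v. is_nat (v 0))"
    unfolding is_nat_def by (intro dioph_intros dioph_is_int) simp_all
  from dioph_subst[OF this, of "\<lambda>_. f"] show "pol f \<Longrightarrow> dioph (\<lambda>v. is_nat (f v))" by simp
qed

end

section \<open>Diophantine relations between natural numbers\<close>

text \<open>On natural numbers, the constant symbol \<open>Z\<close> is given the dummy value 0.\<close>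
primrec nval :: "(nat \<Rightarrow> nat) \<Rightarrow> tm \<Rightarrow> nat" where
  "nval v (Var i) = v i"
| "nval v Zero = 0"
| "nval v One = 1"
| "nval v Z = 0"
| "nval v (Add s t) = nval v s + nval v t"
| "nval v (Mul s t) = nval v s * nval v t"

primrec nsat :: "(nat \<Rightarrow> nat) \<Rightarrow> qf \<Rightarrow> bool" where
  "nsat v (Eq s t) \<longleftrightarrow> nval v s = nval v t"
| "nsat v (Conj p q) \<longleftrightarrow> nsat v p \<and> nsat v q"
| "nsat v (Disj p q) \<longleftrightarrow> nsat v p \<or> nsat v q"

interpretation nat: qf_structure UNIV nval nsat
proof
  show "nval v (tm_subst \<sigma> t) = nval (\<lambda>i. nval v (\<sigma> i)) t" for v \<sigma> t
    by (induction t) auto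
qed auto

abbreviation npol :: "((nat \<Rightarrow> nat) \<Rightarrow> nat) \<Rightarrow> bool" where "npol \<equiv> nat.pol"
abbreviation ndioph :: "((nat \<Rightarrow> nat) \<Rightarrow> bool) \<Rightarrow> bool" where "ndioph \<equiv> nat.dioph"

lemma npol_iff: "npol f \<longleftrightarrow> (\<exists>t. f = (\<lambda>v. nval v t))"
  by (auto simp: nat.pol_def fun_eq_iff)

lemma npol_add: "npol f \<Longrightarrow> npol g \<Longrightarrow> npol (\<lambda>v. f v + g v)"
  by (auto simp: npol_iff fun_eq_iff intro: exI[of _ "Add _ _"])

lemma npol_mult: "npol f \<Longrightarrow> npol g \<Longrightarrow> npol (\<lambda>v. f v * g v)"
  by (auto simp: npol_iff fun_eq_iff intro: exI[of _ "Mul _ _"])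

lemma npol_const: "npol (\<lambda>v. n)"
proof (induction n)
  case 0 show ?case by (rule nat.polI[of _ Zero]) simp
next
  case (Suc n)
  have "npol (\<lambda>v. 1)" by (rule nat.polI[of _ One]) simp
  from npol_add[OF this Suc] show ?case by simp
qed

lemma npol_Suc: "npol f \<Longrightarrow> npol (\<lambda>v. Suc (f v))"
  using npol_add[OF _ npol_const[of 1], of f] by simp

lemma npol_nval: "(\<And>i. npol (\<sigma> i)) \<Longrightarrow> npol (\<lambda>v. nval (\<lambda>i. \<sigma> i v) t)"
  by (induction t) (auto intro: npol_add npol_mult npol_const)

lemma npol_subst:
  assumes "npol f" "\<And>i. npol (\<sigma> i)"
  shows "npol (\<lambda>v. f (\<lambda>i. \<sigma> i v))"
proof -
  obtain t where "f = (\<lambda>v. nval v t)" using assms(1) by (auto simp: npol_iff)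
  then show ?thesis using npol_nval[of \<sigma> t] assms(2) by simp
qed

lemma npol_scons: "npol f \<Longrightarrow> (\<And>i. npol (\<lambda>v. g v i)) \<Longrightarrow> npol (\<lambda>v. (f v ## g v) i)"
  by (cases i) auto

lemmas npol_intros = nat.pol_var npol_add npol_mult npol_const npol_Suc npol_scons

text \<open>Goedel's beta function: the remainders of c modulo 1 + (i + 1) d code a finite sequence
  by two numbers.\<close>

definition beta :: "nat \<Rightarrow> nat \<Rightarrow> nat \<Rightarrow> nat" where
  "beta c d i = c mod Suc (Suc i * d)"

definition append_val :: "nat list \<Rightarrow> (nat \<Rightarrow> nat) \<Rightarrow> nat \<Rightarrow> nat" (infixr "@@" 65) where
  "(ys @@ v) i = (if i < length ys then ys ! i else v (i - length ys))"

lemma append_val_Nil [simp]: "[] @@ v = v"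
  by (simp add: append_val_def fun_eq_iff)

lemma append_val_Cons [simp]: "(y # ys) @@ v = y ## (ys @@ v)"
proof
  show "((y # ys) @@ v) i = (y ## (ys @@ v)) i" for i
    by (cases i) (auto simp: append_val_def)
qed

lemma append_val_append [simp]: "(ys @ zs) @@ v = ys @@ (zs @@ v)"
  by (induction ys) auto

text \<open>Common to three classes of relations between naturals: those given by polynomials
  (\<open>ndioph\<close>), those expressible in the ring at constants (\<open>adioph\<close>), and
  those in Davis normal form (\<open>davis\<close>).\<close>

locale nat_class =
  fixes C :: "((nat \<Rightarrow> nat) \<Rightarrow> bool) \<Rightarrow> bool"
  assumes eq: "npol f \<Longrightarrow> npol g \<Longrightarrow> C (\<lambda>v. f v = g v)"
    and conj: "C P \<Longrightarrow> C Q \<Longrightarrow> C (\<lambda>v. P v \<and> Q v)"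
    and ex_scons: "C Q \<Longrightarrow> C (\<lambda>v. \<exists>n. Q (n ## v))"
    and subst: "C R \<Longrightarrow> (\<And>i. npol (\<sigma> i)) \<Longrightarrow> C (\<lambda>v. R (\<lambda>i. \<sigma> i v))"
begin

lemma ex:
  assumes "C (\<lambda>v. Q (v 0) (\<lambda>i. v (Suc i)))"
  shows "C (\<lambda>v. \<exists>n. Q n v)"
  using ex_scons[OF assms] by simp

lemma exs:
  assumes "C Q"
  shows "C (\<lambda>v. \<exists>ys. length ys = m \<and> Q (ys @@ v))"
proof (induction m)
  case (Suc m)
  \<comment> \<open>\<open>ex_scons\<close> binds the variable standing directly before v, so the
    list grows at its end.\<close>
  have "(\<exists>ys. length ys = Suc m \<and> Q (ys @@ v)) \<longleftrightarrow> (\<exists>n ys. length ys = m \<and> Q (ys @@ (n ## v)))" for v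
  proof
    assume "\<exists>ys. length ys = Suc m \<and> Q (ys @@ v)"
    then obtain ys where ys: "length ys = Suc m" "Q (ys @@ v)" by blast
    then have "ys = butlast ys @ [last ys]" by (intro append_butlast_last_id[symmetric]) auto
    then have "Q (butlast ys @@ (last ys ## v))"
      using ys(2) by (metis append_val_Cons append_val_Nil append_val_append)
    then show "\<exists>n ys. length ys = m \<and> Q (ys @@ (n ## v))" 
      using ys(1) by (intro exI[of _ "last ys"] exI[of _ "butlast ys"]) simp
  next
    assume "\<exists>n ys. length ys = m \<and> Q (ys @@ (n ## v))"
    then obtain n ys where "length ys = m" "Q (ys @@ (n ## v))" by blast
    then show "\<exists>ys. length ys = Suc m \<and> Q (ys @@ v)" by (intro exI[of _ "ys @ [n]"]) auto
  qed
  then show ?case using ex_scons[OF Suc] by simp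
qed (use assms in simp)

lemma all_fin:
  fixes m :: nat
  assumes "\<And>i. i < m \<Longrightarrow> C (R i)"
  shows "C (\<lambda>v. \<forall>i<m. R i v)"
  using assms
proof (induction m)
  case 0
  have "C (\<lambda>v. (0::nat) = 0)" by (intro eq npol_const)
  then show ?case by simp
next
  case (Suc m)
  then have "C (\<lambda>v. (\<forall>i<m. R i v) \<and> R m v)" by (intro conj) auto
  moreover have "(\<forall>i<Suc m. R i v) \<longleftrightarrow> (\<forall>i<m. R i v) \<and> R m v" for v
    by (auto simp: less_Suc_eq)
  ultimately show ?case by simp
qed

lemma shift: "C R \<Longrightarrow> C (\<lambda>v. R (\<lambda>i. v (g i)))"
  by (rule subst) auto

lemma subst': "C R \<Longrightarrow> (\<And>i. npol (\<lambda>v. s v i)) \<Longrightarrow> C (\<lambda>v. R (s v))"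
  using subst[of R "\<lambda>i v. s v i"] by simp

lemma rel2: "C (\<lambda>v. R (v 0) (v 1)) \<Longrightarrow> npol f \<Longrightarrow> npol g \<Longrightarrow> C (\<lambda>v. R (f v) (g v))"
  using subst[of "\<lambda>v. R (v 0) (v 1)" "\<lambda>i. if i = 0 then f else g"] by simp

lemma rel3:
  assumes "C (\<lambda>v. R (v 0) (v 1) (v 2))" "npol f" "npol g" "npol h"
  shows "C (\<lambda>v. R (f v) (g v) (h v))"
  using subst[OF assms(1), of "\<lambda>i. if i = 0 then f else if i = 1 then g else h"] assms(2-) by simp

lemma rel4:
  assumes "C (\<lambda>v. R (v 0) (v 1) (v 2) (v 3))" "npol f" "npol g" "npol h" "npol k"
  shows "C (\<lambda>v. R (f v) (g v) (h v) (k v))"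
  using subst[OF assms(1), of "\<lambda>i. if i = 0 then f else if i = 1 then g else if i = 2 then h else k"]
    assms(2-) by simp

lemma le: "npol f \<Longrightarrow> npol g \<Longrightarrow> C (\<lambda>v. f v \<le> g v)"
  by (rule rel2[of "\<lambda>x y. x \<le> y"]) (unfold le_iff_add, intro ex eq npol_intros)

lemma less: "npol f \<Longrightarrow> npol g \<Longrightarrow> C (\<lambda>v. f v < g v)"
  unfolding Suc_le_eq[symmetric] by (intro le npol_intros)

lemma dvd: "npol f \<Longrightarrow> npol g \<Longrightarrow> C (\<lambda>v. f v dvd g v)"
  by (rule rel2[of "\<lambda>x y. x dvd y"]) (unfold dvd_def, intro ex eq npol_intros)

lemma beta_eq: "npol r \<Longrightarrow> npol c \<Longrightarrow> npol d \<Longrightarrow> npol i \<Longrightarrow> C (\<lambda>v. r v = beta (c v) (d v) (i v))"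
proof -
  have *: "r = beta c d i \<longleftrightarrow> r < Suc (Suc i * d) \<and> (\<exists>q. c = q * Suc (Suc i * d) + r)" for r c d i
  proof
    assume "r = beta c d i"
    then show "r < Suc (Suc i * d) \<and> (\<exists>q. c = q * Suc (Suc i * d) + r)"
      unfolding beta_def by (metis div_mult_mod_eq mod_less_divisor zero_less_Suc)
  next
    assume "r < Suc (Suc i * d) \<and> (\<exists>q. c = q * Suc (Suc i * d) + r)"
    then show "r = beta c d i" unfolding beta_def by (metis mod_less mod_mult_self3)
  qed
  have "C (\<lambda>v. v 0 = beta (v 1) (v 2) (v 3))"
    unfolding * by (intro conj less ex eq npol_intros)
  then show "npol r \<Longrightarrow> npol c \<Longrightarrow> npol d \<Longrightarrow> npol i \<Longrightarrow> C (\<lambda>v. r v = beta (c v) (d v) (i v))"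
    by (rule rel4)
qed

lemma prod_encode_eq: "npol p \<Longrightarrow> npol a \<Longrightarrow> npol b \<Longrightarrow> C (\<lambda>v. p v = prod_encode (a v, b v))"
proof -
  have tri: "2 * triangle n = n * Suc n" for n
    by (simp add: triangle_def)
  \<comment> \<open>Doubling clears the division by 2 in the triangular number and leaves a
    polynomial equation.\<close>
  have *: "p = prod_encode (a, b) \<longleftrightarrow> 2 * p = (a + b) * Suc (a + b) + 2 * a" for p a b
    unfolding prod_encode_def using tri[of "a + b"] by (simp, linarith)
  have "C (\<lambda>v. v 0 = prod_encode (v 1, v 2))"
    unfolding * by (intro eq npol_intros)
  then show "npol p \<Longrightarrow> npol a \<Longrightarrow> npol b \<Longrightarrow> C (\<lambda>v. p v = prod_encode (a v, b v))"
    by (rule rel3)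
qed

end

interpretation nat: nat_class ndioph
proof
  show "ndioph (\<lambda>v. \<exists>n. Q (n ## v))" if "ndioph Q" for Q
    using nat.dioph_ex_scons[OF that] by simp
qed (auto intro: nat.dioph_eq nat.dioph_conj nat.dioph_subst)

text \<open>The symbol \<open>Z\<close> denotes 0 under \<open>nval\<close> but the identity
  function in the ring; after this replacement the two values of a term agree.\<close>

primrec tm_zfree :: "tm \<Rightarrow> tm" where
  "tm_zfree (Var i) = Var i"
| "tm_zfree Zero = Zero"
| "tm_zfree One = One"
| "tm_zfree Z = Zero"
| "tm_zfree (Add s t) = Add (tm_zfree s) (tm_zfree t)"
| "tm_zfree (Mul s t) = Mul (tm_zfree s) (tm_zfree t)"

definition cval :: "(nat \<Rightarrow> nat) \<Rightarrow> nat \<Rightarrow> complex \<Rightarrow> complex" where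
  "cval x i = (\<lambda>_. of_nat (x i))"

lemma tm_val_zfree: "tm_val (cval x) (tm_zfree t) = (\<lambda>_. of_nat (nval x t))"
  by (induction t) (auto simp: cval_def)

lemma cval_scons: "cval (n ## x) = (\<lambda>_. of_nat n) ## cval x"
proof
  show "cval (n ## x) i = ((\<lambda>_. of_nat n) ## cval x) i" for i
    by (cases i) (simp_all add: cval_def)
qed

context lacunary_ring begin

text \<open>The ring relation R' is constrained only at natural constants, so quantifiers over
  naturals must be relativised to \<open>is_nat\<close>.\<close>

definition adioph :: "((nat \<Rightarrow> nat) \<Rightarrow> bool) \<Rightarrow> bool" where
  "adioph R \<longleftrightarrow> (\<exists>R'. dioph R' \<and> (\<forall>x. R x \<longleftrightarrow> R' (cval x)))"

lemma cval_eq_iff: "(\<lambda>_::complex. of_nat m :: complex) = (\<lambda>_. of_nat n) \<longleftrightarrow> m = n"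
  by (simp add: fun_eq_iff)

lemma npol_obtain_pol:
  assumes "npol f"
  obtains g where "pol g" "\<And>x. g (cval x) = (\<lambda>_. of_nat (f x))"
proof -
  obtain t where "f = (\<lambda>v. nval v t)" using assms by (auto simp: npol_iff)
  then show ?thesis
    by (intro that[of "\<lambda>v. tm_val v (tm_zfree t)"] polI[of _ "tm_zfree t"]) (simp_all add: tm_val_zfree)
qed

sublocale ad: nat_class adioph
proof
  fix f g :: "(nat \<Rightarrow> nat) \<Rightarrow> nat"
  assume "npol f" "npol g"
  then obtain f' g' where "pol f'" "pol g'" "\<And>x. f' (cval x) = (\<lambda>_. of_nat (f x))"
    "\<And>x. g' (cval x) = (\<lambda>_. of_nat (g x))"
    by (metis npol_obtain_pol)
  then show "adioph (\<lambda>v. f v = g v)"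
    unfolding adioph_def by (intro exI[of _ "\<lambda>v. f' v = g' v"]) (simp add: dioph_eq cval_eq_iff)
next
  fix P Q assume "adioph P" "adioph Q"
  then obtain P' Q' where "dioph P'" "dioph Q'" "\<And>x. P x \<longleftrightarrow> P' (cval x)" "\<And>x. Q x \<longleftrightarrow> Q' (cval x)"
    unfolding adioph_def by blast
  then show "adioph (\<lambda>v. P v \<and> Q v)"
    unfolding adioph_def by (intro exI[of _ "\<lambda>v. P' v \<and> Q' v"]) (simp add: dioph_conj)
next
  fix Q assume "adioph Q"
  then obtain Q' where Q': "dioph Q'" "\<And>x. Q x \<longleftrightarrow> Q' (cval x)"
    unfolding adioph_def by blast
  have "(\<exists>n. Q (n ## x)) \<longleftrightarrow> (\<exists>y\<in>A. is_nat y \<and> Q' (y ## cval x))" for x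
  proof
    assume "\<exists>n. Q (n ## x)"
    then obtain n where "Q' ((\<lambda>_. of_nat n) ## cval x)" by (auto simp: Q' cval_scons)
    then show "\<exists>y\<in>A. is_nat y \<and> Q' (y ## cval x)"
      using is_nat_iff[OF A_const, of "of_nat n"] by (intro bexI[of _ "\<lambda>_. of_nat n"]) auto
  next
    assume "\<exists>y\<in>A. is_nat y \<and> Q' (y ## cval x)"
    then obtain n :: nat where "Q' ((\<lambda>_. of_nat n) ## cval x)" using is_nat_iff by metis
    then show "\<exists>n. Q (n ## x)" by (auto simp: Q' cval_scons)
  qed
  moreover have "dioph (\<lambda>v. \<exists>y\<in>A. is_nat y \<and> Q' (y ## v))"
    using dioph_ex_scons[OF dioph_conj[OF dioph_is_nat[OF pol_var[of 0]] Q'(1)]] by simp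
  ultimately show "adioph (\<lambda>v. \<exists>n. Q (n ## v))"
    unfolding adioph_def by blast
next
  fix R and \<sigma> :: "nat \<Rightarrow> (nat \<Rightarrow> nat) \<Rightarrow> nat"
  assume "adioph R" and \<sigma>: "\<And>i. npol (\<sigma> i)"
  then obtain R' where R': "dioph R'" "\<And>x. R x \<longleftrightarrow> R' (cval x)"
    unfolding adioph_def by blast
  have "\<exists>s. pol s \<and> (\<forall>x. s (cval x) = (\<lambda>_. of_nat (\<sigma> i x)))" for i
    using npol_obtain_pol[OF \<sigma>] by metis
  then obtain s where s: "\<And>i. pol (s i)" "\<And>i x. s i (cval x) = (\<lambda>_. of_nat (\<sigma> i x))"
    by metis
  have "cval (\<lambda>i. \<sigma> i x) = (\<lambda>i. s i (cval x))" for x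
    by (rule ext) (simp add: s(2), simp add: cval_def)
  then have "R (\<lambda>i. \<sigma> i x) \<longleftrightarrow> R' (\<lambda>i. s i (cval x))" for x by (simp add: R'(2))
  then show "adioph (\<lambda>v. R (\<lambda>i. \<sigma> i v))"
    unfolding adioph_def using dioph_subst[of R' s, OF R'(1) s(1)]
    by (intro exI[of _ "\<lambda>v. R' (\<lambda>i. s i v)"]) simp
qed

text \<open>The base is a successor because the power relation is understood only for nonzero
  constants.\<close>

lemma adioph_power:
  assumes "npol f" "npol g" "npol h"
  shows "adioph (\<lambda>v. f v = Suc (g v) ^ h v)"
proof -
  have "dioph (\<lambda>v. pow_rel (v 0) (\<lambda>z. v 1 z + 1) (v 2))"
  proof -
    have "pol (\<lambda>v z. v 1 z + 1)" by (intro pol_add pol_var pol_const)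
    then show ?thesis
      using dioph_subst[OF dioph_pow_rel, of "\<lambda>i. if i = 0 then (\<lambda>v. v 0) else if i = 1 then (\<lambda>v z. v 1 z + 1) else (\<lambda>v. v 2)"]
      by simp
  qed
  moreover have "x 2 = Suc (x 1) ^ x 0 \<longleftrightarrow> pow_rel (cval x 0) (\<lambda>z. cval x 1 z + 1) (cval x 2)" for x
  proof -
    have "of_nat (Suc (x 1)) \<noteq> (0::complex)" by (simp only: of_nat_eq_0_iff)
    note pow_rel_nat[OF this, of "x 0" "of_nat (x 2)"]
    moreover have "(of_nat (x 2) = (of_nat (Suc (x 1)) :: complex) ^ x 0) \<longleftrightarrow> x 2 = Suc (x 1) ^ x 0"
      by (simp only: of_nat_power[symmetric] of_nat_eq_iff)
    moreover have "(\<lambda>z. cval x 1 z + 1) = (\<lambda>_. of_nat (Suc (x 1)))"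
      by (simp add: cval_def add.commute)
    ultimately show ?thesis by (simp only: cval_def)
  qed
  ultimately have "adioph (\<lambda>x. x 2 = Suc (x 1) ^ x 0)"
    unfolding adioph_def
    by (intro exI[of _ "\<lambda>v. pow_rel (v 0) (\<lambda>z. v 1 z + 1) (v 2)"]) blast
  from ad.rel3[of "\<lambda>a b c. c = Suc b ^ a", OF this assms(3,2,1)] show ?thesis .
qed

end

section \<open>Binomial coefficients and factorials\<close>

lemma digit_sum_less:
  fixes u :: nat
  assumes "\<And>i. a i < u"
  shows "(\<Sum>i<k. a i * u ^ i) < u ^ k"
proof (induction k)
  case (Suc k)
  have "(\<Sum>i<Suc k. a i * u ^ i) < u ^ k + a k * u ^ k" using Suc by simp
  also have "\<dots> = Suc (a k) * u ^ k" by simp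
  also have "\<dots> \<le> u * u ^ k" using assms[of k] by (intro mult_right_mono) auto
  finally show ?case by simp
qed simp

lemma digit_sum_split:
  fixes u :: nat
  shows "\<exists>q. (\<Sum>i<Suc k + m. a i * u ^ i) = (q * u + a k) * u ^ k + (\<Sum>i<k. a i * u ^ i)"
proof (induction m)
  case 0
  show ?case by (rule exI[of _ 0]) simp
next
  case (Suc m)
  then obtain q where "(\<Sum>i<Suc k + m. a i * u ^ i) = (q * u + a k) * u ^ k + (\<Sum>i<k. a i * u ^ i)"
    by blast
  then have "(\<Sum>i<Suc k + Suc m. a i * u ^ i)
      = ((q + a (Suc k + m) * u ^ m) * u + a k) * u ^ k + (\<Sum>i<k. a i * u ^ i)"
    by (simp add: algebra_simps power_add)
  then show ?case by blast
qed

text \<open>A binomial coefficient is a digit of \<open>(u + 1)^n\<close> in a large base \<open>u\<close>.\<close>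
lemma choose_iff:
  fixes n k c :: nat
  defines "u \<equiv> 2 ^ Suc n"
  shows "c = n choose k \<longleftrightarrow> c < u \<and> (\<exists>q l. Suc u ^ n = (q * u + c) * u ^ k + l \<and> l < u ^ k)"
proof -
  define a where "a i = n choose i" for i
  \<comment> \<open>Every coefficient stays below the base, so the binomial expansion is the base u
    expansion without carries.\<close>
  have a: "a i < u" for i
  proof -
    have "a i \<le> 2 ^ n" unfolding a_def by (rule binomial_le_pow2)
    also have "\<dots> < u" by (simp add: u_def)
    finally show ?thesis .
  qed
  have "Suc u ^ n = (\<Sum>i\<le>n. a i * u ^ i)"
    using binomial_ring[of u 1 n] by (simp add: a_def)
  also have "\<dots> = (\<Sum>i<Suc k + n. a i * u ^ i)"
    by (rule sum.mono_neutral_left) (auto simp: a_def not_le)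
  finally have s: "Suc u ^ n = (\<Sum>i<Suc k + n. a i * u ^ i)" .
  show ?thesis
  proof
    assume "c = n choose k"
    then have "c = a k" by (simp add: a_def)
    with a s digit_sum_split[of a u k n] digit_sum_less[of a u k]
    show "c < u \<and> (\<exists>q l. Suc u ^ n = (q * u + c) * u ^ k + l \<and> l < u ^ k)" by auto
  next
    assume "c < u \<and> (\<exists>q l. Suc u ^ n = (q * u + c) * u ^ k + l \<and> l < u ^ k)"
    then obtain q l where c: "c < u" and l: "Suc u ^ n = (q * u + c) * u ^ k + l" "l < u ^ k"
      by auto
    obtain q' where q': "Suc u ^ n = (q' * u + a k) * u ^ k + (\<Sum>i<k. a i * u ^ i)"
      using digit_sum_split[of a u k n] s by auto
    have uk: "u ^ k \<noteq> 0" using l(2) by (metis not_less_zero)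
    have div: "(a * u ^ k + l) div u ^ k = a" if "l < u ^ k" for a l
      using div_mult_self3[OF uk, of a l] that by simp
    have "q * u + c = Suc u ^ n div u ^ k" unfolding l(1) by (rule div[OF l(2), symmetric])
    also have "\<dots> = q' * u + a k" unfolding q' by (rule div[OF digit_sum_less[OF a]])
    finally have "(q * u + c) mod u = (q' * u + a k) mod u" by simp
    then show "c = n choose k" using c a[of k] by (simp add: a_def)
  qed
qed

lemma prod_diff_eq_fact_choose: "(\<Prod>i<k. n - i) = fact k * (n choose k :: nat)"
proof (induction k)
  case (Suc k)
  have "Suc k * (n choose Suc k) = (n - k) * (n choose k)"
    using binomial_absorption[of k n] binomial_absorb_comp[of n k] by simp
  then have "fact k * (Suc k * (n choose Suc k)) = (\<Prod>i<k. n - i) * (n - k)"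
    unfolding Suc by (simp add: mult.commute mult.left_commute del: mult_Suc)
  then show ?case by (simp only: prod.lessThan_Suc fact_Suc of_nat_id ac_simps)
qed simp

text \<open>\<open>r^L / (r choose L)\<close> tends to \<open>L!\<close> from above as \<open>r\<close> grows.\<close>
lemma fact_iff:
  fixes L f :: nat
  defines "r \<equiv> Suc (Suc L) ^ (L + 3)"
  shows "f = fact L \<longleftrightarrow> f * (r choose L) \<le> r ^ L \<and> r ^ L < Suc f * (r choose L)"
proof -
  define P where "P k = (\<Prod>i<k. r - i)" for k
  have Ple: "P k \<le> r ^ k" for k
    unfolding P_def using prod_mono[of "{..<k}" "\<lambda>i. r - i" "\<lambda>_. r"] by simp
  \<comment> \<open>This is P k >= r^k (1 - k L / r), multiplied by r to remain in the
    naturals.\<close>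
  have lower: "r * r ^ k \<le> r * P k + k * L * r ^ k" if "k \<le> L" for k
    using that
  proof (induction k)
    case (Suc k)
    have step: "r * P k \<le> P (Suc k) + L * r ^ k"
    proof -
      have "r * P k \<le> (r - k + k) * P k" by (intro mult_right_mono) auto
      also have "\<dots> = P (Suc k) + k * P k" by (simp add: P_def algebra_simps)
      also have "k * P k \<le> L * r ^ k" using Suc.prems Ple by (intro mult_mono) auto
      finally show ?thesis by simp
    qed
    have "r * r ^ Suc k = r * (r * r ^ k)" by simp
    also have "\<dots> \<le> r * (r * P k + k * L * r ^ k)" using Suc by (intro mult_left_mono) auto
    also have "\<dots> = r * (r * P k) + k * L * r ^ Suc k" by (simp add: algebra_simps)
    also have "\<dots> \<le> r * (P (Suc k) + L * r ^ k) + k * L * r ^ Suc k"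
      using step by (intro add_mono mult_left_mono) auto
    also have "\<dots> = r * P (Suc k) + Suc k * L * r ^ Suc k" by (simp add: algebra_simps)
    finally show ?case .
  qed (simp add: P_def)
  define F where "F = (fact L :: nat)"
  have PF: "P L = F * (r choose L)" unfolding P_def F_def by (rule prod_diff_eq_fact_choose)
  have F: "F > 0" by (simp add: F_def)
  \<comment> \<open>Here the exponent L + 3 enters: L! + 1 <= (L + 2)^(L + 1), and two further
    factors L + 2 exceed L^2. This size of r keeps the quotient r^L / (r choose L) below L! +
    1.\<close>
  have r: "Suc F * (L * L) < r"
  proof -
    have "F \<le> L ^ L" unfolding F_def using fact_le_power[of L, where 'a = nat] by simp
    also have "\<dots> \<le> Suc (Suc L) ^ L" by (intro power_mono) auto
    finally have "Suc F \<le> 2 * Suc (Suc L) ^ L" using one_le_power[of "Suc (Suc L)" L] by linarith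
    also have "\<dots> \<le> Suc (Suc L) * Suc (Suc L) ^ L" by (intro mult_right_mono) auto
    finally have "Suc F * (L * L) \<le> (Suc (Suc L) * Suc (Suc L) ^ L) * (L * L)" by (rule mult_right_mono) simp
    also have "\<dots> < (Suc (Suc L) * Suc (Suc L) ^ L) * (Suc (Suc L) * Suc (Suc L))"
      by (intro mult_strict_left_mono mult_strict_mono) auto
    also have "\<dots> = r" by (simp add: r_def power_add eval_nat_numeral algebra_simps)
    finally show ?thesis .
  qed
  then have "r > 0" by simp
  have 1: "F * (r choose L) \<le> r ^ L" using Ple[of L] by (simp add: PF)
  have 2: "r ^ L < Suc F * (r choose L)"
  proof -
    have "r * (F * r ^ L) + Suc F * (L * L) * r ^ L < r * (F * r ^ L) + r * r ^ L"
      using r \<open>r > 0\<close> by (intro add_strict_left_mono mult_strict_right_mono) auto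
    also have "\<dots> = Suc F * (r * r ^ L)" by (simp add: algebra_simps)
    also have "\<dots> \<le> Suc F * (r * P L + L * L * r ^ L)" using lower[of L] by (intro mult_left_mono) auto
    also have "\<dots> = r * (Suc F * P L) + Suc F * (L * L) * r ^ L" by (simp add: algebra_simps)
    finally have "r * (F * r ^ L) < r * (Suc F * P L)" by simp
    then have "F * r ^ L < F * (Suc F * (r choose L))"
      unfolding PF by (simp add: mult.left_commute)
    then show ?thesis using F by simp
  qed
  show ?thesis
  proof
    assume "f = fact L"
    then show "f * (r choose L) \<le> r ^ L \<and> r ^ L < Suc f * (r choose L)"
      using 1 2 by (simp add: F_def)
  next
    assume *: "f * (r choose L) \<le> r ^ L \<and> r ^ L < Suc f * (r choose L)"
    then have "F * (r choose L) < Suc f * (r choose L)" "f * (r choose L) < Suc F * (r choose L)"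
      using 1 2 by linarith+
    then have "F < Suc f" "f < Suc F" by (simp_all only: mult_less_cancel2)
    then show "f = fact L" by (simp add: F_def)
  qed
qed

section \<open>Elimination of a bounded universal quantifier\<close>

lemma nval_mono: "(\<And>i. i \<in> tm_vars t \<Longrightarrow> v i \<le> w i) \<Longrightarrow> nval v t \<le> nval w t"
  by (induction t) (auto intro!: add_mono mult_mono)

lemma nval_cong_mod:
  "(\<And>i. i \<in> tm_vars t \<Longrightarrow> [v i = w i] (mod p)) \<Longrightarrow> [nval v t = nval w t] (mod p)"
  by (induction t) (auto intro!: cong_add cong_mult)

lemma finite_tm_vars: "finite (tm_vars t)"
  by (induction t) auto

text \<open>For \<open>j < L\<close>, the numbers \<open>1 + L!\<^sup>2 / (j + 1)\<close> are pairwise coprime with all prime factors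
  above \<open>L\<close>, and the product of the first \<open>n\<close> of them is a binomial coefficient.\<close>
definition bmod :: "nat \<Rightarrow> nat \<Rightarrow> nat" where
  "bmod L j = Suc (fact L * fact L div Suc j)"

lemma Suc_mult_bmod:
  assumes "j < L"
  shows "Suc j * bmod L j = Suc j + fact L * fact L"
proof -
  have "Suc j dvd fact L" using assms by (intro dvd_fact) auto
  then have "Suc j dvd fact L * fact L" by simp
  then show ?thesis by (simp add: bmod_def del: mult_Suc)
qed

lemma bmod_dvd: "j < L \<Longrightarrow> bmod L j dvd Suc j + fact L * fact L"
  by (metis Suc_mult_bmod dvd_triv_right)

text \<open>This is why the factorial is squared: one factor L! absorbs the division by j + 1, the
  other remains divisible by every prime up to L. Such a prime divides bmod - 1.\<close>

lemma prime_factor_bmod: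
  assumes "j < L" "prime p" "p dvd bmod L j"
  shows "p > L"
proof (rule ccontr)
  assume "\<not> p > L"
  then have "p dvd fact L" using assms(2) by (simp add: prime_dvd_fact_iff)
  moreover have "Suc j dvd fact L" using assms(1) by (intro dvd_fact) auto
  ultimately have "p dvd fact L * fact L div Suc j"
    by (simp add: div_mult_swap[symmetric] flip: div_mult_swap)
  with assms(2,3) show False
    unfolding bmod_def by (metis One_nat_def Suc_eq_plus1 dvd_add_right_iff not_prime_unit)
qed

text \<open>A common prime factor divides (j + 1 + L!^2) - (i + 1 + L!^2) = j - i < L, while all
  prime factors exceed L.\<close>

lemma coprime_bmod:
  assumes "i < L" "j < L" "i \<noteq> j"
  shows "coprime (bmod L i) (bmod L j)"
proof -
  have "coprime (bmod L i) (bmod L j)" if ij: "i < j" "j < L" for i j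
  proof (rule ccontr)
    assume "\<not> coprime (bmod L i) (bmod L j)"
    then obtain p where p: "prime p" "p dvd bmod L i" "p dvd bmod L j"
      by (metis coprime_iff_gcd_eq_1 gcd_nat.boundedE prime_factor_nat)
    have "p dvd Suc j + fact L * fact L" "p dvd Suc i + fact L * fact L"
      using p bmod_dvd ij by (meson dvd_trans less_trans)+
    then have "p dvd (Suc j + fact L * fact L) - (Suc i + fact L * fact L)" by (rule dvd_diff_nat)
    then have "p \<le> j - i" using ij by (intro dvd_imp_le) auto
    moreover have "p > L" using prime_factor_bmod[of j L p] p ij by auto
    ultimately show False using ij by simp
  qed
  from this[of i j] this[of j i] assms show ?thesis by (auto simp: coprime_commute neq_iff)
qed

text \<open>With T = L!^2, the factors are (T + j + 1) / (j + 1), so the product is (T + 1) ... (T +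
  n) / n!.\<close>

lemma prod_bmod:
  assumes "n \<le> L"
  shows "(\<Prod>j<n. bmod L j) = ((fact L * fact L + n) choose n)"
  using assms
proof (induction n)
  case (Suc n)
  let ?T = "fact L * fact L :: nat"
  have "Suc n * (\<Prod>j<Suc n. bmod L j) = (Suc n * bmod L n) * (\<Prod>j<n. bmod L j)"
    by (simp del: mult_Suc)
  also have "\<dots> = (?T + Suc n) * ((?T + n) choose n)"
    using Suc by (simp add: Suc_mult_bmod add.commute del: mult_Suc)
  also have "\<dots> = Suc n * ((?T + Suc n) choose Suc n)"
    using binomial_absorption[of n "?T + Suc n"] by simp
  finally show ?case by (simp only: mult_cancel1) simp
qed simp

lemma coprime_bmod_fact:
  assumes "j < L" "b \<le> L"
  shows "coprime (bmod L j) (fact b)"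
proof (rule ccontr)
  assume "\<not> coprime (bmod L j) (fact b)"
  then obtain p where p: "prime p" "p dvd bmod L j" "p dvd fact b"
    by (metis coprime_iff_gcd_eq_1 gcd_nat.boundedE prime_factor_nat)
  then have "p \<le> b" by (simp add: prime_dvd_fact_iff)
  with prime_factor_bmod[OF assms(1) p(1,2)] assms(2) show False by simp
qed

text \<open>One number represents all values of the bounded variable: M vanishes modulo each
  \<open>bmod L k\<close>, and -(L!^2 + 1) is congruent to k there. Writing M - 1 in place of -1
  avoids negative numbers.\<close>

lemma bmod_cong:
  assumes "k < n" "n \<le> L"
  defines "M \<equiv> (fact L * fact L + n) choose n"
  shows "[(M - 1) * (fact L * fact L + 1) = k] (mod bmod L k)"
proof -
  let ?T = "fact L * fact L :: nat"
  have "bmod L k dvd M"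
    unfolding M_def prod_bmod[OF assms(2), symmetric] using assms(1) by (intro dvd_prodI) auto
  have "M > 0" unfolding M_def by simp
  have "(M - 1) * (?T + 1) + (?T + 1) = M * (?T + 1)"
    using \<open>M > 0\<close> by (cases M) auto
  then have "bmod L k dvd (M - 1) * (?T + 1) + (?T + 1)" using \<open>bmod L k dvd M\<close> by simp
  moreover have "bmod L k dvd k + (?T + 1)" using bmod_dvd[of k L] assms(1,2) by simp
  ultimately have "[(M - 1) * (?T + 1) + (?T + 1) = k + (?T + 1)] (mod bmod L k)"
    by (simp add: cong_def)
  then show ?thesis by (simp only: cong_add_rcancel_nat)
qed

text \<open>A prime dividing the binomial coefficient divides one of the factors a, a - 1, ..., a -
  B. Divisibility of a binomial coefficient thus expresses that a residue has a representative at
  most B.\<close>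

lemma prime_dvd_choose_cong:
  assumes "prime p" "p dvd (a choose Suc B)"
  obtains y where "y \<le> B" "[a = y] (mod p)"
proof (cases "a \<le> B")
  case True
  then show ?thesis using that[of a] by simp
next
  case False
  have "p dvd (\<Prod>i<Suc B. a - i)" unfolding prod_diff_eq_fact_choose using assms(2) by simp
  then have "\<exists>i\<in>{..<Suc B}. p dvd a - i"
    using prime_dvd_prod_iff[OF finite_lessThan assms(1)] by blast
  then obtain i where i: "i < Suc B" "p dvd a - i" by blast
  then have "[a = i] (mod p)" using False by (simp add: cong_altdef_nat)
  with i(1) show ?thesis using that[of i] by simp
qed

text \<open>The witnesses for all k are merged into one list by the Chinese remainder theorem, with
  K in the role of k. Conversely, a prime p dividing \<open>bmod L k\<close> turns the list into
  witnesses at most B for which both sides agree modulo p; as p > L exceeds both sides, they are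
  equal.\<close>

lemma bounded_all_elim:
  fixes s t :: tm and v :: "nat \<Rightarrow> nat"
  assumes m: "\<And>i. i \<in> tm_vars s \<union> tm_vars t \<Longrightarrow> i < m"
  defines "S \<equiv> \<lambda>k w. nval (mix (k ## v) w) s" and "T \<equiv> \<lambda>k w. nval (mix (k ## v) w) t"
  shows "(\<forall>k<n. \<exists>w. S k w = T k w) \<longleftrightarrow>
    (\<exists>B L M K as. length as = m \<and> (\<forall>i<m. v i \<le> B) \<and> n \<le> B \<and>
      L = nval (\<lambda>_. B) s + nval (\<lambda>_. B) t + B + 1 \<and>
      M = (fact L * fact L + n) choose n \<and> K = (M - 1) * (fact L * fact L + 1) \<and>
      (\<forall>i<m. M dvd (as ! i choose Suc B)) \<and>
      [S K (as @@ (\<lambda>_. 0)) = T K (as @@ (\<lambda>_. 0))] (mod M))" (is "?lhs \<longleftrightarrow> ?rhs")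
proof -
  \<comment> \<open>Position i of \<open>mix\<close> reads entry i div 2 of a component, so the
    first m entries of each are enough and the default 0 beyond them is never read.\<close>
  have half: "i div 2 < m" if "i \<in> tm_vars s \<union> tm_vars t" for i using m[OF that] by simp
  have ST_cong: "[S k w = S k' w'] (mod p)" "[T k w = T k' w'] (mod p)"
    if "[k = k'] (mod p)" "\<And>i. i < m \<Longrightarrow> [w i = w' i] (mod p)" for k k' w w' p
  proof -
    have *: "[mix (k ## v) w i = mix (k' ## v) w' i] (mod p)" if "i \<in> tm_vars s \<union> tm_vars t" for i
      using half[OF that] \<open>[k = k'] (mod p)\<close> \<open>\<And>i. i < m \<Longrightarrow> [w i = w' i] (mod p)\<close>
      by (cases "i div 2") (auto simp: mix_def)
    show "[S k w = S k' w'] (mod p)" "[T k w = T k' w'] (mod p)"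
      unfolding S_def T_def by (rule nval_cong_mod, rule *, simp)+
  qed
  show ?thesis
  proof
    assume ?lhs
    then obtain w where w: "\<And>k. k < n \<Longrightarrow> S k (w k) = T k (w k)" by metis
    \<comment> \<open>A sum is a convenient common bound for n, the parameters and all
      witnesses.\<close>
    define B where "B = n + (\<Sum>i<m. v i) + (\<Sum>k<n. \<Sum>i<m. w k i)"
    have vB: "v i \<le> B" if "i < m" for i
      using member_le_sum[of i "{..<m}" v] that by (simp add: B_def)
    have wB: "w k i \<le> B" if "k < n" "i < m" for k i
    proof -
      have "w k i \<le> (\<Sum>i<m. w k i)" using that by (intro member_le_sum) auto
      also have "\<dots> \<le> (\<Sum>k<n. \<Sum>i<m. w k i)" using that by (intro member_le_sum) auto
      finally show ?thesis by (simp add: B_def)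
    qed
    define L where "L = nval (\<lambda>_. B) s + nval (\<lambda>_. B) t + B + 1"
    define M where "M = (fact L * fact L + n) choose n"
    define K where "K = (M - 1) * (fact L * fact L + 1)"
    have nL: "n \<le> L" by (simp add: L_def B_def)
    have M: "M = (\<Prod>j<n. bmod L j)" unfolding M_def by (rule prod_bmod[OF nL, symmetric])
    have cop: "coprime (bmod L i) (bmod L j)" if "i < n" "j < n" "i \<noteq> j" for i j
      using that nL by (intro coprime_bmod) auto
    \<comment> \<open>For each witness position i, one number carries the witnesses of all k < n as
      residues.\<close>
    have "\<exists>x. \<forall>k\<in>{..<n}. [x = w k i] (mod bmod L k)" for i
      using cop by (intro chinese_remainder_nat) auto
    then obtain a where a: "\<And>i k. k < n \<Longrightarrow> [a i = w k i] (mod bmod L k)"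
      by (metis lessThan_iff)
    define as where "as = map a [0..<m]"
    have as: "(as @@ (\<lambda>_. 0)) i = a i" if "i < m" for i
      using that by (simp add: as_def append_val_def)
    have "M dvd (as ! i choose Suc B)" if "i < m" for i
      unfolding M cong_0_iff[symmetric]
    proof (rule coprime_cong_prod_nat)
      fix k assume "k \<in> {..<n}"
      then have k: "k < n" by simp
      have "bmod L k dvd (as ! i choose Suc B)"
      proof (cases "a i \<le> B")
        case True
        then show ?thesis using that by (simp add: as_def binomial_eq_0)
      next
        case False
        then have "bmod L k dvd a i - w k i"
          using a[OF k, of i] wB[OF k that] by (simp add: cong_altdef_nat)
        also have "\<dots> dvd (\<Prod>l<Suc B. a i - l)"
          using wB[OF k that] by (intro dvd_prodI) auto
        also have "\<dots> = fact (Suc B) * (a i choose Suc B)" by (rule prod_diff_eq_fact_choose)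
        \<comment> \<open>Cancelling (B + 1)! requires B + 1 <= L, which the summands B + 1 of L
          ensure.\<close>
        finally have "bmod L k dvd (a i choose Suc B)"
          using coprime_bmod_fact[of k L "Suc B"] k nL
          by (simp add: coprime_dvd_mult_right_iff L_def del: fact_Suc)
        then show ?thesis using that by (simp add: as_def)
      qed
      then show "[as ! i choose Suc B = 0] (mod bmod L k)" by (simp only: cong_0_iff)
    qed (use cop in auto)
    moreover have "[S K (as @@ (\<lambda>_. 0)) = T K (as @@ (\<lambda>_. 0))] (mod M)"
      unfolding M
    proof (rule coprime_cong_prod_nat)
      fix k assume "k \<in> {..<n}"
      then have k: "k < n" by simp
      have Kk: "[K = k] (mod bmod L k)" unfolding K_def M_def by (rule bmod_cong[OF k nL])
      have aw: "[(as @@ (\<lambda>_. 0)) i = w k i] (mod bmod L k)" if "i < m" for i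
        using a[OF k] as[OF that] by simp
      have "[S K (as @@ (\<lambda>_. 0)) = S k (w k)] (mod bmod L k)"
        by (rule ST_cong(1)[OF Kk aw])
      also have "S k (w k) = T k (w k)" by (rule w[OF k])
      also have "[T k (w k) = T K (as @@ (\<lambda>_. 0))] (mod bmod L k)"
        by (rule cong_sym[OF ST_cong(2)[OF Kk aw]])
      finally show "[S K (as @@ (\<lambda>_. 0)) = T K (as @@ (\<lambda>_. 0))] (mod bmod L k)" .
    qed (use cop in auto)
    moreover have "length as = m" "n \<le> B" by (simp_all add: as_def B_def)
    ultimately show ?rhs using vB L_def M_def K_def by blast
  next
    assume ?rhs
    then obtain B L M K as where len: "length as = m" and vB: "\<And>i. i < m \<Longrightarrow> v i \<le> B" and nB: "n \<le> B"
      and L: "L = nval (\<lambda>_. B) s + nval (\<lambda>_. B) t + B + 1"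
      and M: "M = (fact L * fact L + n) choose n" and K: "K = (M - 1) * (fact L * fact L + 1)"
      and dvd: "\<And>i. i < m \<Longrightarrow> M dvd (as ! i choose Suc B)"
      and cong: "[S K (as @@ (\<lambda>_. 0)) = T K (as @@ (\<lambda>_. 0))] (mod M)"
      by blast
    have nL: "n \<le> L" using nB by (simp add: L)
    show ?lhs
    proof (intro allI impI)
      fix k assume k: "k < n"
      have "bmod L k \<noteq> 1" using Suc_mult_bmod[of k L] k nL by auto
      then obtain p where p: "prime p" "p dvd bmod L k" by (metis prime_factor_nat)
      have "bmod L k dvd M"
        unfolding M prod_bmod[OF nL, symmetric] using k by (intro dvd_prodI) auto
      then have "p dvd M" using p by (metis dvd_trans)
      have "p > L" using prime_factor_bmod[OF _ p] k nL by simp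
      have "\<exists>y\<le>B. [as ! i = y] (mod p)" if "i < m" for i
        using prime_dvd_choose_cong[OF p(1), of "as ! i" B] dvd[OF that] \<open>p dvd M\<close>
        by (metis dvd_trans)
      then obtain y where y: "\<And>i. i < m \<Longrightarrow> y i \<le> B" "\<And>i. i < m \<Longrightarrow> [as ! i = y i] (mod p)"
        by metis
      have Kk: "[K = k] (mod p)"
        using bmod_cong[OF k nL] p(2) unfolding K M by (rule cong_dvd_modulus_nat)
      have ay: "[(as @@ (\<lambda>_. 0)) i = y i] (mod p)" if "i < m" for i
        using y(2)[OF that] that by (simp add: append_val_def len)
      have "[S k y = S K (as @@ (\<lambda>_. 0))] (mod p)" by (rule cong_sym[OF ST_cong(1)[OF Kk ay]])
      also have "[S K (as @@ (\<lambda>_. 0)) = T K (as @@ (\<lambda>_. 0))] (mod p)"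
        using cong \<open>p dvd M\<close> by (rule cong_dvd_modulus_nat)
      also have "[T K (as @@ (\<lambda>_. 0)) = T k y] (mod p)" by (rule ST_cong(2)[OF Kk ay])
      finally have "[S k y = T k y] (mod p)" .
      moreover have "mix (k ## v) y i \<le> B" if "i \<in> tm_vars s \<union> tm_vars t" for i
        using half[OF that] vB y(1) k nB by (cases "i div 2") (auto simp: mix_def)
      then have "S k y \<le> nval (\<lambda>_. B) s" "T k y \<le> nval (\<lambda>_. B) t"
        unfolding S_def T_def by (auto intro!: nval_mono)
      \<comment> \<open>Terms are monotone on the naturals, so L, which includes both terms
        evaluated at B throughout, bounds the two sides.\<close>
      then have "S k y < p" "T k y < p" using \<open>p > L\<close> by (auto simp: L)
      ultimately have "S k y = T k y" by (simp add: cong_less_modulus_unique_nat)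
      then show "\<exists>w. S k w = T k w" by blast
    qed
  qed
qed

lemma cong_nat_iff_ex: "[a = b] (mod m) \<longleftrightarrow> (\<exists>x y. a + m * x = b + m * y)" for a b m :: nat
  using cong_iff_lin_nat[of b a m] by (auto simp: cong_sym_eq mult.commute eq_commute)

lemma npol_mix:
  "(\<And>i. npol (\<lambda>v. a v i)) \<Longrightarrow> (\<And>i. npol (\<lambda>v. b v i)) \<Longrightarrow> npol (\<lambda>v. mix (a v) (b v) i)"
  by (cases "even i") (simp_all add: mix_def)

lemma npol_if: "npol f \<Longrightarrow> npol g \<Longrightarrow> npol (\<lambda>v. if b then f v else g v)"
  by (cases b) simp_all

text \<open>The equations (a - b)^2 + (c - d)^2 = 0 and (a - b) (c - d) = 0, with negative terms
  moved to the other side.\<close>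

lemma nsat_single_eq: "\<exists>s t. \<forall>v. nsat v q \<longleftrightarrow> nval v s = nval v t"
proof (induction q)
  case (Conj p q)
  then obtain s t s' t' where 1: "\<And>v. nsat v p \<longleftrightarrow> nval v s = nval v t"
    and 2: "\<And>v. nsat v q \<longleftrightarrow> nval v s' = nval v t'" by blast
  have *: "a = b \<and> c = d \<longleftrightarrow> (a * a + b * b) + (c * c + d * d) = (a * b + a * b) + (c * d + c * d)"
    for a b c d :: nat
  proof -
    have "(a = b \<and> c = d) \<longleftrightarrow> (int a - int b) * (int a - int b) + (int c - int d) * (int c - int d) = 0"
      by (simp add: sum_squares_eq_zero_iff)
    also have "\<dots> \<longleftrightarrow> int ((a * a + b * b) + (c * c + d * d)) = int ((a * b + a * b) + (c * d + c * d))"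
      by (simp add: algebra_simps)
    finally show ?thesis by (simp only: of_nat_eq_iff)
  qed
  show ?case
    by (rule exI[of _ "Add (Add (Mul s s) (Mul t t)) (Add (Mul s' s') (Mul t' t'))"],
        rule exI[of _ "Add (Add (Mul s t) (Mul s t)) (Add (Mul s' t') (Mul s' t'))"])
      (simp only: nsat.simps nval.simps 1 2 * simp_thms)
next
  case (Disj p q)
  then obtain s t s' t' where 1: "\<And>v. nsat v p \<longleftrightarrow> nval v s = nval v t"
    and 2: "\<And>v. nsat v q \<longleftrightarrow> nval v s' = nval v t'" by blast
  have *: "a = b \<or> c = d \<longleftrightarrow> a * c + b * d = a * d + b * c" for a b c d :: nat
  proof -
    have "(a = b \<or> c = d) \<longleftrightarrow> (int a - int b) * (int c - int d) = 0" by simp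
    also have "\<dots> \<longleftrightarrow> int (a * c + b * d) = int (a * d + b * c)" by (simp add: algebra_simps)
    finally show ?thesis by (simp only: of_nat_eq_iff)
  qed
  show ?case
    by (rule exI[of _ "Add (Mul s s') (Mul t t')"], rule exI[of _ "Add (Mul s t') (Mul t s')"])
      (simp only: nsat.simps nval.simps 1 2 * simp_thms)
qed auto

lemma ndioph_single_eq:
  assumes "ndioph Q"
  obtains s t where "\<And>v. Q v \<longleftrightarrow> (\<exists>w. nval (mix v w) s = nval (mix v w) t)"
proof -
  obtain q where q: "\<And>v. Q v \<longleftrightarrow> (\<exists>w. nsat (mix v w) q)"
    using assms unfolding nat.dioph_def by auto
  obtain s t where "\<And>v. nsat v q \<longleftrightarrow> nval v s = nval v t" using nsat_single_eq by blast
  then show ?thesis using q by (intro that[of s t]) simp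
qed

section \<open>Bounded universal quantification inside the ring\<close>

context lacunary_ring begin

lemma adioph_cong:
  assumes "npol f" "npol g" "npol h"
  shows "adioph (\<lambda>v. [f v = g v] (mod h v))"
proof -
  have "adioph (\<lambda>v. [v 0 = v 1] (mod v 2))"
    unfolding cong_nat_iff_ex by (intro ad.ex ad.eq npol_intros)
  from ad.rel3[of "\<lambda>a b c. [a = b] (mod c)", OF this assms] show ?thesis .
qed

lemma adioph_choose:
  assumes "npol f" "npol g" "npol h"
  shows "adioph (\<lambda>v. f v = (g v choose h v))"
proof -
  \<comment> \<open>The auxiliary u' presents the base u as a successor, the form that
    \<open>adioph_power\<close> accepts.\<close>
  have *: "c = (n choose k) \<longleftrightarrow> (\<exists>u u' p s q l. u = Suc 1 ^ Suc n \<and> u = Suc u' \<and> p = Suc u' ^ k \<and>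
      s = Suc u ^ n \<and> c < u \<and> s = (q * u + c) * p + l \<and> l < p)" for c n k
  proof -
    have "(2::nat) ^ Suc n = Suc (2 ^ Suc n - 1)" by simp
    then show ?thesis unfolding choose_iff[of c n k] by (metis Suc_1)
  qed
  have "adioph (\<lambda>v. v 0 = (v 1 choose v 2))"
    unfolding * by (intro ad.ex ad.conj ad.eq ad.less adioph_power npol_intros)
  from ad.rel3[of "\<lambda>a b c. a = (b choose c)", OF this assms] show ?thesis .
qed

lemma adioph_fact:
  assumes "npol f" "npol g"
  shows "adioph (\<lambda>v. f v = fact (g v))"
proof -
  have *: "f = fact L \<longleftrightarrow> (\<exists>r r' c p. r = Suc (Suc L) ^ (L + 3) \<and> r = Suc r' \<and> c = (r choose L) \<and>
      p = Suc r' ^ L \<and> f * c \<le> p \<and> p < Suc f * c)" for f L :: nat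
  proof -
    have "Suc (Suc L) ^ (L + 3) = Suc (Suc (Suc L) ^ (L + 3) - 1)" by simp
    then show ?thesis unfolding fact_iff[of f L] by metis
  qed
  have "adioph (\<lambda>v. v 0 = fact (v 1))"
    unfolding * by (intro ad.ex ad.conj ad.eq ad.less ad.le adioph_power adioph_choose npol_intros)
  from ad.rel2[of "\<lambda>a b. a = fact b", OF this assms] show ?thesis .
qed

text \<open>The matrix must be polynomial over the naturals, since its two sides are evaluated on
  residues; the result involves factorials and binomial coefficients and is only
  \<open>adioph\<close>.\<close>

lemma adioph_bounded_all_var:
  assumes "ndioph Q"
  shows "adioph (\<lambda>x. \<forall>k<x 0. Q (k ## (\<lambda>i. x (Suc i))))"
proof -
  obtain s t where Q: "\<And>v. Q v \<longleftrightarrow> (\<exists>w. nval (mix v w) s = nval (mix v w) t)"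
    using ndioph_single_eq[OF assms] by blast
  have "finite (tm_vars s \<union> tm_vars t)" by (simp add: finite_tm_vars)
  then obtain m where m: "\<And>i. i \<in> tm_vars s \<union> tm_vars t \<Longrightarrow> i < m"
    using finite_nat_set_iff_bounded by auto
  \<comment> \<open>Layout of y: the list of m merged witnesses, then K, M, L, B at positions m to m
    + 3, the bound at m + 4, and the parameters from m + 5 on.\<close>
  define val where "val r y = nval (mix (y m ## (\<lambda>i. y (m + 5 + i))) (\<lambda>i. if i < m then y i else 0)) r"
    for r and y :: "nat \<Rightarrow> nat"
  define P where "P y \<longleftrightarrow> (\<forall>i<m. y (m + 5 + i) \<le> y (m + 3)) \<and> y (m + 4) \<le> y (m + 3) \<and>
      y (m + 2) = nval (\<lambda>_. y (m + 3)) s + nval (\<lambda>_. y (m + 3)) t + y (m + 3) + 1 \<and>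
      (\<exists>F M'. F = fact (y (m + 2)) \<and> y (m + 1) = (F * F + y (m + 4) choose y (m + 4)) \<and>
        y (m + 1) = Suc M' \<and> y m = M' * (F * F + 1)) \<and>
      (\<forall>i<m. \<exists>c. c = (y i choose Suc (y (m + 3))) \<and> y (m + 1) dvd c) \<and>
      [val s y = val t y] (mod y (m + 1))" for y :: "nat \<Rightarrow> nat"
  have "npol (val r)" for r
    unfolding val_def by (intro npol_nval npol_mix npol_scons npol_if npol_const nat.pol_var)
  then have "adioph P"
    unfolding P_def
    by (intro ad.conj ad.all_fin ad.ex ad.le ad.eq ad.dvd adioph_fact adioph_choose adioph_cong
        npol_intros npol_nval)
  then have "adioph (\<lambda>x. \<exists>as. length as = m \<and> P (as @@ x))" by (rule ad.exs)
  then have "adioph (\<lambda>x. \<exists>B L M K as. length as = m \<and> P (as @@ (K ## M ## L ## B ## x)))"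
    by (rule ad.ex_scons[OF ad.ex_scons[OF ad.ex_scons[OF ad.ex_scons]]])
  moreover have "(\<forall>k<x 0. Q (k ## (\<lambda>i. x (Suc i)))) \<longleftrightarrow>
      (\<exists>B L M K as. length as = m \<and> P (as @@ (K ## M ## L ## B ## x)))" for x
  proof -
    define v where "v = (\<lambda>i. x (Suc i))"
    define W where "W B L M K as \<longleftrightarrow> (\<forall>i<m. v i \<le> B) \<and> x 0 \<le> B \<and>
      L = nval (\<lambda>_. B) s + nval (\<lambda>_. B) t + B + 1 \<and>
      M = (fact L * fact L + x 0) choose x 0 \<and> K = (M - 1) * (fact L * fact L + 1) \<and>
      (\<forall>i<m. M dvd (as ! i choose Suc B)) \<and>
      [nval (mix (K ## v) (as @@ (\<lambda>_. 0))) s = nval (mix (K ## v) (as @@ (\<lambda>_. 0))) t] (mod M)"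
      for B L M K and as :: "nat list"
    have "P (as @@ (K ## M ## L ## B ## x)) \<longleftrightarrow> W B L M K as"
      if len: "length as = m" for as K M L B
    proof -
      define y where "y = as @@ (K ## M ## L ## B ## x)"
      have y: "y (m + j) = (K ## M ## L ## B ## x) j" for j
        by (simp add: y_def append_val_def len)
      have ys: "y m = K" "y (m + 1) = M" "y (m + 2) = L" "y (m + 3) = B" "y (m + 4) = x 0"
        "y (m + 5 + i) = v i" for i
        using y[of 0] y[of 1] y[of 2] y[of 3] y[of 4] y[of "5 + i"]
        by (simp_all add: v_def eval_nat_numeral)
      have yi: "y i = as ! i" if "i < m" for i using that by (simp add: y_def append_val_def len)
      have "(\<lambda>i. if i < m then y i else 0) = as @@ (\<lambda>_. 0)"
        by (auto simp: fun_eq_iff append_val_def len yi)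
      then have val: "val r y = nval (mix (K ## v) (as @@ (\<lambda>_. 0))) r" for r
        by (simp add: val_def ys)
      have MK: "(\<exists>F M'. F = fact L \<and> M = (F * F + x 0 choose x 0) \<and> M = Suc M' \<and> K = M' * (F * F + 1))
        \<longleftrightarrow> M = ((fact L * fact L + x 0) choose x 0) \<and> K = (M - 1) * (fact L * fact L + 1)"
      proof -
        have "((fact L * fact L + x 0) choose x 0) \<noteq> 0" by simp
        then show ?thesis by (cases M) auto
      qed
      show ?thesis
        unfolding P_def W_def y_def[symmetric] ys val MK using yi by auto
    qed
    then have "(\<exists>B L M K as. length as = m \<and> P (as @@ (K ## M ## L ## B ## x))) \<longleftrightarrow>
        (\<exists>B L M K as. length as = m \<and> W B L M K as)"
      by (simp cong: conj_cong)
    also have "\<dots> \<longleftrightarrow> (\<forall>k<x 0. \<exists>w. nval (mix (k ## v) w) s = nval (mix (k ## v) w) t)"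
      unfolding W_def by (rule bounded_all_elim[OF m, symmetric])
    finally show ?thesis by (simp only: Q v_def)
  qed
  ultimately show ?thesis by simp
qed

lemma adioph_bounded_all:
  assumes "ndioph Q" "npol f"
  shows "adioph (\<lambda>v. \<forall>k<f v. Q (k ## v))"
  using ad.subst[OF adioph_bounded_all_var[OF assms(1)], of "\<lambda>i. case i of 0 \<Rightarrow> f | Suc j \<Rightarrow> (\<lambda>v. v j)"]
    assms(2) by (simp split: nat.split)

end

section \<open>Davis normal form\<close>

text \<open>Take d = N! with N bounding the length and all values. A common prime of two moduli
  divides (j - i) d but not d, hence divides j - i <= N, and then it divides N! = d after all. The
  moduli exceed the values, so remainders recover them.\<close>

lemma beta_exists: "\<exists>c d. \<forall>i<n. beta c d i = s i"
proof -
  define N where "N = n + (\<Sum>i<n. s i)"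
  define d where "d = (fact N :: nat)"
  have sN: "s i < Suc (Suc i * d)" if "i < n" for i
  proof -
    have "s i \<le> N" using member_le_sum[of i "{..<n}" s] that by (simp add: N_def)
    also have "\<dots> \<le> d" unfolding d_def by (rule fact_ge_self)
    finally show ?thesis by simp
  qed
  have cop: "coprime (Suc (Suc i * d)) (Suc (Suc j * d))" if ij: "i < j" "j < n" for i j
  proof (rule ccontr)
    assume "\<not> coprime (Suc (Suc i * d)) (Suc (Suc j * d))"
    then obtain p where p: "prime p" "p dvd Suc (Suc i * d)" "p dvd Suc (Suc j * d)"
      by (metis coprime_iff_gcd_eq_1 gcd_nat.boundedE prime_factor_nat)
    have nd: "\<not> p dvd d"
    proof
      assume "p dvd d"
      then have "p dvd Suc i * d" by simp
      with p(2) have "p dvd 1" by (metis Suc_eq_plus1 dvd_add_right_iff)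
      with p(1) show False by (metis not_prime_unit)
    qed
    have "p dvd Suc (Suc j * d) - Suc (Suc i * d)" using p by (intro dvd_diff_nat)
    also have "Suc (Suc j * d) - Suc (Suc i * d) = (j - i) * d"
      by (simp add: diff_mult_distrib)
    finally have "p dvd j - i" using p(1) nd by (simp add: prime_dvd_mult_iff)
    then have "p \<le> N" using ij by (auto dest!: dvd_imp_le simp: N_def)
    then have "p dvd d" using p(1) by (simp add: d_def prime_dvd_fact_iff)
    with nd show False by simp
  qed
  have "\<forall>i\<in>{..<n}. \<forall>j\<in>{..<n}. i \<noteq> j \<longrightarrow> coprime (Suc (Suc i * d)) (Suc (Suc j * d))"
  proof (intro ballI impI)
    fix i j assume "i \<in> {..<n}" "j \<in> {..<n}" "i \<noteq> j"
    then show "coprime (Suc (Suc i * d)) (Suc (Suc j * d))"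
      using cop[of i j] cop[of j i] by (auto simp: coprime_commute neq_iff)
  qed
  then obtain c where c: "\<And>i. i < n \<Longrightarrow> [c = s i] (mod Suc (Suc i * d))"
    using chinese_remainder_nat[of "{..<n}" "\<lambda>i. Suc (Suc i * d)" s] by auto
  have "beta c d i = s i" if "i < n" for i
    using c[OF that] sN[OF that] unfolding beta_def cong_def by simp
  then show ?thesis by blast
qed

text \<open>The single number u packs all remaining existential data by pairing, and the matrix may
  also refer to the bound y.\<close>

definition davis :: "((nat \<Rightarrow> nat) \<Rightarrow> bool) \<Rightarrow> bool" where
  "davis R \<longleftrightarrow> (\<exists>Q. ndioph Q \<and> (\<forall>v. R v \<longleftrightarrow> (\<exists>u y. \<forall>j\<le>y. Q (j ## u ## y ## v))))"

lemma davisI: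
  assumes "ndioph Q" "\<And>v. R v \<longleftrightarrow> (\<exists>u y. \<forall>j\<le>y. Q (j ## u ## y ## v))"
  shows "davis R"
  using assms unfolding davis_def by blast

lemma ndioph_imp_davis:
  assumes "ndioph R"
  shows "davis R"
proof (rule davisI)
  show "ndioph (\<lambda>x. R (\<lambda>i. x (i + 3)))" by (rule nat.shift[OF assms])
  show "R v \<longleftrightarrow> (\<exists>u y. \<forall>j\<le>y. R (\<lambda>i. (j ## u ## y ## v) (i + 3)))" for v
    by (auto simp: numeral_3_eq_3)
qed

text \<open>The two ranges are laid end to end: indices 0 to y1 test the first matrix, y1 + 1 to y1
  + y2 + 1 the second. The extra 1 arises because both ranges include their endpoint.\<close>

lemma davis_conj:
  assumes "davis P" "davis Q"
  shows "davis (\<lambda>v. P v \<and> Q v)"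
proof -
  obtain P' where P': "ndioph P'" "\<And>v. P v \<longleftrightarrow> (\<exists>u y. \<forall>j\<le>y. P' (j ## u ## y ## v))"
    using assms unfolding davis_def by blast
  obtain Q' where Q': "ndioph Q'" "\<And>v. Q v \<longleftrightarrow> (\<exists>u y. \<forall>j\<le>y. Q' (j ## u ## y ## v))"
    using assms unfolding davis_def by blast
  define R where "R x \<longleftrightarrow> (\<exists>u1 y1 u2 y2 a b. x 1 = prod_encode (a, b) \<and> a = prod_encode (u1, y1) \<and>
    b = prod_encode (u2, y2) \<and> x 2 = y1 + y2 + 1 \<and>
    (x 0 \<le> y1 \<and> P' (x 0 ## u1 ## y1 ## (\<lambda>i. x (i + 3))) \<or>
      (\<exists>j. x 0 = y1 + 1 + j \<and> Q' (j ## u2 ## y2 ## (\<lambda>i. x (i + 3))))))" for x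
  show ?thesis
  proof (rule davisI)
    show "ndioph R"
      unfolding R_def
      by (intro nat.ex nat.conj nat.dioph_disj nat.prod_encode_eq nat.eq nat.le nat.subst'[OF P'(1)]
          nat.subst'[OF Q'(1)] npol_intros)
    define E where "E u1 y1 u2 y2 = prod_encode (prod_encode (u1, y1), prod_encode (u2, y2))"
      for u1 y1 u2 y2
    show "(P v \<and> Q v) \<longleftrightarrow> (\<exists>u y. \<forall>j\<le>y. R (j ## u ## y ## v))" for v
    proof -
      have R: "R (j ## E u1 y1 u2 y2 ## y ## v) \<longleftrightarrow> y = y1 + y2 + 1 \<and>
          (j \<le> y1 \<and> P' (j ## u1 ## y1 ## v) \<or> (\<exists>i. j = y1 + 1 + i \<and> Q' (i ## u2 ## y2 ## v)))"
        for j u1 y1 u2 y2 y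
        unfolding R_def E_def by (simp add: numeral_3_eq_3)
      show ?thesis
      proof
        assume "P v \<and> Q v"
        then obtain u1 y1 u2 y2 where 1: "\<And>j. j \<le> y1 \<Longrightarrow> P' (j ## u1 ## y1 ## v)"
          and 2: "\<And>j. j \<le> y2 \<Longrightarrow> Q' (j ## u2 ## y2 ## v)"
          unfolding P' Q' by blast
        have "R (j ## E u1 y1 u2 y2 ## (y1 + y2 + 1) ## v)" if "j \<le> y1 + y2 + 1" for j
        proof (cases "j \<le> y1")
          case True
          then show ?thesis using 1[OF True] unfolding R by simp
        next
          case False
          then have "Q' ((j - y1 - 1) ## u2 ## y2 ## v)" using that by (intro 2) simp
          moreover have "j = y1 + 1 + (j - y1 - 1)" using False by simp
          ultimately show ?thesis unfolding R by blast
        qed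
        then show "\<exists>u y. \<forall>j\<le>y. R (j ## u ## y ## v)" by blast
      next
        assume "\<exists>u y. \<forall>j\<le>y. R (j ## u ## y ## v)"
        then obtain u y where Ruy: "\<And>j. j \<le> y \<Longrightarrow> R (j ## u ## y ## v)" by blast
        obtain u1 y1 u2 y2 where u: "u = E u1 y1 u2 y2"
          unfolding E_def by (metis prod_decode_inverse surj_pair)
        note R' = Ruy[unfolded u R]
        have y: "y = y1 + y2 + 1" using R'[of 0] by simp
        have "P' (j ## u1 ## y1 ## v)" if "j \<le> y1" for j
          using R'[of j] that by (auto simp: y)
        moreover have "Q' (j ## u2 ## y2 ## v)" if "j \<le> y2" for j
          using R'[of "y1 + 1 + j"] that by (auto simp: y)
        ultimately show "P v \<and> Q v" unfolding P' Q' by blast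
      qed
    qed
  qed
qed

lemma davis_ex:
  assumes "davis Q"
  shows "davis (\<lambda>v. \<exists>n. Q (n ## v))"
proof -
  obtain Q' where Q': "ndioph Q'" "\<And>v. Q v \<longleftrightarrow> (\<exists>u y. \<forall>j\<le>y. Q' (j ## u ## y ## v))"
    using assms unfolding davis_def by blast
  define R where "R x \<longleftrightarrow> (\<exists>u n. x 1 = prod_encode (u, n) \<and> Q' (x 0 ## u ## x 2 ## n ## (\<lambda>i. x (i + 3))))"
    for x
  show ?thesis
  proof (rule davisI)
    show "ndioph R"
      unfolding R_def
      by (intro nat.ex nat.conj nat.prod_encode_eq nat.subst'[OF Q'(1)] npol_intros)
    have R: "R (j ## prod_encode (u, n) ## y ## v) \<longleftrightarrow> Q' (j ## u ## y ## n ## v)" for j u n y v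
      unfolding R_def by (auto simp: numeral_3_eq_3)
    show "(\<exists>n. Q (n ## v)) \<longleftrightarrow> (\<exists>u y. \<forall>j\<le>y. R (j ## u ## y ## v))" for v
    proof
      assume "\<exists>n. Q (n ## v)"
      then show "\<exists>u y. \<forall>j\<le>y. R (j ## u ## y ## v)" unfolding Q' R[symmetric] by blast
    next
      assume "\<exists>u y. \<forall>j\<le>y. R (j ## u ## y ## v)"
      then obtain u' y where "\<And>j. j \<le> y \<Longrightarrow> R (j ## u' ## y ## v)" by blast
      moreover obtain u n where "u' = prod_encode (u, n)" by (metis prod_decode_inverse surj_pair)
      ultimately show "\<exists>n. Q (n ## v)" unfolding Q' using R by blast
    qed
  qed
qed

lemma davis_subst:
  assumes "davis Q" "\<And>i. npol (\<sigma> i)"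
  shows "davis (\<lambda>v. Q (\<lambda>i. \<sigma> i v))"
proof -
  obtain Q' where Q': "ndioph Q'" "\<And>v. Q v \<longleftrightarrow> (\<exists>u y. \<forall>j\<le>y. Q' (j ## u ## y ## v))"
    using assms unfolding davis_def by blast
  show ?thesis
  proof (rule davisI)
    show "ndioph (\<lambda>x. Q' (x 0 ## x 1 ## x 2 ## (\<lambda>i. \<sigma> i (\<lambda>k. x (k + 3)))))"
      by (intro nat.subst'[OF Q'(1)] npol_scons nat.pol_var npol_subst[OF assms(2)])
  qed (simp add: Q' numeral_3_eq_3)
qed

interpretation davis: nat_class davis
proof
  show "davis (\<lambda>v. f v = g v)" if "npol f" "npol g" for f g
    using that by (intro ndioph_imp_davis nat.eq)
qed (auto intro: davis_conj davis_ex davis_subst)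

text \<open>The data u, y for the various k are coded by two beta pairs, and B bounds all the y. The
  nested quantifiers over k < n and i <= B are then merged into one over the index k (B + 1) +
  i.\<close>

lemma davis_all_scons:
  assumes "davis Q"
  shows "davis (\<lambda>x. \<forall>k<x 0. Q (k ## (\<lambda>i. x (Suc i))))"
proof -
  obtain Q' where Q': "ndioph Q'" "\<And>v. Q v \<longleftrightarrow> (\<exists>u y. \<forall>j\<le>y. Q' (j ## u ## y ## v))"
    using assms unfolding davis_def by blast
  define E where "E c d c' d' B = prod_encode (prod_encode (c, d), prod_encode (prod_encode (c', d'), B))"
    for c d c' d' B
  have E_inj: "E c d c' d' B = E a b a' b' B' \<longleftrightarrow> c = a \<and> d = b \<and> c' = a' \<and> d' = b' \<and> B = B'"
    for c d c' d' B a b a' b' B'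
    by (simp add: E_def)
  have E_ex: "u = E c d c' d' B \<longleftrightarrow> (\<exists>p q r. u = prod_encode (p, q) \<and> p = prod_encode (c, d) \<and>
      q = prod_encode (r, B) \<and> r = prod_encode (c', d'))" for u c d c' d' B
    by (auto simp: E_def)
  \<comment> \<open>The disjunct n <= k covers the last index n (B + 1), which the inclusive bound
    admits; y < i makes the padding up to B harmless.\<close>
  define S where "S c d c' d' B k i n v \<longleftrightarrow> n \<le> k \<or> (\<exists>u y. u = beta c d k \<and> y = beta c' d' k \<and> y \<le> B \<and>
    (y < i \<or> Q' (i ## u ## y ## k ## v)))" for c d c' d' B k i n v
  define R where "R x \<longleftrightarrow> (\<exists>c d c' d' B. x 1 = E c d c' d' B \<and> x 2 = x 3 * (B + 1) \<and>
    (\<exists>k i. x 0 = k * (B + 1) + i \<and> i \<le> B \<and> S c d c' d' B k i (x 3) (\<lambda>i. x (i + 4))))" for x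
  show ?thesis
  proof (rule davisI)
    show "ndioph R"
      unfolding R_def E_ex S_def
      by (intro nat.ex nat.conj nat.dioph_disj nat.prod_encode_eq nat.eq nat.le nat.less nat.beta_eq
          nat.subst'[OF Q'(1)] npol_intros)
    fix x :: "nat \<Rightarrow> nat"
    define n where "n = x 0"
    define v where "v = (\<lambda>i. x (Suc i))"
    have R: "R (I ## U ## Y ## x) \<longleftrightarrow> (\<exists>c d c' d' B. U = E c d c' d' B \<and> Y = n * (B + 1) \<and>
      (\<exists>k i. I = k * (B + 1) + i \<and> i \<le> B \<and> S c d c' d' B k i n v))" for I U Y
      unfolding R_def by (simp add: n_def v_def eval_nat_numeral)
    show "(\<forall>k<x 0. Q (k ## (\<lambda>i. x (Suc i)))) \<longleftrightarrow> (\<exists>u y. \<forall>j\<le>y. R (j ## u ## y ## x))"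
      unfolding n_def[symmetric] v_def[symmetric]
    proof
      assume "\<forall>k<n. Q (k ## v)"
      then have "\<forall>k. \<exists>u y. k < n \<longrightarrow> (\<forall>j\<le>y. Q' (j ## u ## y ## k ## v))" unfolding Q' by blast
      then obtain u y where uy: "\<And>k j. k < n \<Longrightarrow> j \<le> y k \<Longrightarrow> Q' (j ## u k ## y k ## k ## v)"
        by metis
      obtain c d where cd: "\<And>k. k < n \<Longrightarrow> beta c d k = u k" using beta_exists[of n u] by auto
      obtain c' d' where cd': "\<And>k. k < n \<Longrightarrow> beta c' d' k = y k" using beta_exists[of n y] by auto
      define B where "B = (\<Sum>k<n. y k)"
      have yB: "y k \<le> B" if "k < n" for k
        using that by (auto simp: B_def intro: member_le_sum)
      have "S c d c' d' B k i n v" for k i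
        unfolding S_def using uy[of k i] yB[of k] cd[of k] cd'[of k] by force
      moreover have "\<exists>k i. I = k * (B + 1) + i \<and> i \<le> B" for I
      proof -
        have "I mod (B + 1) < B + 1" by (rule mod_less_divisor) simp
        then have "I mod (B + 1) \<le> B" by (simp only: less_Suc_eq_le Suc_eq_plus1[symmetric])
        then show ?thesis using div_mult_mod_eq[of I "B + 1"] by metis
      qed
      ultimately have "R (I ## E c d c' d' B ## n * (B + 1) ## x)" for I
        unfolding R by blast
      then show "\<exists>u y. \<forall>j\<le>y. R (j ## u ## y ## x)" by blast
    next
      assume "\<exists>u y. \<forall>j\<le>y. R (j ## u ## y ## x)"
      then obtain U Y where UY: "\<And>I. I \<le> Y \<Longrightarrow> R (I ## U ## Y ## x)" by blast
      \<comment> \<open>Since E is injective, the data decoded at index 0 are the data at every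
        index.\<close>
      obtain c d c' d' B where U: "U = E c d c' d' B" and Y: "Y = n * (B + 1)"
        using UY[of 0] unfolding R by blast
      have S: "S c d c' d' B k i n v" if "k < n" "i \<le> B" for k i
      proof -
        have "k * (B + 1) + i \<le> Suc k * (B + 1)" using that by simp
        also have "\<dots> \<le> n * (B + 1)" using that by (intro mult_right_mono) auto
        finally have "R ((k * (B + 1) + i) ## U ## Y ## x)" using UY by (simp add: Y)
        then obtain k' i' where ki: "k * (B + 1) + i = k' * (B + 1) + i'" "i' \<le> B" "S c d c' d' B k' i' n v"
          unfolding R U E_inj by blast
        have "k' = k"
        proof -
          have "(a * (B + 1) + b) div (B + 1) = a" if "b \<le> B" for a b
            using div_mult_self3[of "B + 1" a b] that by simp
          then show ?thesis using ki(1,2) that(2) by metis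
        qed
        with ki show ?thesis by simp
      qed
      show "\<forall>k<n. Q (k ## v)"
      proof (intro allI impI)
        fix k assume k: "k < n"
        have yB: "beta c' d' k \<le> B" using S[OF k, of 0] k by (auto simp: S_def)
        have "Q' (i ## beta c d k ## beta c' d' k ## k ## v)" if "i \<le> beta c' d' k" for i
          using S[OF k, of i] k yB that by (auto simp: S_def)
        then show "Q (k ## v)" unfolding Q' by blast
      qed
    qed
  qed
qed

lemma davis_all:
  assumes "davis (\<lambda>v. Q (v 0) (\<lambda>i. v (Suc i)))" "npol f"
  shows "davis (\<lambda>v. \<forall>k<f v. Q k v)"
  using davis.subst'[OF davis_all_scons[OF assms(1)], of "\<lambda>v. f v ## v"] assms(2)
  by (simp add: npol_scons)

section \<open>Graphs of recursive functions\<close>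

lemma Cons_map_upt: "a # map y [0..<n] = map (a ## y) [0..<Suc n]"
proof -
  have "map (a ## y) [0..<Suc n] = map (a ## y) (0 # map Suc [0..<n])"
    by (simp only: map_Suc_upt upt_conv_Cons[OF zero_less_Suc])
  then show ?thesis by simp
qed

definition graph_rel :: "nat \<Rightarrow> (nat list \<Rightarrow> nat) \<Rightarrow> (nat \<Rightarrow> nat) \<Rightarrow> bool" where
  "graph_rel n f v \<longleftrightarrow> v 0 = f (map (\<lambda>i. v (Suc i)) [0..<n])"

lemma davis_graph:
  assumes "davis (graph_rel n f)" "npol a" "\<And>i. npol (\<lambda>v. b v i)"
  shows "davis (\<lambda>v. a v = f (map (b v) [0..<n]))"
  using davis.subst'[OF assms(1), of "\<lambda>v. a v ## b v"] assms(2,3)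
  by (simp add: graph_rel_def npol_scons)

text \<open>Composition adds only existential quantifiers. Primitive recursion guesses the sequence
  of values, coded by \<open>beta\<close>, and checks each step under a bounded quantifier;
  minimisation checks under one that all smaller arguments fail.\<close>

lemma recursive_fun_davis: "recursive_fun n f \<Longrightarrow> davis (graph_rel n f)"
proof (induction rule: recursive_fun.induct)
  case (zero n)
  show ?case unfolding graph_rel_def by (intro davis.eq npol_intros)
next
  case succ
  have "davis (\<lambda>v. v 0 = Suc (v 1))" by (intro davis.eq npol_intros)
  then show ?case by (simp add: graph_rel_def[abs_def])
next
  case (proj i n)
  have "davis (\<lambda>v. v 0 = v (Suc i))" by (intro davis.eq npol_intros)
  then show ?case using proj by (simp add: graph_rel_def[abs_def])
next
  case (comp gs f n)
  define m where "m = length gs"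
  \<comment> \<open>Positions below m hold the inner values, position m the result, and later ones
    the arguments.\<close>
  define Q where "Q y \<longleftrightarrow> (\<forall>i<m. y i = (gs ! i) (map (\<lambda>j. y (m + Suc j)) [0..<n])) \<and>
    y m = f (map y [0..<m])" for y :: "nat \<Rightarrow> nat"
  have "davis (\<lambda>y. y i = (gs ! i) (map (\<lambda>j. y (m + Suc j)) [0..<n]))" if "i < m" for i
    by (rule davis_graph) (use that comp.IH(2) in \<open>auto simp: m_def\<close>)
  moreover have "davis (\<lambda>y. y m = f (map (\<lambda>i. y i) [0..<m]))"
    by (rule davis_graph) (use comp.IH(1) in \<open>auto simp: m_def\<close>)
  ultimately have "davis Q"
    unfolding Q_def by (intro davis.conj davis.all_fin)
  then have "davis (\<lambda>v. \<exists>ys. length ys = m \<and> Q (ys @@ v))" by (rule davis.exs)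
  moreover have "graph_rel n (\<lambda>xs. f (map (\<lambda>g. g xs) gs)) v \<longleftrightarrow> (\<exists>ys. length ys = m \<and> Q (ys @@ v))" for v
  proof -
    define xs where "xs = map (\<lambda>i. v (Suc i)) [0..<n]"
    have "Q (ys @@ v) \<longleftrightarrow> ys = map (\<lambda>g. g xs) gs \<and> v 0 = f ys" if "length ys = m" for ys
    proof -
      have "map (ys @@ v) [0..<m] = ys"
        using that by (auto simp: append_val_def intro: nth_equalityI)
      moreover have "(\<lambda>j. (ys @@ v) (m + Suc j)) = (\<lambda>j. v (Suc j))" "(ys @@ v) m = v 0"
        using that by (auto simp: append_val_def)
      moreover have "(\<forall>i<m. (ys @@ v) i = (gs ! i) xs) \<longleftrightarrow> ys = map (\<lambda>g. g xs) gs"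
        using that by (auto simp: append_val_def m_def list_eq_iff_nth_eq)
      ultimately show ?thesis unfolding Q_def by (simp add: xs_def)
    qed
    then have "(\<exists>ys. length ys = m \<and> Q (ys @@ v)) \<longleftrightarrow>
        (\<exists>ys. length ys = m \<and> ys = map (\<lambda>g. g xs) gs \<and> v 0 = f ys)"
      by (simp cong: conj_cong)
    then show ?thesis by (auto simp: graph_rel_def xs_def m_def)
  qed
  ultimately show ?case by (simp add: fun_eq_iff[symmetric])
next
  case (prim_rec n f g)
  define h where "h xs = rec_nat (f (tl xs)) (\<lambda>k r. g (k # r # tl xs)) (hd xs)" for xs
  define Q where "Q v \<longleftrightarrow> (\<exists>c d. (\<exists>r. r = beta c d 0 \<and> r = f (map (\<lambda>i. v (Suc (Suc i))) [0..<n])) \<and>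
    (\<forall>k<v 1. \<exists>r r'. r = beta c d k \<and> r' = beta c d (Suc k) \<and>
       r' = g (map (k ## r ## (\<lambda>i. v (Suc (Suc i)))) [0..<Suc (Suc n)])) \<and> v 0 = beta c d (v 1))" for v
  have "davis Q"
    unfolding Q_def
    by (intro davis.ex davis.conj davis_all davis.beta_eq davis_graph[OF prim_rec.IH(1)]
        davis_graph[OF prim_rec.IH(2)] npol_intros)
  moreover have "graph_rel (Suc n) h v \<longleftrightarrow> Q v" for v
  proof -
    define ys where "ys = map (\<lambda>i. v (Suc (Suc i))) [0..<n]"
    define F where "F = rec_nat (f ys) (\<lambda>k r. g (k # r # ys))"
    have "map (\<lambda>i. v (Suc i)) [0..<Suc n] = v 1 # ys"
      by (simp only: ys_def upt_conv_Cons[OF zero_less_Suc] map_Suc_upt[symmetric] list.map map_map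
          o_def One_nat_def)
    then have "graph_rel (Suc n) h v \<longleftrightarrow> v 0 = F (v 1)"
      by (simp add: graph_rel_def h_def F_def del: upt_Suc)
    also have "\<dots> \<longleftrightarrow> (\<exists>c d. beta c d 0 = f ys \<and>
      (\<forall>k<v 1. beta c d (Suc k) = g (k # beta c d k # ys)) \<and> v 0 = beta c d (v 1))" (is "_ \<longleftrightarrow> ?R")
    proof
      assume "v 0 = F (v 1)"
      moreover obtain c d where "\<And>i. i < Suc (v 1) \<Longrightarrow> beta c d i = F i"
        using beta_exists[of "Suc (v 1)" F] by auto
      ultimately show ?R by (intro exI[of _ c] exI[of _ d]) (auto simp: F_def)
    next
      assume ?R
      then obtain c d where cd: "beta c d 0 = f ys"
        "\<And>k. k < v 1 \<Longrightarrow> beta c d (Suc k) = g (k # beta c d k # ys)" "v 0 = beta c d (v 1)" by blast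
      have "k \<le> v 1 \<Longrightarrow> beta c d k = F k" for k
        by (induction k) (simp_all add: cd F_def)
      then show "v 0 = F (v 1)" using cd(3) by simp
    qed
    also have "\<dots> \<longleftrightarrow> Q v"
      unfolding Q_def ys_def[symmetric] Cons_map_upt[symmetric] by simp
    finally show ?thesis .
  qed
  ultimately show ?case unfolding h_def[symmetric, abs_def] by (simp add: fun_eq_iff[symmetric])
next
  case (minimisation n f)
  define h where "h xs = (LEAST k. f (k # xs) = 0)" for xs
  \<comment> \<open>Nonvanishing is expressed positively, as being a successor.\<close>
  define Q where "Q v \<longleftrightarrow> 0 = f (map (v 0 ## (\<lambda>i. v (Suc i))) [0..<Suc n]) \<and>
    (\<forall>k<v 0. \<exists>w. Suc w = f (map (k ## (\<lambda>i. v (Suc i))) [0..<Suc n]))" for v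
  have "davis Q"
    unfolding Q_def
    by (intro davis.ex davis.conj davis_all davis_graph[OF minimisation.IH] npol_intros)
  moreover have "graph_rel n h v \<longleftrightarrow> Q v" for v
  proof -
    define xs where "xs = map (\<lambda>i. v (Suc i)) [0..<n]"
    have ex: "\<exists>k. f (k # xs) = 0" using minimisation.hyps by (simp add: xs_def)
    have "graph_rel n h v \<longleftrightarrow> v 0 = (LEAST k. f (k # xs) = 0)"
      by (simp add: graph_rel_def h_def xs_def)
    also have "\<dots> \<longleftrightarrow> f (v 0 # xs) = 0 \<and> (\<forall>k<v 0. f (k # xs) \<noteq> 0)"
      using LeastI_ex[OF ex] not_less_Least
      by (metis (mono_tags, lifting) Least_equality not_le_imp_less)
    also have "\<dots> \<longleftrightarrow> Q v"
    proof -
      have "(\<exists>w. Suc w = a) \<longleftrightarrow> a \<noteq> 0" for a by (cases a) auto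
      then show ?thesis
        unfolding Q_def Cons_map_upt[symmetric] xs_def[symmetric] by (simp add: eq_commute[of 0])
    qed
    finally show ?thesis .
  qed
  ultimately show ?case unfolding h_def[symmetric, abs_def] by (simp add: fun_eq_iff[symmetric])
qed

section \<open>Computability of the diagonal sentences\<close>

text \<open>Extensional equality on lists of the right length only, since values elsewhere carry no
  meaning.\<close>
definition computable :: "nat \<Rightarrow> (nat list \<Rightarrow> nat) \<Rightarrow> bool" where
  "computable n F \<longleftrightarrow> (\<exists>f. recursive_fun n f \<and> (\<forall>xs. length xs = n \<longrightarrow> f xs = F xs))"

lemma computable_nth: "i < n \<Longrightarrow> computable n (\<lambda>xs. xs ! i)"
  unfolding computable_def by (intro exI[of _ "\<lambda>xs. xs ! i"]) (simp add: recursive_fun.proj)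

lemma computable_comp1:
  assumes "computable 1 (\<lambda>xs. F (xs ! 0))" "computable n g"
  shows "computable n (\<lambda>xs. F (g xs))"
proof -
  obtain F' where F': "recursive_fun 1 F'" "\<And>xs. length xs = 1 \<Longrightarrow> F' xs = F (xs ! 0)"
    using assms(1) unfolding computable_def by blast
  obtain g' where g': "recursive_fun n g'" "\<And>xs. length xs = n \<Longrightarrow> g' xs = g xs"
    using assms(2) unfolding computable_def by blast
  have "recursive_fun n (\<lambda>xs. F' (map (\<lambda>h. h xs) [g']))"
    by (rule recursive_fun.comp) (use F'(1) g'(1) in auto)
  then show ?thesis unfolding computable_def using F'(2) g'(2)
    by (intro exI[of _ "\<lambda>xs. F' (map (\<lambda>h. h xs) [g'])"]) simp
qed

lemma computable_comp2:
  assumes "computable 2 (\<lambda>xs. F (xs ! 0) (xs ! 1))" "computable n g" "computable n h"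
  shows "computable n (\<lambda>xs. F (g xs) (h xs))"
proof -
  obtain F' where F': "recursive_fun 2 F'" "\<And>xs. length xs = 2 \<Longrightarrow> F' xs = F (xs ! 0) (xs ! 1)"
    using assms(1) unfolding computable_def by blast
  obtain g' where g': "recursive_fun n g'" "\<And>xs. length xs = n \<Longrightarrow> g' xs = g xs"
    using assms(2) unfolding computable_def by blast
  obtain h' where h': "recursive_fun n h'" "\<And>xs. length xs = n \<Longrightarrow> h' xs = h xs"
    using assms(3) unfolding computable_def by blast
  have "recursive_fun n (\<lambda>xs. F' (map (\<lambda>h. h xs) [g', h']))"
    by (rule recursive_fun.comp) (use F'(1) g'(1) h'(1) in \<open>auto simp: numeral_2_eq_2\<close>)
  then show ?thesis unfolding computable_def using F'(2) g'(2) h'(2)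
    by (intro exI[of _ "\<lambda>xs. F' (map (\<lambda>h. h xs) [g', h'])"]) simp
qed

lemma computable_Suc:
  assumes "computable n g"
  shows "computable n (\<lambda>xs. Suc (g xs))"
proof -
  have "computable 1 (\<lambda>xs. Suc (xs ! 0))"
    unfolding computable_def by (blast intro: recursive_fun.succ)
  from computable_comp1[of Suc, OF this assms] show ?thesis .
qed

lemma computable_const: "computable n (\<lambda>xs. c)"
proof (induction c)
  case 0
  show ?case unfolding computable_def by (blast intro: recursive_fun.zero)
qed (rule computable_Suc)

lemma computable_rec_nat:
  assumes "computable 1 (\<lambda>xs. F (xs ! 0))" "computable 3 (\<lambda>xs. G (xs ! 0) (xs ! 1) (xs ! 2))"
    and "computable n a" "computable n b"
  shows "computable n (\<lambda>xs. rec_nat (F (b xs)) (\<lambda>k r. G k r (b xs)) (a xs))"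
proof -
  obtain F' where F': "recursive_fun 1 F'" "\<And>xs. length xs = 1 \<Longrightarrow> F' xs = F (xs ! 0)"
    using assms(1) unfolding computable_def by blast
  obtain G' where G': "recursive_fun 3 G'" "\<And>xs. length xs = 3 \<Longrightarrow> G' xs = G (xs ! 0) (xs ! 1) (xs ! 2)"
    using assms(2) unfolding computable_def by blast
  define R where "R xs = rec_nat (F' (tl xs)) (\<lambda>k r. G' (k # r # tl xs)) (hd xs)" for xs
  have "recursive_fun (Suc 1) R"
    unfolding R_def by (rule recursive_fun.prim_rec) (use F'(1) G'(1) in \<open>simp_all add: numeral_3_eq_3\<close>)
  moreover have "R xs = rec_nat (F (xs ! 1)) (\<lambda>k r. G k r (xs ! 1)) (xs ! 0)" if "length xs = 2" for xs
  proof -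
    obtain x y where "xs = [x, y]"
      using \<open>length xs = 2\<close> by (auto simp: numeral_2_eq_2 length_Suc_conv)
    then show ?thesis by (simp add: R_def F'(2) G'(2))
  qed
  ultimately have "computable 2 (\<lambda>xs. rec_nat (F (xs ! 1)) (\<lambda>k r. G k r (xs ! 1)) (xs ! 0))"
    unfolding computable_def by (intro exI[of _ R]) (simp add: numeral_2_eq_2)
  from computable_comp2[of "\<lambda>x y. rec_nat (F y) (\<lambda>k r. G k r y) x", OF this assms(3,4)]
  show ?thesis .
qed

lemma computable_add:
  assumes "computable n f" "computable n g"
  shows "computable n (\<lambda>xs. f xs + g xs)"
proof -
  have "computable n (\<lambda>xs. rec_nat (g xs) (\<lambda>k r. Suc r) (f xs))"
    by (rule computable_rec_nat[of "\<lambda>y. y" "\<lambda>k r y. Suc r"])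
      (intro computable_nth computable_Suc assms; simp)+
  moreover have "rec_nat b (\<lambda>k r. Suc r) a = a + b" for a b :: nat
    by (induction a) auto
  ultimately show ?thesis by simp
qed

lemma computable_triangle:
  assumes "computable n f"
  shows "computable n (\<lambda>xs. triangle (f xs))"
proof -
  have "computable n (\<lambda>xs. rec_nat 0 (\<lambda>k r. r + Suc k) (f xs))"
    by (rule computable_rec_nat[of "\<lambda>y. 0" "\<lambda>k r y. r + Suc k", OF _ _ _ computable_const[of _ 0]])
      (intro computable_nth computable_Suc computable_add computable_const assms; simp)+
  moreover have "rec_nat 0 (\<lambda>k r. r + Suc k) a = triangle a" for a :: nat
    by (induction a) auto
  ultimately show ?thesis by simp
qed

lemma computable_prod_encode:
  assumes "computable n f" "computable n g"
  shows "computable n (\<lambda>xs. prod_encode (f xs, g xs))"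
proof -
  have "computable n (\<lambda>xs. triangle (f xs + g xs) + f xs)"
    by (intro computable_add computable_triangle assms)
  then show ?thesis by (simp add: prod_encode_def)
qed

section \<open>Numerals and the codes of diagonal sentences\<close>

primrec num_tm :: "nat \<Rightarrow> tm" where
  "num_tm 0 = Zero"
| "num_tm (Suc n) = Add One (num_tm n)"

lemma tm_val_num_tm: "tm_val v (num_tm n) = (\<lambda>_. of_nat n)"
  by (induction n) auto

lemma tm_vars_num_tm [simp]: "tm_vars (num_tm n) = {}"
  by (induction n) auto

lemma computable_num_tm:
  assumes "computable n f"
  shows "computable n (\<lambda>xs. tm_code (num_tm (f xs)))"
proof -
  have "computable n (\<lambda>xs. rec_nat (tm_code Zero) (\<lambda>k r. prod_encode (4, prod_encode (tm_code One, r))) (f xs))"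
    by (rule computable_rec_nat[of "\<lambda>y. tm_code Zero" "\<lambda>k r y. prod_encode (4, prod_encode (tm_code One, r))",
          OF _ _ _ computable_const[of _ 0]])
      (intro computable_nth computable_prod_encode computable_const assms; simp)+
  moreover have "rec_nat (tm_code Zero) (\<lambda>k r. prod_encode (4, prod_encode (tm_code One, r))) a
      = tm_code (num_tm a)" for a
    by (induction a) auto
  ultimately show ?thesis by simp
qed

text \<open>The sentence \<open>\<exists>x\<^sub>m \<dots> \<exists>x\<^sub>0. x\<^sub>0 = n \<and> q\<close>; with \<open>n = m = qf_code q\<close> it is
  closed and its code is a recursive function of \<open>n\<close>.\<close>
definition instance_pe :: "nat \<Rightarrow> nat \<Rightarrow> qf \<Rightarrow> pe" where
  "instance_pe m n q = foldr Ex (rev [0..<m]) (Matrix (Conj (Eq (Var 0) (num_tm n)) q))"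

text \<open>Pure arithmetic on n, which is used both as the code of the matrix and as the numeral.
  The recursion prefixes n + 1 quantifiers because the variables of q have indices up to its
  code.\<close>

definition diag_code :: "nat \<Rightarrow> nat" where
  "diag_code n = rec_nat (prod_encode (0, prod_encode (1, prod_encode (prod_encode (0,
       prod_encode (tm_code (Var 0), tm_code (num_tm n))), n))))
     (\<lambda>k r. prod_encode (1, prod_encode (k, r))) (Suc n)"

lemma diag_code: "diag_code (qf_code q) = pe_code (instance_pe (Suc (qf_code q)) (qf_code q) q)"
proof -
  have "pe_code (instance_pe m n q) = rec_nat (pe_code (instance_pe 0 n q))
      (\<lambda>k r. prod_encode (1, prod_encode (k, r))) m" for m n
    by (induction m) (simp_all add: instance_pe_def)
  then show ?thesis by (simp add: diag_code_def instance_pe_def)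
qed

lemma computable_diag_code: "computable 1 (\<lambda>xs. diag_code (xs ! 0))"
proof -
  let ?F = "\<lambda>y. prod_encode (0, prod_encode (1, prod_encode (prod_encode (0,
       prod_encode (tm_code (Var 0), tm_code (num_tm y))), y)))"
  let ?G = "\<lambda>k r y :: nat. prod_encode (1, prod_encode (k, r))"
  have F: "computable 1 (\<lambda>xs. ?F (xs ! 0))"
    by (rule computable_prod_encode computable_num_tm computable_nth computable_const | simp)+
  have G: "computable 3 (\<lambda>xs. ?G (xs ! 0) (xs ! 1) (xs ! 2))"
    by (rule computable_prod_encode computable_nth computable_const | simp)+
  have "computable 1 (\<lambda>xs. Suc (xs ! 0))" "computable 1 (\<lambda>xs. xs ! 0)"
    by (rule computable_Suc computable_nth | simp)+
  from computable_rec_nat[of ?F ?G 1, OF F G this] show ?thesis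
    by (simp only: diag_code_def)
qed

section \<open>Quantifier prefixes and bounds on variable indices\<close>

lemma pe_free_foldr_Ex: "pe_free (foldr Ex is p) = pe_free p - set is"
  by (induction "is") auto

lemma pe_sat_foldr_Ex:
  assumes "A \<noteq> {}"
  shows "pe_sat A v (foldr Ex is p) \<longleftrightarrow>
    (\<exists>w. (\<forall>i. w i \<in> A) \<and> pe_sat A (\<lambda>i. if i \<in> set is then w i else v i) p)"
proof (induction "is" arbitrary: v)
  case (Cons m "is")
  show ?case
  proof
    assume "pe_sat A v (foldr Ex (m # is) p)"
    then obtain y w where "y \<in> A" "\<forall>i. w i \<in> A"
      and p: "pe_sat A (\<lambda>i. if i \<in> set is then w i else (v(m := y)) i) p"
      by (auto simp: Cons)
    \<comment> \<open>An inner quantifier over the same variable shadows the outer one, so w takes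
      precedence over y.\<close>
    define w' where "w' i = (if i \<in> set is then w i else y)" for i
    have "(\<lambda>i. if i \<in> set is then w i else (v(m := y)) i)
        = (\<lambda>i. if i \<in> set (m # is) then w' i else v i)"
      by (auto simp: w'_def)
    with p have "pe_sat A (\<lambda>i. if i \<in> set (m # is) then w' i else v i) p" by simp
    moreover have "\<forall>i. w' i \<in> A" using \<open>y \<in> A\<close> \<open>\<forall>i. w i \<in> A\<close> by (simp add: w'_def)
    ultimately show "\<exists>w. (\<forall>i. w i \<in> A) \<and> pe_sat A (\<lambda>i. if i \<in> set (m # is) then w i else v i) p"
      by blast
  next
    assume "\<exists>w. (\<forall>i. w i \<in> A) \<and> pe_sat A (\<lambda>i. if i \<in> set (m # is) then w i else v i) p"
    then obtain w where w: "\<forall>i. w i \<in> A" "pe_sat A (\<lambda>i. if i \<in> set (m # is) then w i else v i) p"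
      by blast
    have eq: "(\<lambda>i. if i \<in> set is then w i else (v(m := w m)) i)
        = (\<lambda>i. if i \<in> set (m # is) then w i else v i)"
      by auto
    have "pe_sat A (\<lambda>i. if i \<in> set is then w i else (v(m := w m)) i) p" unfolding eq by (rule w(2))
    then have "pe_sat A (v(m := w m)) (foldr Ex is p)"
      unfolding Cons using w(1) by (intro exI[of _ w]) simp
    then show "pe_sat A v (foldr Ex (m # is) p)" using w(1) by auto
  qed
qed (use assms in auto)

lemma le_prod_encodeI:
  "n \<le> a \<Longrightarrow> n \<le> prod_encode (a, b)" "n \<le> b \<Longrightarrow> n \<le> prod_encode (a, b)"
  by (erule order_trans, rule le_prod_encode_1 le_prod_encode_2)+

lemma tm_vars_le_code: "i \<in> tm_vars t \<Longrightarrow> i \<le> tm_code t"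
proof (induction t)
  case (Add s t)
  then have "i \<le> tm_code s \<or> i \<le> tm_code t" by auto
  then show ?case by (auto intro: le_prod_encodeI)
next
  case (Mul s t)
  then have "i \<le> tm_code s \<or> i \<le> tm_code t" by auto
  then show ?case by (auto intro: le_prod_encodeI)
qed (auto intro: le_prod_encodeI)

text \<open>Yields a quantifier prefix that closes q and whose length is computable from the code
  alone.\<close>

lemma qf_vars_le_code: "i \<in> qf_vars q \<Longrightarrow> i \<le> qf_code q"
proof (induction q)
  case (Eq s t)
  then have "i \<le> tm_code s \<or> i \<le> tm_code t" by (auto dest: tm_vars_le_code)
  then show ?case by (auto intro: le_prod_encodeI)
next
  case (Conj p q)
  then have "i \<le> qf_code p \<or> i \<le> qf_code q" by auto
  then show ?case by (auto intro: le_prod_encodeI)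
next
  case (Disj p q)
  then have "i \<le> qf_code p \<or> i \<le> qf_code q" by auto
  then show ?case by (auto intro: le_prod_encodeI)
qed

section \<open>Undecidability\<close>

lemma tm_val_subst: "tm_val v (tm_subst \<sigma> t) = tm_val (\<lambda>i. tm_val v (\<sigma> i)) t"
  by (induction t) auto

lemma qf_sat_subst: "qf_sat v (qf_subst \<sigma> q) \<longleftrightarrow> qf_sat (\<lambda>i. tm_val v (\<sigma> i)) q"
  by (induction q) (auto simp: tm_val_subst)

context lacunary_ring begin

text \<open>The normal form contributes exactly one bounded quantifier over a polynomial matrix,
  which is what the elimination in the ring can treat.\<close>

lemma davis_imp_adioph:
  assumes "davis R"
  shows "adioph R"
proof -
  obtain Q where Q: "ndioph Q" "\<And>v. R v \<longleftrightarrow> (\<exists>u y. \<forall>j\<le>y. Q (j ## u ## y ## v))"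
    using assms unfolding davis_def by blast
  have "adioph (\<lambda>x. \<forall>k<Suc (x 1). Q (k ## x))"
    by (intro adioph_bounded_all Q(1) npol_intros)
  from ad.ex_scons[OF ad.ex_scons[OF this]]
  have "adioph (\<lambda>v. \<exists>y u. \<forall>k<Suc y. Q (k ## u ## y ## v))" by simp
  moreover have "R v \<longleftrightarrow> (\<exists>y u. \<forall>k<Suc y. Q (k ## u ## y ## v))" for v
    unfolding Q less_Suc_eq_le by blast
  ultimately show ?thesis by presburger
qed

text \<open>When every free variable takes the value f, all of them collapse to
  \<open>Var 0\<close>, and the witnesses fill the later positions.\<close>

lemma dioph_unary:
  assumes "dioph R"
  obtains q where "\<And>f. f \<in> A \<Longrightarrow> R (\<lambda>_. f) \<longleftrightarrow> (\<exists>w. (\<forall>i. w i \<in> A) \<and> qf_sat (f ## w) q)"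
proof -
  obtain q where q: "\<And>v. (\<And>i. v i \<in> A) \<Longrightarrow> R v \<longleftrightarrow> (\<exists>w. (\<forall>i. w i \<in> A) \<and> qf_sat (mix v w) q)"
    using assms unfolding dioph_def by metis
  define \<rho> where "\<rho> i = (if even i then Var 0 else Var (Suc (i div 2)))" for i :: nat
  have "(\<lambda>i. tm_val (f ## w) (\<rho> i)) = mix (\<lambda>_. f) w" for f w
    by (auto simp: \<rho>_def mix_def)
  then have "qf_sat (f ## w) (qf_subst \<rho> q) \<longleftrightarrow> qf_sat (mix (\<lambda>_. f) w) q" for f w
    by (simp add: qf_sat_subst)
  then show ?thesis using q by (intro that[of "qf_subst \<rho> q"]) simp
qed

lemma A_nonempty: "A \<noteq> {}"
  using A_id by blast

lemma ex_scons_iff: "(\<exists>w. (\<forall>i. w i \<in> A) \<and> P (f ## w)) \<longleftrightarrow> (\<exists>w. (\<forall>i. w i \<in> A) \<and> w 0 = f \<and> P w)"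
  if "f \<in> A"
proof
  assume "\<exists>w. (\<forall>i. w i \<in> A) \<and> P (f ## w)"
  then obtain w where "\<forall>i. w i \<in> A" "P (f ## w)" by blast
  then show "\<exists>w. (\<forall>i. w i \<in> A) \<and> w 0 = f \<and> P w"
    using that by (intro exI[of _ "f ## w"]) (simp add: scons_in)
next
  assume "\<exists>w. (\<forall>i. w i \<in> A) \<and> w 0 = f \<and> P w"
  then obtain w where w: "\<forall>i. w i \<in> A" "w 0 = f" "P w" by blast
  have "f ## (\<lambda>i. w (Suc i)) = w"
  proof
    show "(f ## (\<lambda>i. w (Suc i))) i = w i" for i using w(2) by (cases i) auto
  qed
  then show "\<exists>w. (\<forall>i. w i \<in> A) \<and> P (f ## w)"
    using w by (intro exI[of _ "\<lambda>i. w (Suc i)"]) simp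
qed

theorem pe_definable_integers: "pe_definable A integer_constants"
proof -
  have "dioph (\<lambda>v. is_int (v 0))" by (rule dioph_is_int[OF pol_var])
  then obtain q where q: "\<And>f. f \<in> A \<Longrightarrow> is_int f \<longleftrightarrow> (\<exists>w. (\<forall>i. w i \<in> A) \<and> qf_sat (f ## w) q)"
    using dioph_unary[of "\<lambda>v. is_int (v 0)"] by blast
  define \<phi> where "\<phi> = foldr Ex [1..<Suc (qf_code q)] (Matrix q)"
  have "pe_free \<phi> \<subseteq> {0}"
    using qf_vars_le_code[of _ q] by (fastforce simp: \<phi>_def pe_free_foldr_Ex)
  moreover have "pe_sat A (\<lambda>_. f) \<phi> \<longleftrightarrow> is_int f" if "f \<in> A" for f
  proof -
    define J where "J = set [1..<Suc (qf_code q)]"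
    have J: "0 \<notin> J" "\<And>i. i \<in> qf_vars q \<Longrightarrow> i \<notin> J \<Longrightarrow> i = 0"
      using qf_vars_le_code[of _ q] by (force simp: J_def)+
    have "qf_sat (\<lambda>i. if i \<in> J then w i else f) q \<longleftrightarrow> qf_sat w q" if "w 0 = f" for w
      by (rule qf_sat_cong) (use that J in auto)
    then have *: "(\<exists>w. (\<forall>i. w i \<in> A) \<and> w 0 = f \<and> qf_sat (\<lambda>i. if i \<in> J then w i else f) q)
        \<longleftrightarrow> is_int f"
      unfolding q[OF \<open>f \<in> A\<close>] ex_scons_iff[OF \<open>f \<in> A\<close>, of "\<lambda>w. qf_sat w q"]
      by (simp cong: conj_cong)
    \<comment> \<open>Index 0 lies outside the prefix, so w 0 is never read and may be set to
      f.\<close>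
    have "(\<exists>w. (\<forall>i. w i \<in> A) \<and> qf_sat (\<lambda>i. if i \<in> J then w i else f) q)
      \<longleftrightarrow> (\<exists>w. (\<forall>i. w i \<in> A) \<and> w 0 = f \<and> qf_sat (\<lambda>i. if i \<in> J then w i else f) q)"
    proof
      assume "\<exists>w. (\<forall>i. w i \<in> A) \<and> qf_sat (\<lambda>i. if i \<in> J then w i else f) q"
      then obtain w where w: "\<forall>i. w i \<in> A" "qf_sat (\<lambda>i. if i \<in> J then w i else f) q" by blast
      have "(\<lambda>i. if i \<in> J then w i else f) = (\<lambda>i. if i \<in> J then (w(0 := f)) i else f)"
        using J(1) by (intro ext) auto
      with w(2) have "qf_sat (\<lambda>i. if i \<in> J then (w(0 := f)) i else f) q" by simp
      moreover have "\<forall>i. (w(0 := f)) i \<in> A" using w(1) \<open>f \<in> A\<close> by simp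
      moreover have "(w(0 := f)) 0 = f" by simp
      ultimately show "\<exists>w. (\<forall>i. w i \<in> A) \<and> w 0 = f \<and> qf_sat (\<lambda>i. if i \<in> J then w i else f) q"
        by blast
    qed blast
    with * show ?thesis
      unfolding \<phi>_def pe_sat_foldr_Ex[OF A_nonempty] J_def[symmetric] pe_sat.simps by simp
  qed
  moreover have "integer_constants \<subseteq> A" by (auto simp: integer_constants_def)
  ultimately have "integer_constants = {f \<in> A. pe_sat A (\<lambda>_. f) \<phi>}"
    by (auto simp: is_int_iff integer_constants_def)
  with \<open>pe_free \<phi> \<subseteq> {0}\<close> show ?thesis unfolding pe_definable_def by blast
qed

text \<open>Diagonal argument: q says of x that the decision function D rejects
  \<open>diag_code\<close> x. Instantiated at the code m of q, it becomes a sentence with code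
  \<open>diag_code m\<close> that holds exactly when D rejects that code.\<close>

theorem pe_theory_undecidable: "\<not> pe_theory_decidable A"
proof
  assume "pe_theory_decidable A"
  then obtain D where D: "recursive_fun 1 D"
    "\<And>n. D [n] = (if n \<in> pe_code ` pe_theory A then 1 else 0)"
    unfolding pe_theory_decidable_def decidable_nat_set_def by blast
  obtain H where H: "recursive_fun 1 H" "\<And>n. H [n] = diag_code n"
    using computable_diag_code unfolding computable_def by force
  define g where "g = (\<lambda>xs. D (map (\<lambda>h. h xs) [H]))"
  have g: "g [n] = D [diag_code n]" for n by (simp add: g_def H(2))
  have "recursive_fun 1 g"
    unfolding g_def by (rule recursive_fun.comp) (use D(1) H(1) in auto)
  then have "davis (graph_rel 1 g)" by (rule recursive_fun_davis)
  then have "davis (\<lambda>v. 0 = g (map (\<lambda>i. v i) [0..<1]))" by (rule davis_graph) (intro npol_intros)+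
  then have "adioph (\<lambda>v. 0 = g [v 0])" by (intro davis_imp_adioph) simp
  then obtain R where R: "dioph R" "\<And>x. 0 = g [x 0] \<longleftrightarrow> R (cval x)"
    unfolding adioph_def by blast
  obtain q where q: "\<And>f. f \<in> A \<Longrightarrow> R (\<lambda>_. f) \<longleftrightarrow> (\<exists>w. (\<forall>i. w i \<in> A) \<and> qf_sat (f ## w) q)"
    using dioph_unary[OF R(1)] by metis
  define m where "m = qf_code q"
  define c where "c = (\<lambda>_::complex. of_nat m :: complex)"
  define \<phi> where "\<phi> = instance_pe (Suc m) m q"
  have m: "i \<le> m" if "i \<in> qf_vars q" for i
    unfolding m_def using that by (rule qf_vars_le_code)
  have "0 = g [m] \<longleftrightarrow> R (\<lambda>_. c)"
  proof -
    have "cval (\<lambda>_. m) = (\<lambda>_. c)" by (simp add: cval_def c_def fun_eq_iff)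
    then show ?thesis using R(2)[of "\<lambda>_. m"] by simp
  qed
  also have "\<dots> \<longleftrightarrow> (\<exists>w. (\<forall>i. w i \<in> A) \<and> w 0 = c \<and> qf_sat w q)"
    unfolding q[OF A_const, of "of_nat m", folded c_def] by (rule ex_scons_iff) (simp add: c_def)
  also have "\<dots> \<longleftrightarrow> pe_sat A (\<lambda>_ _. 0) \<phi>"
  proof -
    \<comment> \<open>No variable of q exceeds m, so the default 0 outside the prefix does not
      affect the matrix.\<close>
    have "qf_sat (\<lambda>i. if i < Suc m then w i else (\<lambda>_. 0)) q \<longleftrightarrow> qf_sat w q" for w
      by (rule qf_sat_cong) (use m in \<open>auto simp: less_Suc_eq_le\<close>)
    then show ?thesis
      unfolding \<phi>_def instance_pe_def pe_sat_foldr_Ex[OF A_nonempty]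
      by (simp add: tm_val_num_tm c_def del: upt_Suc)
  qed
  also have "\<dots> \<longleftrightarrow> \<phi> \<in> pe_theory A"
  proof -
    have "pe_free \<phi> = {}" using m by (auto simp: \<phi>_def instance_pe_def pe_free_foldr_Ex less_Suc_eq_le simp del: upt_Suc)
    then show ?thesis by (simp add: pe_theory_def)
  qed
  also have "\<dots> \<longleftrightarrow> diag_code m \<in> pe_code ` pe_theory A"
    unfolding m_def diag_code \<phi>_def using inj_pe_code by (auto dest: injD)
  finally show False using D(2)[of "diag_code m"] by (auto simp: g split: if_splits)
qed

end

theorem theorem1p2:
  fixes A :: "(complex \<Rightarrow> complex) set"
  assumes "fun_subring A"
    and "poly_funs \<subseteq> A"
    and "A \<subseteq> H_fin"
    and "\<And>f. f \<in> A \<Longrightarrow> lacunary f"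
  shows "pe_definable A integer_constants \<and> \<not> pe_theory_decidable A"
proof -
  interpret lacunary_ring A using assms by unfold_locales
  show ?thesis using pe_definable_integers pe_theory_undecidable by simp
qed

end
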